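(* Let $\pi_{\mathcal B}:\mathcal B\to\mathbb B$ be a material bundle. For $F\in\mathrm{Conf}(T\mathcal B,T\mathcal E)$ with punctual shadow $\varphi$, set $$\mathbb I(F)=\big(F^*\mathfrak g_v^v,\;F^*\vartheta,\;F^*\gamma,\;(T\varphi)^*\gamma\big)\in \mathcal S_v^{++}(\mathcal B)\times \mathrm{Sold}(\mathcal B)\times\mathrm{Con}(\mathcal B)\times\mathrm{Con}(\mathcal B),$$ which is also equal to $\big((T\varphi)^*\mathfrak g_v^v,\;(T\varphi)^*\vartheta,\;F^*\gamma,\;(T\varphi)^*\gamma\big)$. Then $\mathbb I$ is constant on the orbits of the action of $T\mathfrak{Gal}$ on $\mathrm{Conf}(T\mathcal B,T\mathcal E)$ by left composition $(O,F)\mapsto O\circ F$, and it induces a bijection $$\mathrm{Conf}(T\mathcal B,T\mathcal E)/T\mathfrak{Gal}\;\longrightarrow\;\mathrm{Im}(\mathbb I).$$ In other words, $\mathbb I$ is complete: for all $F_1,F_2\in\mathrm{Conf}(T\mathcal B,T\mathcal E)$, the orbits of $F_1$ and $F_2$ under $T\mathfrak{Gal}$ are equal if and only if $\mathbb I(F_1)=\mathbb I(F_2)$.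
   Context: Smooth means at least $C^1$ (maps are understood to be regular enough that the tangent maps occurring are again smooth). Affine bundles. An affine (resp. vector) bundle $\pi_{A}:A\to\mathbb A$ is a smooth surjection between smooth connected orientable manifolds which is locally trivial with typical fibre a finite-dimensional real affine (resp. vector) space $F_A$, with transition maps affine (resp. linear) on the fibres; its rank is $\dim F_A$. Affine trivialising coordinates are local coordinates $(\bar x,y)$ on $A$ with $\bar x$ coordinates on $\mathbb A$ and $y$ affine coordinates on each fibre; they induce coordinates $(\bar x,y,\delta\bar x,\delta y)$ on $TA$ ("vectorial coordinates" $(\delta \bar x,\delta y)$). $VA=\ker T\pi_A\subset TA$. A connection on $A$ is a smooth map $\gamma:A\times_{\mathbb A}T\mathbb A\to TA$ such that each $\gamma_a=\gamma(a,\cdot):T_{\bar a}\mathbb A\to T_aA$ (where $\bar a=\pi_A(a)$) is linear with $T\pi_A\circ\gamma_a=\mathrm{Id}$, and such that, in affine trivialising coordinates, for fixed $\bar u$, the vectorial coordinates of $\gamma(a,\bar u)$ are affine in the vertical coordinate $y$ of $a$. A solder form on $A$ is a smooth injective map $\vartheta:A\times_{\mathbb A}T\mathbb A\to TA$ such that each $\vartheta_a:T_{\bar a}\mathbb A\to V_aA$ is linear with values in $V_aA$, and the vectorial coordinates of $\vartheta(a,\bar u)$ are affine in the vertical coordinate of $a$. $\mathrm{Con}(A)$, $\mathrm{Sold}(A)$ denote the sets of these. $\mathcal S^{++}_v(\mathcal B)$ is the set of micro-metrics on $\mathcal B$: smooth families of Riemannian metrics on the fibres $\mathcal B_{\bar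 X}$, $\bar X\in\mathbb B$ (equivalently, on $V\mathcal B$). Ambient space. $\mathbb E=\mathbb R^3$ with Euclidean metric $\mathbf g$; $\mathcal E=\mathbb R^3\times\mathbb R^3\ni(\bar x,y)$ with $\pi_{\mathcal E}(\bar x,y)=\bar x$. In the canonical ("holonomic") coordinates, the connection is $\gamma_{(\bar x,y)}(\delta\bar x)=((\bar x,y),(\delta\bar x,0))$, the solder form is $\vartheta_{(\bar x,y)}(\delta\bar x)=((\bar x,y),(0,\delta\bar x))$, the projection of interpretation is $\iota:T\mathcal E\to T\mathbb E$, $((\bar x,y),(\delta\bar x,\delta y))\mapsto(\bar x,\delta\bar x+\delta y)$, and the pseudo-metric is $\mathfrak g=\iota^*\mathbf g$. $\mathfrak g_v^v$ is the restriction of $\mathfrak g$ to $V\mathcal E$ (i.e. $|\delta y|^2$). Material bundle. $\pi_{\mathcal B}:\mathcal B\to\mathbb B$ is an affine bundle of rank $3$, $\dim\mathbb B\in\{1,2,3\}$. Placements. For affine bundles $A\to\mathbb A$, $D\to\mathbb D$, $\mathrm{Aff}(A,D)$ is the set of smooth maps $\ell:A\to D$ such that there is a smooth $\bar\ell:\mathbb A\to\mathbb D$ with $\pi_D\circ\ell=\bar\ell\circ\pi_A$, and $\ell$ is affine on each fibre. A smooth map $L:TA\to TD$ is physically acceptable, $L\in\mathcal L_{pa}(TA,TD)$, if: (1) $L$ is a vector bundle morphism $TA\to TD$ over some $\ell\in\mathrm{Aff}(A,D)$ (its punctual shadow); (2) $T\pi_D\circ L=\bar L\circ T\pi_A$ with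 $\bar L:=T\bar\ell$; (3) $L|_{VA}=(T\ell)|_{VA}$; (4) in affine trivialising coordinates, the vectorial coordinates of $L_a u$ (for fixed vectorial coordinates of $u\in T_aA$) are affine in the vertical coordinate of $a$. $\mathrm{Conf}(T\mathcal B,T\mathcal E)$ is the set of $F\in\mathcal L_{pa}(T\mathcal B,T\mathcal E)$ that are differential embeddings and whose punctual shadow $\varphi:\mathcal B\to\mathcal E$ is a differential embedding (injective, homeomorphism onto the image, injective differential). Pull-backs. For such $F$ with shadow $\varphi$: $(F^*\gamma)_X=F_X^{-1}\circ\gamma_{\varphi(X)}\circ\bar F$ and $(F^*\vartheta)_X=F_X^{-1}\circ\vartheta_{\varphi(X)}\circ\bar F$ for $X\in\mathcal B$ (well defined since $F_X$ is injective and $F_X(V_X\mathcal B)=V_{\varphi(X)}\mathcal E$), and $F^*\mathfrak g_v^v$ is the form $(U,W)\mapsto\langle FU,FW\rangle_{\mathfrak g}$ on $V\mathcal B$. The same definitions apply with $T\varphi$ in place of $F$. Galilean group. $\mathrm{Gal}$ is the group of maps $\bar x\mapsto R\bar x+\bar t$ of $\mathbb R^3$ with $R\in O(3)$, $\bar t\in\mathbb R^3$; $T\mathrm{Gal}=\{T O: O\in\mathrm{Gal}\}$. The generalised Galilean group is $T\mathfrak{Gal}=\{Ta: a\in\mathrm{Aff}(\mathcal E,\mathcal E),\ \exists\, O\in T\mathrm{Gal},\ \iota\circ Ta=O\circ\iota\}$. *)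

theory Defs
  imports "HOL-Analysis.Analysis" "HOL-Algebra.Group_Action" "HOL-Library.Extended_Nat"
begin

section \<open>Regularity\<close>

text \<open>
  Throughout, "smooth" is made precise by a regularity \<open>r\<close> with \<open>1 \<le> r \<le> \<infinity>\<close>: maps living on
  tangent bundles are of class \<open>C^r\<close>, while manifolds and the maps that get differentiated
  are of class \<open>C^(r+1)\<close>. The case \<open>r = \<infinity>\<close> is the smooth category in the usual sense.
  The two predicates below are only meant for open sets \<open>S\<close>.
\<close>

primrec Ck_on :: "nat \<Rightarrow> ('a::euclidean_space \<Rightarrow> 'c::real_normed_vector) \<Rightarrow> 'a set \<Rightarrow> bool" where
  "Ck_on 0 f S \<longleftrightarrow> continuous_on S f"
| "Ck_on (Suc k) f S \<longleftrightarrow>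
     (\<forall>x\<in>S. f differentiable (at x)) \<and> (\<forall>v. Ck_on k (\<lambda>x. frechet_derivative f (at x) v) S)"

definition Cr_on :: "enat \<Rightarrow> ('a::euclidean_space \<Rightarrow> 'c::real_normed_vector) \<Rightarrow> 'a set \<Rightarrow> bool" where
  "Cr_on r f S \<longleftrightarrow> (\<forall>k::nat. enat k \<le> r \<longrightarrow> Ck_on k f S)"

definition affine_fun :: "('a::real_vector \<Rightarrow> 'c::real_vector) \<Rightarrow> bool" where
  "affine_fun f \<longleftrightarrow> linear (\<lambda>y. f y - f 0)"

text \<open>Determinant of an endomorphism of a Euclidean space (Leibniz formula in the basis \<open>Basis\<close>).\<close>

definition lin_det :: "('e::euclidean_space \<Rightarrow> 'e) \<Rightarrow> real" where
  "lin_det L = (\<Sum>p | p permutes (Basis::'e set). of_int (sign p) * (\<Prod>b\<in>Basis. L b \<bullet> p b))"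


section \<open>Manifolds and tangent bundles\<close>

text \<open>
  A manifold is given by an atlas, which need not be maximal. A chart is a domain together with
  a coordinate map, only meaningful on the domain. The dimension is that of the model space \<open>'e\<close>.
\<close>

type_synonym ('p, 'e) chart = "'p set \<times> ('p \<Rightarrow> 'e)"
type_synonym ('p, 'e) atlas = "('p, 'e) chart set"

definition points :: "('p, 'e) atlas \<Rightarrow> 'p set" where
  "points A = \<Union>(fst ` A)"

definition charts_at :: "('p, 'e) atlas \<Rightarrow> 'p \<Rightarrow> ('p, 'e) chart set" where
  "charts_at A p = {c \<in> A. p \<in> fst c}"

definition of_coords :: "('p, 'e) chart \<Rightarrow> 'e \<Rightarrow> 'p" where
  "of_coords c = inv_into (fst c) (snd c)"

definition transition :: "('p, 'e) chart \<Rightarrow> ('p, 'e) chart \<Rightarrow> 'e \<Rightarrow> 'e" where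
  "transition c d = snd d \<circ> of_coords c"

definition smooth_atlas :: "enat \<Rightarrow> ('p, 'e::euclidean_space) atlas \<Rightarrow> bool" where
  "smooth_atlas s A \<longleftrightarrow>
     (\<forall>c\<in>A. inj_on (snd c) (fst c) \<and> open (snd c ` fst c)) \<and>
     (\<forall>c\<in>A. \<forall>d\<in>A. open (snd c ` (fst c \<inter> fst d)) \<and>
        Cr_on s (transition c d) (snd c ` (fst c \<inter> fst d)))"

definition man_topology :: "('p, 'e::euclidean_space) atlas \<Rightarrow> 'p topology" where
  "man_topology A = topology_generated_by {fst c \<inter> snd c -` S | c S. c \<in> A \<and> open S}"

text \<open>Orientability: some compatible atlas has transition maps of positive Jacobian.\<close>

definition orientable :: "enat \<Rightarrow> ('p, 'e::euclidean_space) atlas \<Rightarrow> bool" where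
  "orientable s A \<longleftrightarrow> (\<exists>A'. points A' = points A \<and> smooth_atlas s (A \<union> A') \<and>
     (\<forall>c\<in>A'. \<forall>d\<in>A'. \<forall>p\<in>fst c \<inter> fst d.
        0 < lin_det (frechet_derivative (transition c d) (at (snd c p)))))"

definition manifold :: "enat \<Rightarrow> ('p, 'e::euclidean_space) atlas \<Rightarrow> bool" where
  "manifold s A \<longleftrightarrow> smooth_atlas s A \<and> Hausdorff_space (man_topology A) \<and>
     second_countable (man_topology A)"

definition smooth_map :: "enat \<Rightarrow> ('p, 'e::euclidean_space) atlas \<Rightarrow> ('q, 'd::euclidean_space) atlas
    \<Rightarrow> ('p \<Rightarrow> 'q) \<Rightarrow> bool" where
  "smooth_map s A D f \<longleftrightarrow> f \<in> points A \<rightarrow> points D \<and>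
     (\<forall>c\<in>A. \<forall>d\<in>D. open (snd c ` (fst c \<inter> f -` fst d)) \<and>
        Cr_on s (snd d \<circ> f \<circ> of_coords c) (snd c ` (fst c \<inter> f -` fst d)))"

text \<open>
  A tangent vector is a base point together with its family of coordinate vectors, one for each
  chart at the point, related by the differentials of the transition maps; the family is
  \<open>0\<close> on all other charts.
\<close>

type_synonym ('p, 'e) tvec = "'p \<times> (('p, 'e) chart \<Rightarrow> 'e)"

definition tangent_space :: "('p, 'e::euclidean_space) atlas \<Rightarrow> 'p \<Rightarrow> ('p, 'e) tvec set" where
  "tangent_space A p = {(p, v) | v. p \<in> points A \<and>
     (\<forall>c\<in>charts_at A p. \<forall>d\<in>charts_at A p.
        v d = frechet_derivative (transition c d) (at (snd c p)) (v c)) \<and>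
     (\<forall>c. c \<notin> charts_at A p \<longrightarrow> v c = 0)}"

definition tangent :: "('p, 'e::euclidean_space) atlas \<Rightarrow> ('p, 'e) tvec set" where
  "tangent A = (\<Union>p\<in>points A. tangent_space A p)"

definition tangent_atlas ::
    "('p, 'e::euclidean_space) atlas \<Rightarrow> (('p, 'e) tvec, 'e \<times> 'e) atlas" where
  "tangent_atlas A =
     (\<lambda>c. ({u \<in> tangent A. fst u \<in> fst c}, \<lambda>u. (snd c (fst u), snd u c))) ` A"

text \<open>The tangent vector at \<open>p\<close> with coordinates \<open>w\<close> in the chart \<open>c\<close> at \<open>p\<close>.\<close>

definition tvec_of :: "('p, 'e::euclidean_space) atlas \<Rightarrow> ('p, 'e) chart \<Rightarrow> 'p \<Rightarrow> 'e \<Rightarrow> ('p, 'e) tvec" where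
  "tvec_of A c p w = (p, \<lambda>d. if d \<in> charts_at A p
     then frechet_derivative (transition c d) (at (snd c p)) w else 0)"

definition tzero :: "'p \<Rightarrow> ('p, 'e::euclidean_space) tvec" where
  "tzero p = (p, \<lambda>_. 0)"

definition tadd :: "('p, 'e::euclidean_space) tvec \<Rightarrow> ('p, 'e) tvec \<Rightarrow> ('p, 'e) tvec" where
  "tadd u w = (fst u, \<lambda>c. snd u c + snd w c)"

definition tscale :: "real \<Rightarrow> ('p, 'e::euclidean_space) tvec \<Rightarrow> ('p, 'e) tvec" where
  "tscale t u = (fst u, \<lambda>c. t *\<^sub>R snd u c)"

definition tlinear_on :: "('p, 'e::euclidean_space) tvec set \<Rightarrow>
    (('p, 'e) tvec \<Rightarrow> ('q, 'd::euclidean_space) tvec) \<Rightarrow> bool" where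
  "tlinear_on V f \<longleftrightarrow> (\<forall>u\<in>V. \<forall>w\<in>V. f (tadd u w) = tadd (f u) (f w)) \<and>
     (\<forall>t. \<forall>u\<in>V. f (tscale t u) = tscale t (f u))"

text \<open>
  The tangent map; the result does not depend on the chart used at the source point.
  Like all maps compared below, it is extensional (undefined off its domain).
\<close>

definition tmap :: "('p, 'e::euclidean_space) atlas \<Rightarrow> ('q, 'd::euclidean_space) atlas \<Rightarrow>
    ('p \<Rightarrow> 'q) \<Rightarrow> ('p, 'e) tvec \<Rightarrow> ('q, 'd) tvec" where
  "tmap A D f = (\<lambda>u\<in>tangent A. let p = fst u; c = (SOME c. c \<in> charts_at A p) in
     (f p, \<lambda>d. if d \<in> charts_at D (f p)
        then frechet_derivative (snd d \<circ> f \<circ> of_coords c) (at (snd c p)) (snd u c) else 0))"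

definition diff_embedding :: "enat \<Rightarrow> ('p, 'e::euclidean_space) atlas \<Rightarrow>
    ('q, 'd::euclidean_space) atlas \<Rightarrow> ('p \<Rightarrow> 'q) \<Rightarrow> bool" where
  "diff_embedding s A D f \<longleftrightarrow> smooth_map s A D f \<and>
     embedding_map (man_topology A) (man_topology D) f \<and>
     (\<forall>p\<in>points A. \<forall>c\<in>charts_at A p. \<forall>d\<in>charts_at D (f p).
        inj (frechet_derivative (snd d \<circ> f \<circ> of_coords c) (at (snd c p))))"


section \<open>Affine bundles\<close>

text \<open>
  The affine bundle structure and the smooth structure of the total space are both given by an
  atlas of affine trivialising charts, with coordinates \<open>(x, y)\<close>: \<open>x\<close> are coordinates on
  the base and \<open>y\<close> are affine coordinates on the whole fibre. The rank is the dimension of \<open>'f\<close>.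
\<close>

record ('p, 'f, 'q, 'b) affbundle =
  tot :: "('p, 'b \<times> 'f) atlas"
  bas :: "('q, 'b) atlas"
  prj :: "'p \<Rightarrow> 'q"

definition trivialises :: "('p, 'f, 'q, 'b) affbundle \<Rightarrow> ('p, 'b \<times> 'f) chart \<Rightarrow> ('q, 'b) chart \<Rightarrow> bool" where
  "trivialises A c b \<longleftrightarrow> c \<in> tot A \<and> b \<in> bas A \<and>
     fst c = {p \<in> points (tot A). prj A p \<in> fst b} \<and>
     snd c ` fst c = (snd b ` fst b) \<times> UNIV \<and>
     (\<forall>p\<in>fst c. fst (snd c p) = snd b (prj A p))"

text \<open>The point of the fibre through \<open>p\<close> with vertical coordinate \<open>y\<close>.\<close>

definition fibre_pt :: "('p, 'b \<times> 'f) chart \<Rightarrow> 'p \<Rightarrow> 'f \<Rightarrow> 'p" where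
  "fibre_pt c p y = of_coords c (fst (snd c p), y)"

definition affine_bundle ::
    "enat \<Rightarrow> ('p, 'f::euclidean_space, 'q, 'b::euclidean_space) affbundle \<Rightarrow> bool" where
  "affine_bundle s A \<longleftrightarrow>
     manifold s (tot A) \<and> connected_space (man_topology (tot A)) \<and> orientable s (tot A) \<and>
     manifold s (bas A) \<and> connected_space (man_topology (bas A)) \<and> orientable s (bas A) \<and>
     smooth_map s (tot A) (bas A) (prj A) \<and> prj A ` points (tot A) = points (bas A) \<and>
     (\<forall>c\<in>tot A. \<exists>b. trivialises A c b) \<and>
     (\<forall>c\<in>tot A. \<forall>d\<in>tot A. \<forall>p\<in>fst c \<inter> fst d. affine_fun (\<lambda>y. snd (snd d (fibre_pt c p y))))"

definition tprj :: "('p, 'f::euclidean_space, 'q, 'b::euclidean_space) affbundle \<Rightarrow>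
    ('p, 'b \<times> 'f) tvec \<Rightarrow> ('q, 'b) tvec" where
  "tprj A = tmap (tot A) (bas A) (prj A)"

definition vertical :: "('p, 'f::euclidean_space, 'q, 'b::euclidean_space) affbundle \<Rightarrow> 'p \<Rightarrow>
    ('p, 'b \<times> 'f) tvec set" where
  "vertical A p = {u \<in> tangent_space (tot A) p. tprj A u = tzero (prj A p)}"

text \<open>The fibre product of the total space and the tangent bundle of the base, as a manifold.\<close>

definition fibprod_atlas :: "('p, 'f::euclidean_space, 'q, 'b::euclidean_space) affbundle \<Rightarrow>
    ('p \<times> ('q, 'b) tvec, ('b \<times> 'f) \<times> 'b) atlas" where
  "fibprod_atlas A =
     {({(a, u). a \<in> fst c \<and> u \<in> tangent_space (bas A) (prj A a)}, \<lambda>(a, u). (snd c a, snd u b))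
       | c b. trivialises A c b}"

text \<open>
  Smooth maps from the fibre product to the tangent bundle of the total space, linear in the
  vector and affine in the vertical coordinate: the common part of connections and solder forms.
\<close>

definition fibre_affine_form :: "enat \<Rightarrow> ('p, 'f::euclidean_space, 'q, 'b::euclidean_space) affbundle \<Rightarrow>
    ('p \<times> ('q, 'b) tvec \<Rightarrow> ('p, 'b \<times> 'f) tvec) \<Rightarrow> bool" where
  "fibre_affine_form r A \<theta> \<longleftrightarrow>
     \<theta> \<in> extensional (points (fibprod_atlas A)) \<and>
     smooth_map r (fibprod_atlas A) (tangent_atlas (tot A)) \<theta> \<and>
     (\<forall>a\<in>points (tot A). (\<forall>u\<in>tangent_space (bas A) (prj A a). \<theta> (a, u) \<in> tangent_space (tot A) a) \<and>
        tlinear_on (tangent_space (bas A) (prj A a)) (\<lambda>u. \<theta> (a, u))) \<and>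
     (\<forall>c\<in>tot A. \<forall>a\<in>fst c. \<forall>u\<in>tangent_space (bas A) (prj A a).
        affine_fun (\<lambda>y. snd (\<theta> (fibre_pt c a y, u)) c))"

definition Con :: "enat \<Rightarrow> ('p, 'f::euclidean_space, 'q, 'b::euclidean_space) affbundle \<Rightarrow>
    ('p \<times> ('q, 'b) tvec \<Rightarrow> ('p, 'b \<times> 'f) tvec) set" where
  "Con r A = {\<gamma>. fibre_affine_form r A \<gamma> \<and>
     (\<forall>a\<in>points (tot A). \<forall>u\<in>tangent_space (bas A) (prj A a). tprj A (\<gamma> (a, u)) = u)}"

definition Sold :: "enat \<Rightarrow> ('p, 'f::euclidean_space, 'q, 'b::euclidean_space) affbundle \<Rightarrow>
    ('p \<times> ('q, 'b) tvec \<Rightarrow> ('p, 'b \<times> 'f) tvec) set" where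
  "Sold r A = {\<theta>. fibre_affine_form r A \<theta> \<and> inj_on \<theta> (points (fibprod_atlas A)) \<and>
     (\<forall>a\<in>points (tot A). \<forall>u\<in>tangent_space (bas A) (prj A a). \<theta> (a, u) \<in> vertical A a)}"

definition vertical_pairs :: "('p, 'f::euclidean_space, 'q, 'b::euclidean_space) affbundle \<Rightarrow>
    (('p, 'b \<times> 'f) tvec \<times> ('p, 'b \<times> 'f) tvec) set" where
  "vertical_pairs A = (\<Union>p\<in>points (tot A). vertical A p \<times> vertical A p)"

text \<open>Vertical coordinate vectors are those of the form \<open>(0, w)\<close>.\<close>

definition micro_metrics :: "enat \<Rightarrow> ('p, 'f::euclidean_space, 'q, 'b::euclidean_space) affbundle \<Rightarrow>
    (('p, 'b \<times> 'f) tvec \<times> ('p, 'b \<times> 'f) tvec \<Rightarrow> real) set" where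
  "micro_metrics r A = {g. g \<in> extensional (vertical_pairs A) \<and>
     (\<forall>p\<in>points (tot A). \<forall>u\<in>vertical A p. \<forall>w\<in>vertical A p.
        g (u, w) = g (w, u) \<and>
        (\<forall>u'\<in>vertical A p. g (tadd u u', w) = g (u, w) + g (u', w)) \<and>
        (\<forall>t. g (tscale t u, w) = t * g (u, w)) \<and>
        (u \<noteq> tzero p \<longrightarrow> 0 < g (u, u))) \<and>
     (\<forall>c\<in>tot A. \<forall>w w'. Cr_on r
        (\<lambda>z. g (tvec_of (tot A) c (of_coords c z) (0, w), tvec_of (tot A) c (of_coords c z) (0, w')))
        (snd c ` fst c))}"


section \<open>Placements\<close>

definition Aff :: "enat \<Rightarrow> ('p, 'f::euclidean_space, 'q, 'b::euclidean_space) affbundle \<Rightarrow>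
    ('p2, 'f2::euclidean_space, 'q2, 'b2::euclidean_space) affbundle \<Rightarrow> ('p \<Rightarrow> 'p2) set" where
  "Aff s A D = {l. l \<in> extensional (points (tot A)) \<and> smooth_map s (tot A) (tot D) l \<and>
     (\<exists>lb. smooth_map s (bas A) (bas D) lb \<and> (\<forall>p\<in>points (tot A). prj D (l p) = lb (prj A p))) \<and>
     (\<forall>c\<in>tot A. \<forall>d\<in>tot D. \<forall>p\<in>fst c. l p \<in> fst d \<longrightarrow>
        affine_fun (\<lambda>y. snd (snd d (l (fibre_pt c p y)))))}"

text \<open>The map between the bases induced by a fibre-preserving map.\<close>

definition base_map :: "('p, 'f, 'q, 'b) affbundle \<Rightarrow> ('p2, 'f2, 'q2, 'b2) affbundle \<Rightarrow>
    ('p \<Rightarrow> 'p2) \<Rightarrow> 'q \<Rightarrow> 'q2" where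
  "base_map A D l = (\<lambda>x\<in>points (bas A). prj D (l (SOME p. p \<in> points (tot A) \<and> prj A p = x)))"

text \<open>The punctual shadow, read off on the zero section.\<close>

definition shadow :: "('p, 'f, 'q, 'b::euclidean_space) affbundle \<Rightarrow>
    (('p, 'b \<times> 'f::euclidean_space) tvec \<Rightarrow> ('p2, 'e2) tvec) \<Rightarrow> 'p \<Rightarrow> 'p2" where
  "shadow A L = (\<lambda>p\<in>points (tot A). fst (L (tzero p)))"

text \<open>
  The differential of the map between the bases induced by the shadow of \<open>L\<close>: this is
  the map written \<open>L\<close> with a bar.
\<close>

definition bar :: "('p, 'f::euclidean_space, 'q, 'b::euclidean_space) affbundle \<Rightarrow>
    ('p2, 'f2::euclidean_space, 'q2, 'b2::euclidean_space) affbundle \<Rightarrow>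
    (('p, 'b \<times> 'f) tvec \<Rightarrow> ('p2, 'b2 \<times> 'f2) tvec) \<Rightarrow> ('q, 'b) tvec \<Rightarrow> ('q2, 'b2) tvec" where
  "bar A D L = tmap (bas A) (bas D) (base_map A D (shadow A L))"

definition Lpa :: "enat \<Rightarrow> ('p, 'f::euclidean_space, 'q, 'b::euclidean_space) affbundle \<Rightarrow>
    ('p2, 'f2::euclidean_space, 'q2, 'b2::euclidean_space) affbundle \<Rightarrow>
    (('p, 'b \<times> 'f) tvec \<Rightarrow> ('p2, 'b2 \<times> 'f2) tvec) set" where
  "Lpa r A D = {L. L \<in> extensional (tangent (tot A)) \<and>
     smooth_map r (tangent_atlas (tot A)) (tangent_atlas (tot D)) L \<and>
     shadow A L \<in> Aff (r + 1) A D \<and>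
     (\<forall>p\<in>points (tot A). (\<forall>u\<in>tangent_space (tot A) p. L u \<in> tangent_space (tot D) (shadow A L p)) \<and>
        tlinear_on (tangent_space (tot A) p) L) \<and>
     (\<forall>u\<in>tangent (tot A). tprj D (L u) = bar A D L (tprj A u)) \<and>
     (\<forall>p\<in>points (tot A). \<forall>u\<in>vertical A p. L u = tmap (tot A) (tot D) (shadow A L) u) \<and>
     (\<forall>c\<in>tot A. \<forall>d\<in>tot D. \<forall>p\<in>fst c. shadow A L p \<in> fst d \<longrightarrow>
        (\<forall>w. affine_fun (\<lambda>y. snd (L (tvec_of (tot A) c (fibre_pt c p y) w)) d)))}"

definition pull_form :: "('p, 'f::euclidean_space, 'q, 'b::euclidean_space) affbundle \<Rightarrow>
    ('p2, 'f2::euclidean_space, 'q2, 'b2::euclidean_space) affbundle \<Rightarrow>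
    (('p, 'b \<times> 'f) tvec \<Rightarrow> ('p2, 'b2 \<times> 'f2) tvec) \<Rightarrow>
    ('p2 \<times> ('q2, 'b2) tvec \<Rightarrow> ('p2, 'b2 \<times> 'f2) tvec) \<Rightarrow>
    ('p \<times> ('q, 'b) tvec \<Rightarrow> ('p, 'b \<times> 'f) tvec)" where
  "pull_form A D L \<theta> = (\<lambda>(X, u)\<in>points (fibprod_atlas A).
     inv_into (tangent_space (tot A) X) L (\<theta> (shadow A L X, bar A D L u)))"

definition pull_metric :: "('p, 'f::euclidean_space, 'q, 'b::euclidean_space) affbundle \<Rightarrow>
    (('p, 'b \<times> 'f) tvec \<Rightarrow> 'v) \<Rightarrow> ('v \<times> 'v \<Rightarrow> real) \<Rightarrow>
    (('p, 'b \<times> 'f) tvec \<times> ('p, 'b \<times> 'f) tvec \<Rightarrow> real)" where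
  "pull_metric A L g = (\<lambda>(u, w)\<in>vertical_pairs A. g (L u, L w))"


section \<open>The ambient space\<close>

type_synonym R3 = "real^3"

abbreviation std :: "('a, 'a) chart" where
  "std \<equiv> (UNIV, id)"

definition EE :: "(R3, R3) atlas" where
  "EE = {std}"

definition Eamb :: "(R3 \<times> R3, R3, R3, R3) affbundle" where
  "Eamb = \<lparr>tot = {std}, bas = EE, prj = fst\<rparr>"

type_synonym TE = "(R3 \<times> R3, R3 \<times> R3) tvec"

definition gamma_E :: "(R3 \<times> R3) \<times> (R3, R3) tvec \<Rightarrow> TE" where
  "gamma_E = (\<lambda>(a, u)\<in>points (fibprod_atlas Eamb). tvec_of (tot Eamb) std a (snd u std, 0))"

definition theta_E :: "(R3 \<times> R3) \<times> (R3, R3) tvec \<Rightarrow> TE" where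
  "theta_E = (\<lambda>(a, u)\<in>points (fibprod_atlas Eamb). tvec_of (tot Eamb) std a (0, snd u std))"

definition iota :: "TE \<Rightarrow> (R3, R3) tvec" where
  "iota = (\<lambda>U\<in>tangent (tot Eamb).
     tvec_of EE std (fst (fst U)) (fst (snd U std) + snd (snd U std)))"

definition g_eucl :: "(R3, R3) tvec \<times> (R3, R3) tvec \<Rightarrow> real" where
  "g_eucl = (\<lambda>(u, w). snd u std \<bullet> snd w std)"

definition pseudo_metric :: "TE \<times> TE \<Rightarrow> real" where
  "pseudo_metric = (\<lambda>(U, W). g_eucl (iota U, iota W))"

definition g_vv :: "TE \<times> TE \<Rightarrow> real" where
  "g_vv = restrict pseudo_metric (vertical_pairs Eamb)"

definition Gal :: "(R3 \<Rightarrow> R3) set" where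
  "Gal = {\<lambda>x. R x + t | R t. orthogonal_transformation R}"

definition TGal :: "((R3, R3) tvec \<Rightarrow> (R3, R3) tvec) set" where
  "TGal = tmap EE EE ` Gal"

definition gen_Gal :: "enat \<Rightarrow> (TE \<Rightarrow> TE) set" where
  "gen_Gal r = {tmap (tot Eamb) (tot Eamb) a | a. a \<in> Aff (r + 1) Eamb Eamb \<and>
     (\<exists>h\<in>TGal. \<forall>U\<in>tangent (tot Eamb). iota (tmap (tot Eamb) (tot Eamb) a U) = h (iota U))}"

definition gen_Gal_group :: "enat \<Rightarrow> (TE \<Rightarrow> TE) monoid" where
  "gen_Gal_group r = \<lparr>carrier = gen_Gal r, mult = compose (tangent (tot Eamb)),
     one = (\<lambda>U\<in>tangent (tot Eamb). U)\<rparr>"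


section \<open>Conformations and their invariants\<close>

definition Conf :: "enat \<Rightarrow> ('p, 'f::euclidean_space, 'q, 'b::euclidean_space) affbundle \<Rightarrow>
    (('p, 'b \<times> 'f) tvec \<Rightarrow> TE) set" where
  "Conf r B = {F \<in> Lpa r B Eamb.
     diff_embedding r (tangent_atlas (tot B)) (tangent_atlas (tot Eamb)) F \<and>
     diff_embedding (r + 1) (tot B) (tot Eamb) (shadow B F)}"

definition left_action :: "enat \<Rightarrow> ('p, 'f::euclidean_space, 'q, 'b::euclidean_space) affbundle \<Rightarrow>
    (TE \<Rightarrow> TE) \<Rightarrow> (('p, 'b \<times> 'f) tvec \<Rightarrow> TE) \<Rightarrow> (('p, 'b \<times> 'f) tvec \<Rightarrow> TE)" where
  "left_action r B a = (\<lambda>F\<in>Conf r B. compose (tangent (tot B)) a F)"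

definition Tshadow :: "('p, 'f::euclidean_space, 'q, 'b::euclidean_space) affbundle \<Rightarrow>
    (('p, 'b \<times> 'f) tvec \<Rightarrow> TE) \<Rightarrow> (('p, 'b \<times> 'f) tvec \<Rightarrow> TE)" where
  "Tshadow B F = tmap (tot B) (tot Eamb) (shadow B F)"

definition II :: "('p, 'f::euclidean_space, 'q, 'b::euclidean_space) affbundle \<Rightarrow>
    (('p, 'b \<times> 'f) tvec \<Rightarrow> TE) \<Rightarrow>
    (('p, 'b \<times> 'f) tvec \<times> ('p, 'b \<times> 'f) tvec \<Rightarrow> real) \<times>
    ('p \<times> ('q, 'b) tvec \<Rightarrow> ('p, 'b \<times> 'f) tvec) \<times>
    ('p \<times> ('q, 'b) tvec \<Rightarrow> ('p, 'b \<times> 'f) tvec) \<times>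
    ('p \<times> ('q, 'b) tvec \<Rightarrow> ('p, 'b \<times> 'f) tvec)" where
  "II B F = (pull_metric B F g_vv, pull_form B Eamb F theta_E,
     pull_form B Eamb F gamma_E, pull_form B Eamb (Tshadow B F) gamma_E)"

end

theory Submission
  imports Defs
begin

text \<open>
  In trivialising coordinates \<open>(x, y)\<close> the shadow is \<open>\<phi>(x, y) = (p(x), A(x) y + \<tau>(x))\<close> and
  \<open>F(\<delta>x, \<delta>y) = (dp \<delta>x, G(x, y) \<delta>x + A(x) \<delta>y)\<close> with \<open>A(x)\<close> invertible, so the invariants amount to
  \<open>A\<^sup>T A\<close>, \<open>A\<^sup>-\<^sup>1 dp\<close>, \<open>A\<^sup>-\<^sup>1 G\<close> and \<open>A\<^sup>-\<^sup>1 (dA y + d\<tau>)\<close>. The group consists of the tangent maps of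
  \<open>(x, y) \<mapsto> (R x + t, R y + s)\<close> with \<open>R\<close> orthogonal. If two conformations have the same invariants,
  then \<open>R = A\<^sub>2 A\<^sub>1\<^sup>-\<^sup>1\<close> is orthogonal and carries \<open>F\<^sub>1\<close> to \<open>F\<^sub>2\<close> and \<open>T\<phi>\<^sub>1\<close> to \<open>T\<phi>\<^sub>2\<close> pointwise; the
  \<open>y\<close>-dependent part of the last invariant gives \<open>dA\<^sub>2 = R dA\<^sub>1\<close>, hence \<open>dR = 0\<close>. So \<open>R\<close>, and then
  \<open>\<phi>\<^sub>2 - R \<phi>\<^sub>1\<close>, is locally constant, and constant since the total space is connected.
\<close>

section \<open>Calculus of \<open>C^k\<close> maps\<close>

text \<open>The base may have dimension less than 3, so a conformation need not be onto on tangent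
  spaces, and \<open>F\<^sub>2 F\<^sub>1\<^sup>-\<^sup>1\<close> does not directly give a map of the
  ambient space. The fibres do have full rank 3: \<open>A\<close> is invertible, \<open>R\<close> is
  read off from vertical vectors alone, and the remaining components are transported through
  \<open>A\<close>.

  The invariants of \<open>F\<close> give an orthogonal \<open>R(x)\<close> at each base point; the
  fourth one makes it constant. Since \<open>R(x)\<close> does not involve \<open>y\<close>, the
  relation between the differentials of the two shadows can be compared at two heights of the same
  fibre, and the difference isolates \<open>dA\<close>. Conversely, invariance of the solder form
  rests on the group using one and the same \<open>R\<close> on base and fibres, which compatibility
  with \<open>iota\<close> forces.

  \<open>R\<close> is computed in a chart. The global step therefore works with a relation free of
  charts, "the triple (R, t, s) carries \<open>F\<^sub>1\<close> to \<open>F\<^sub>2\<close> at the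
  point p", whose solution is unique at every point. In the completeness argument \<open>R\<close>
  is differentiated only once, so regularity 1 is enough there.\<close>

lemma Ck_on_SucD:
  assumes "Ck_on (Suc k) f S" "x \<in> S"
  shows "(f has_derivative frechet_derivative f (at x)) (at x)"
  using assms frechet_derivative_works by auto

text \<open>Openness turns pointwise equality into equality near each point, so it passes to
  \<open>frechet_derivative\<close> and the induction can go on.\<close>

lemma Ck_on_cong:
  assumes "open S" "Ck_on k f S" "\<And>x. x \<in> S \<Longrightarrow> f x = g x"
  shows "Ck_on k g S"
  using assms(2,3)
proof (induction k arbitrary: f g)
  case 0
  then show ?case by (simp cong: continuous_on_cong)
next
  case (Suc k)
  have fd: "frechet_derivative g (at x) = frechet_derivative f (at x)" if "x \<in> S" for x
    using frechet_derivative_transform_within_open[of f x S g] Suc.prems \<open>open S\<close> that by simp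
  have "g differentiable at x" if "x \<in> S" for x
    using has_derivative_transform_within_open[OF Ck_on_SucD[OF Suc.prems(1) that] \<open>open S\<close> that]
      Suc.prems(2) unfolding differentiable_def by blast
  moreover have "Ck_on k (\<lambda>x. frechet_derivative g (at x) v) S" for v
    using Suc.IH[of "\<lambda>x. frechet_derivative f (at x) v"] Suc.prems fd by simp
  ultimately show ?case by simp
qed

text \<open>Admits an explicit derivative \<open>f'\<close> in place of the canonical
  \<open>frechet_derivative\<close>; the closure rules below get theirs from the usual rules of
  calculus and enter here.\<close>

lemma Ck_on_SucI:
  assumes "open S" "\<And>x. x \<in> S \<Longrightarrow> (f has_derivative f' x) (at x)" "\<And>v. Ck_on k (\<lambda>x. f' x v) S"
  shows "Ck_on (Suc k) f S"
proof -
  have "f' x = frechet_derivative f (at x)" if "x \<in> S" for x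
    using assms(2)[OF that] by (rule frechet_derivative_at)
  then have "Ck_on k (\<lambda>x. frechet_derivative f (at x) v) S" for v
    using Ck_on_cong[OF assms(1) assms(3)[of v]] by simp
  then show ?thesis using assms(2) by (auto simp: differentiable_def)
qed

lemma Ck_on_mono_Suc: "Ck_on (Suc k) f S \<Longrightarrow> Ck_on k f S"
proof (induction k arbitrary: f)
  case 0
  then show ?case
    by (auto intro!: continuous_at_imp_continuous_on differentiable_imp_continuous_within)
next
  case (Suc k)
  then show ?case by (metis Ck_on.simps(2))
qed

lemma Ck_on_subset: "Ck_on k f T \<Longrightarrow> S \<subseteq> T \<Longrightarrow> Ck_on k f S"
  by (induction k arbitrary: f) (auto intro: continuous_on_subset)

lemma Ck_on_const: "open S \<Longrightarrow> Ck_on k (\<lambda>x. a) S"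
  by (induction k arbitrary: a) (auto intro: Ck_on_SucI)

lemma Ck_on_linear:
  assumes "open S" "bounded_linear f"
  shows "Ck_on k f S"
proof (cases k)
  case 0
  then show ?thesis using assms(2) by (simp add: linear_continuous_on)
next
  case (Suc n)
  show ?thesis unfolding Suc
    by (rule Ck_on_SucI[where f'="\<lambda>_. f"])
       (use assms Ck_on_const bounded_linear_imp_has_derivative in auto)
qed

lemma Ck_on_add:
  assumes "open S" "Ck_on k f S" "Ck_on k g S"
  shows "Ck_on k (\<lambda>x. f x + g x) S"
  using assms(2,3)
proof (induction k arbitrary: f g)
  case (Suc k)
  show ?case
    by (rule Ck_on_SucI[OF \<open>open S\<close> has_derivative_add[OF Ck_on_SucD Ck_on_SucD]])
       (use Suc in auto)
qed (auto intro: continuous_intros)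

lemma Ck_on_linear_comp:
  assumes "open S" "bounded_linear h" "Ck_on k f S"
  shows "Ck_on k (\<lambda>x. h (f x)) S"
  using assms(3)
proof (induction k arbitrary: f)
  case 0
  then show ?case using assms(2) by (simp add: bounded_linear.continuous_on)
next
  case (Suc k)
  show ?case
    by (rule Ck_on_SucI[OF \<open>open S\<close> bounded_linear.has_derivative[OF assms(2) Ck_on_SucD]])
       (use Suc in auto)
qed

lemma Ck_on_bilinear:
  assumes "open S" "bounded_bilinear m" "Ck_on k f S" "Ck_on k g S"
  shows "Ck_on k (\<lambda>x. m (f x) (g x)) S"
  using assms(3,4)
proof (induction k arbitrary: f g)
  case 0
  then show ?case using assms(2) by (simp add: bounded_bilinear.continuous_on)
next
  case (Suc k)
  have "Ck_on k (\<lambda>x. m (f x) (frechet_derivative g (at x) v)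
      + m (frechet_derivative f (at x) v) (g x)) S" for v
    using Suc.prems Ck_on_mono_Suc[OF Suc.prems(1)] Ck_on_mono_Suc[OF Suc.prems(2)]
    by (intro Ck_on_add \<open>open S\<close> Suc.IH) auto
  from Ck_on_SucI[OF \<open>open S\<close> bounded_bilinear.FDERIV[OF assms(2)
          Ck_on_SucD[OF Suc.prems(1)] Ck_on_SucD[OF Suc.prems(2)]] this]
  show ?case .
qed

lemma Ck_on_inverse:
  fixes f :: "'a::euclidean_space \<Rightarrow> real"
  assumes "open S" "Ck_on k f S" "\<And>x. x \<in> S \<Longrightarrow> f x \<noteq> 0"
  shows "Ck_on k (\<lambda>x. inverse (f x)) S"
  using assms(2)
proof (induction k)
  case 0
  then show ?case using assms(3) by (auto intro: continuous_intros)
next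
  case (Suc k)
  have inv: "Ck_on k (\<lambda>x. inverse (f x)) S"
    using Suc Ck_on_mono_Suc by blast
  have "Ck_on k (\<lambda>x. - (inverse (f x) * frechet_derivative f (at x) v * inverse (f x))) S" for v
    by (rule Ck_on_linear_comp[where h=uminus], simp_all add: \<open>open S\<close> bounded_linear_minus)
       (use Suc.prems inv in \<open>auto intro!: Ck_on_bilinear[OF \<open>open S\<close> bounded_bilinear_mult]\<close>)
  from Ck_on_SucI[OF \<open>open S\<close> Deriv.has_derivative_inverse[OF assms(3) Ck_on_SucD[OF Suc.prems]] this]
  show ?case .
qed

lemma Ck_on_sum:
  assumes "open S" "\<And>i. i \<in> I \<Longrightarrow> Ck_on k (f i) S"
  shows "Ck_on k (\<lambda>x. \<Sum>i\<in>I. f i x) S"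
  using assms(2)
  by (induction I rule: infinite_finite_induct)
     (auto intro: Ck_on_const Ck_on_add \<open>open S\<close>)

lemma linear_euclidean_sum:
  fixes h :: "'a::euclidean_space \<Rightarrow> 'b::real_vector"
  assumes "linear h"
  shows "h x = (\<Sum>b\<in>Basis. (x \<bullet> b) *\<^sub>R h b)"
proof -
  have "h (\<Sum>b\<in>Basis. (x \<bullet> b) *\<^sub>R b) = (\<Sum>b\<in>Basis. (x \<bullet> b) *\<^sub>R h b)"
    using assms by (simp add: linear_sum linear_scale)
  then show ?thesis by (simp add: euclidean_representation)
qed

text \<open>Expanding the moving vector \<open>h x\<close> in the basis gives a finite sum of
  products, so regularity of \<open>H\<close> on fixed basis vectors is enough. The chain rule and
  the coordinate formulas on tangent bundles rest on this.\<close>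

lemma Ck_on_linear_apply:
  fixes H :: "'a::euclidean_space \<Rightarrow> 'c::euclidean_space \<Rightarrow> 'd::real_normed_vector"
  assumes "open S" "\<And>x. x \<in> S \<Longrightarrow> linear (H x)" "\<And>b. b \<in> Basis \<Longrightarrow> Ck_on k (\<lambda>x. H x b) S"
    "Ck_on k h S"
  shows "Ck_on k (\<lambda>x. H x (h x)) S"
proof (rule Ck_on_cong[OF \<open>open S\<close>])
  show "Ck_on k (\<lambda>x. \<Sum>b\<in>Basis. (h x \<bullet> b) *\<^sub>R H x b) S"
    using assms
    by (auto intro!: Ck_on_sum Ck_on_bilinear[OF _ bounded_bilinear_scaleR]
        Ck_on_linear_comp[where h="\<lambda>x. x \<bullet> _"] bounded_linear_inner_left)
qed (metis assms(2) linear_euclidean_sum)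

lemma Ck_on_compose:
  fixes g :: "'b::euclidean_space \<Rightarrow> 'c::real_normed_vector"
  assumes "open S" "open T" "Ck_on k f S" "f ` S \<subseteq> T" "Ck_on k g T"
  shows "Ck_on k (\<lambda>x. g (f x)) S"
  using assms(3,4,5)
proof (induction k arbitrary: f g)
  case 0
  then show ?case by (auto intro: continuous_on_compose2)
next
  case (Suc k)
  have "((\<lambda>x. g (f x)) has_derivative
      (\<lambda>v. frechet_derivative g (at (f x)) (frechet_derivative f (at x) v))) (at x)" if "x \<in> S" for x
    using Suc.prems that
    by (intro has_derivative_compose[OF Ck_on_SucD[OF Suc.prems(1)] Ck_on_SucD[OF Suc.prems(3)]]) auto
  \<comment> \<open>The derivative of the composite is a linear family taken at \<open>f x\<close>
    and applied to a moving vector. On a fixed basis vector this family is again a composite, of one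
    order less, so the induction hypothesis applies to it.\<close>
  moreover have "Ck_on k (\<lambda>x. frechet_derivative g (at (f x)) (frechet_derivative f (at x) v)) S" for v
  proof (rule Ck_on_linear_apply[OF \<open>open S\<close>])
    show "linear (frechet_derivative g (at (f x)))" if "x \<in> S" for x
      using Suc.prems that by (auto intro!: linear_frechet_derivative simp: image_subset_iff)
    show "Ck_on k (\<lambda>x. frechet_derivative g (at (f x)) b) S" for b
      using Suc.prems(2,3) Ck_on_mono_Suc[OF Suc.prems(1)]
      by (intro Suc.IH[where g="\<lambda>y. frechet_derivative g (at y) b"]) auto
  qed (use Suc.prems in simp)
  ultimately show ?case by (rule Ck_on_SucI[OF \<open>open S\<close>])
qed

section \<open>The same rules for a finite or infinite order of regularity\<close>

lemma Cr_on_cong: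
  "open S \<Longrightarrow> Cr_on r f S \<Longrightarrow> (\<And>x. x \<in> S \<Longrightarrow> f x = g x) \<Longrightarrow> Cr_on r g S"
  unfolding Cr_on_def using Ck_on_cong by blast

lemma Cr_on_subset: "Cr_on r f T \<Longrightarrow> S \<subseteq> T \<Longrightarrow> Cr_on r f S"
  unfolding Cr_on_def using Ck_on_subset by blast

lemma Cr_on_const: "open S \<Longrightarrow> Cr_on r (\<lambda>x. a) S"
  unfolding Cr_on_def by (simp add: Ck_on_const)

lemma Cr_on_linear: "open S \<Longrightarrow> bounded_linear f \<Longrightarrow> Cr_on r f S"
  unfolding Cr_on_def by (simp add: Ck_on_linear)

lemma Cr_on_linear_comp:
  "open S \<Longrightarrow> bounded_linear h \<Longrightarrow> Cr_on r f S \<Longrightarrow> Cr_on r (\<lambda>x. h (f x)) S"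
  unfolding Cr_on_def by (simp add: Ck_on_linear_comp)

lemma Cr_on_add: "open S \<Longrightarrow> Cr_on r f S \<Longrightarrow> Cr_on r g S \<Longrightarrow> Cr_on r (\<lambda>x. f x + g x) S"
  unfolding Cr_on_def by (simp add: Ck_on_add)

lemma Cr_on_minus: "open S \<Longrightarrow> Cr_on r f S \<Longrightarrow> Cr_on r (\<lambda>x. - f x) S"
  using Cr_on_linear_comp[of S uminus r f] by (simp add: bounded_linear_minus bounded_linear_ident)

lemma Cr_on_bilinear:
  "open S \<Longrightarrow> bounded_bilinear m \<Longrightarrow> Cr_on r f S \<Longrightarrow> Cr_on r g S \<Longrightarrow> Cr_on r (\<lambda>x. m (f x) (g x)) S"
  unfolding Cr_on_def by (simp add: Ck_on_bilinear)

lemma Cr_on_inverse: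
  fixes f :: "'a::euclidean_space \<Rightarrow> real"
  shows "open S \<Longrightarrow> Cr_on r f S \<Longrightarrow> (\<And>x. x \<in> S \<Longrightarrow> f x \<noteq> 0) \<Longrightarrow> Cr_on r (\<lambda>x. inverse (f x)) S"
  unfolding Cr_on_def by (simp add: Ck_on_inverse)

lemma Cr_on_sum:
  "open S \<Longrightarrow> (\<And>i. i \<in> I \<Longrightarrow> Cr_on r (f i) S) \<Longrightarrow> Cr_on r (\<lambda>x. \<Sum>i\<in>I. f i x) S"
  unfolding Cr_on_def by (simp add: Ck_on_sum)

lemma Cr_on_prod:
  fixes f :: "'i \<Rightarrow> 'a::euclidean_space \<Rightarrow> real"
  assumes "open S" "\<And>i. i \<in> I \<Longrightarrow> Cr_on r (f i) S"
  shows "Cr_on r (\<lambda>x. \<Prod>i\<in>I. f i x) S"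
  using assms(2)
  by (induction I rule: infinite_finite_induct)
     (auto intro: Cr_on_const Cr_on_bilinear[OF _ bounded_bilinear_mult] \<open>open S\<close>)

lemma Cr_on_compose:
  fixes g :: "'b::euclidean_space \<Rightarrow> 'c::real_normed_vector"
  shows "open S \<Longrightarrow> open T \<Longrightarrow> Cr_on r f S \<Longrightarrow> f ` S \<subseteq> T \<Longrightarrow> Cr_on r g T \<Longrightarrow> Cr_on r (\<lambda>x. g (f x)) S"
  unfolding Cr_on_def
  by (intro allI impI, rule Ck_on_compose[where f=f and g=g and T=T]) simp_all

lemma Cr_on_linear_apply:
  fixes H :: "'a::euclidean_space \<Rightarrow> 'c::euclidean_space \<Rightarrow> 'd::real_normed_vector"
  assumes "open S" "\<And>x. x \<in> S \<Longrightarrow> linear (H x)" "\<And>b. Cr_on r (\<lambda>x. H x b) S" "Cr_on r h S"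
  shows "Cr_on r (\<lambda>x. H x (h x)) S"
  unfolding Cr_on_def
proof (intro allI impI)
  show "Ck_on k (\<lambda>x. H x (h x)) S" if "enat k \<le> r" for k
    by (rule Ck_on_linear_apply[OF assms(1,2)]) (use assms(3,4) that in \<open>simp_all add: Cr_on_def\<close>)
qed

lemma Cr_on_Pair:
  fixes f :: "'a::euclidean_space \<Rightarrow> 'b::real_normed_vector" and g :: "'a \<Rightarrow> 'c::real_normed_vector"
  assumes "open S" "Cr_on r f S" "Cr_on r g S"
  shows "Cr_on r (\<lambda>x. (f x, g x)) S"
proof -
  have "Cr_on r (\<lambda>x. (f x, 0) + (0, g x)) S"
    using assms
    by (intro Cr_on_add Cr_on_linear_comp[where h="\<lambda>x. (x, 0)"] Cr_on_linear_comp[where h="\<lambda>x. (0, x)"])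
       (auto intro!: bounded_linear_Pair bounded_linear_ident bounded_linear_zero)
  then show ?thesis by simp
qed

lemma Cr_on_fst: "open S \<Longrightarrow> Cr_on r f S \<Longrightarrow> Cr_on r (\<lambda>x. fst (f x)) S"
  by (rule Cr_on_linear_comp[OF _ bounded_linear_fst])

lemma Cr_on_snd: "open S \<Longrightarrow> Cr_on r f S \<Longrightarrow> Cr_on r (\<lambda>x. snd (f x)) S"
  by (rule Cr_on_linear_comp[OF _ bounded_linear_snd])

lemma Cr_on_ident: "open S \<Longrightarrow> Cr_on r (\<lambda>x. x) S"
  by (rule Cr_on_linear[OF _ bounded_linear_ident])

lemma Cr_on_vec:
  fixes f :: "'a::euclidean_space \<Rightarrow> real^'n"
  assumes "open S" "\<And>i. Cr_on r (\<lambda>x. f x $ i) S"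
  shows "Cr_on r f S"
proof (rule Cr_on_cong[OF \<open>open S\<close>])
  show "Cr_on r (\<lambda>x. \<Sum>i\<in>UNIV. (f x $ i) *\<^sub>R axis i 1) S"
    using assms
    by (intro Cr_on_sum Cr_on_linear_comp[where h="\<lambda>t. t *\<^sub>R _"] bounded_linear_scaleR_left) auto
  show "(\<Sum>i\<in>UNIV. (f x $ i) *\<^sub>R axis i 1) = f x" for x
    using basis_expansion[of "f x"] by (simp add: scalar_mult_eq_scaleR)
qed

lemma Cr_on_component:
  fixes f :: "'a::euclidean_space \<Rightarrow> real^'n"
  shows "open S \<Longrightarrow> Cr_on r f S \<Longrightarrow> Cr_on r (\<lambda>x. f x $ i) S"
  by (rule Cr_on_linear_comp[OF _ bounded_linear_vec_nth])

lemma Cr_on_det: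
  fixes M :: "'a::euclidean_space \<Rightarrow> real^'n^'n"
  assumes "open S" "\<And>i j. Cr_on r (\<lambda>x. M x $ i $ j) S"
  shows "Cr_on r (\<lambda>x. det (M x)) S"
  unfolding det_def using assms
  by (intro Cr_on_sum Cr_on_bilinear[OF _ bounded_bilinear_mult] Cr_on_const Cr_on_prod) auto

text \<open>Cramer's rule writes the solution as a quotient of determinants, that is, a polynomial
  in the matrix entries and in \<open>h\<close> divided by a nonvanishing function.
  \<open>D k\<close> is the numerator of component \<open>k\<close>.\<close>

lemma Cr_on_linear_inverse:
  fixes H :: "'a::euclidean_space \<Rightarrow> real^'n \<Rightarrow> real^'n"
  assumes S: "open S" and lin: "\<And>x. x \<in> S \<Longrightarrow> linear (H x)" and inj: "\<And>x. x \<in> S \<Longrightarrow> inj (H x)"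
    and H: "\<And>w. Cr_on r (\<lambda>x. H x w) S" and h: "Cr_on r h S"
  shows "Cr_on r (\<lambda>x. inv_into UNIV (H x) (h x)) S"
proof -
  define M where "M x = matrix (H x)" for x
  have ent: "Cr_on r (\<lambda>x. M x $ i $ j) S" for i j
    using Cr_on_component[OF S H, of "axis j 1" i] by (simp add: M_def matrix_def)
  have det: "det (M x) \<noteq> 0" if "x \<in> S" for x
    using that lin inj by (simp add: M_def det_nz_iff_inj)
  define D where "D k x = det (\<chi> i j. if j = k then h x $ i else M x $ i $ j)" for k x
  have "Cr_on r (D k) S" for k
    unfolding D_def
  proof (rule Cr_on_det[OF S])
    show "Cr_on r (\<lambda>x. (\<chi> i j. if j = k then h x $ i else M x $ i $ j) $ i $ j) S" for i j
      using ent Cr_on_component[OF S h] by (cases "j = k") simp_all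
  qed
  then have "Cr_on r (\<lambda>x. \<chi> k. D k x * inverse (det (M x))) S"
    using det ent by (intro Cr_on_vec[OF S])
      (auto intro!: Cr_on_bilinear[OF S bounded_bilinear_mult] Cr_on_inverse[OF S] Cr_on_det[OF S])
  moreover have "(\<chi> k. D k x * inverse (det (M x))) = inv_into UNIV (H x) (h x)" if "x \<in> S" for x
  proof -
    have "surj (H x)"
      using linear_injective_imp_surjective lin inj that by blast
    then have "M x *v inv_into UNIV (H x) (h x) = h x"
      using matrix_works[of "H x"] lin[OF that]
      by (simp add: M_def surj_f_inv_f linear_def scalar_mult_eq_scaleR[abs_def])
    then show ?thesis
      using cramer[OF det[OF that]] by (simp add: D_def divide_inverse)
  qed
  ultimately show ?thesis by (rule Cr_on_cong[OF S])
qed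

lemma Cr_on_mono: "Cr_on s f S \<Longrightarrow> r \<le> s \<Longrightarrow> Cr_on r f S"
  unfolding Cr_on_def using order_trans by blast

lemma Cr_on_differentiable: "Cr_on r f S \<Longrightarrow> 1 \<le> r \<Longrightarrow> x \<in> S \<Longrightarrow> f differentiable at x"
  unfolding Cr_on_def by (metis Ck_on.simps(2) One_nat_def one_enat_def)

lemma Cr_on_deriv:
  assumes "Cr_on (r + 1) f S"
  shows "Cr_on r (\<lambda>x. frechet_derivative f (at x) v) S"
  unfolding Cr_on_def
proof (intro allI impI)
  fix k assume "enat k \<le> r"
  then have "enat (Suc k) \<le> r + 1"
    by (metis add.commute eSuc_enat eSuc_plus_1 eSuc_ile_mono)
  then have "Ck_on (Suc k) f S" using assms unfolding Cr_on_def by blast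
  then show "Ck_on k (\<lambda>x. frechet_derivative f (at x) v) S" by simp
qed

section \<open>Charts, tangent vectors and tangent maps\<close>

text \<open>Charts are pairs; splitting quantifiers over them only blocks rewriting.\<close>

declare split_paired_All [simp del] split_paired_Ex [simp del]

lemma charts_at_iff: "c \<in> charts_at A p \<longleftrightarrow> c \<in> A \<and> p \<in> fst c"
  by (simp add: charts_at_def)

lemma points_iff: "p \<in> points A \<longleftrightarrow> (\<exists>c. c \<in> charts_at A p)"
  unfolding points_def charts_at_def by blast

lemma pointsI: "c \<in> A \<Longrightarrow> p \<in> fst c \<Longrightarrow> p \<in> points A"
  by (auto simp: points_def)

lemma of_coords_snd: "smooth_atlas s A \<Longrightarrow> c \<in> A \<Longrightarrow> p \<in> fst c \<Longrightarrow> of_coords c (snd c p) = p"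
  by (simp add: smooth_atlas_def of_coords_def)

lemma of_coords_in: "z \<in> snd c ` fst c \<Longrightarrow> of_coords c z \<in> fst c"
  by (simp add: of_coords_def inv_into_into)

lemma snd_of_coords: "z \<in> snd c ` fst c \<Longrightarrow> snd c (of_coords c z) = z"
  by (simp add: of_coords_def f_inv_into_f)

lemma open_chart_image: "smooth_atlas s A \<Longrightarrow> c \<in> A \<Longrightarrow> open (snd c ` fst c)"
  by (simp add: smooth_atlas_def)

lemma smooth_map_ident: "smooth_atlas s A \<Longrightarrow> smooth_map s A A (\<lambda>p. p)"
  by (simp add: smooth_map_def smooth_atlas_def transition_def comp_def vimage_def)

lemma smooth_map_points: "smooth_map s A D f \<Longrightarrow> p \<in> points A \<Longrightarrow> f p \<in> points D"
  by (auto simp: smooth_map_def)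

lemma smooth_map_has_derivative:
  assumes "smooth_map s A D f" "1 \<le> s" "c \<in> charts_at A p" "d \<in> charts_at D (f p)"
  shows "((snd d \<circ> f \<circ> of_coords c) has_derivative
    frechet_derivative (snd d \<circ> f \<circ> of_coords c) (at (snd c p))) (at (snd c p))"
proof -
  have "Cr_on s (snd d \<circ> f \<circ> of_coords c) (snd c ` (fst c \<inter> f -` fst d))"
    using assms by (auto simp: smooth_map_def charts_at_iff)
  from Cr_on_differentiable[OF this assms(2)] show ?thesis
    using assms(3,4) frechet_derivative_works by (auto simp: charts_at_iff)
qed

lemma frechet_derivative_smooth_comp:
  assumes A: "smooth_atlas s A" and D: "smooth_atlas s D"
    and f: "smooth_map s A D f" and g: "smooth_map s D E g" and s: "1 \<le> s"
    and c: "c \<in> charts_at A p" and d: "d \<in> charts_at D (f p)" and e: "e \<in> charts_at E (g (f p))"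
  shows "frechet_derivative (snd e \<circ> (\<lambda>p. g (f p)) \<circ> of_coords c) (at (snd c p)) w =
    frechet_derivative (snd e \<circ> g \<circ> of_coords d) (at (snd d (f p)))
      (frechet_derivative (snd d \<circ> f \<circ> of_coords c) (at (snd c p)) w)"
proof -
  \<comment> \<open>The composite in coordinates factors through the chart \<open>d\<close> only at
    points that \<open>f\<close> sends into its domain. These form an open set, so derivatives may
    be compared there.\<close>
  let ?O = "snd c ` (fst c \<inter> f -` fst d)"
  have O: "open ?O" "snd c p \<in> ?O"
    using f c d by (auto simp: smooth_map_def charts_at_iff)
  have cp: "of_coords c (snd c p) = p"
    using of_coords_snd[OF A] c by (simp add: charts_at_iff)
  have "((\<lambda>z. (snd e \<circ> g \<circ> of_coords d) ((snd d \<circ> f \<circ> of_coords c) z)) has_derivative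
    (\<lambda>w. frechet_derivative (snd e \<circ> g \<circ> of_coords d) (at (snd d (f p)))
      (frechet_derivative (snd d \<circ> f \<circ> of_coords c) (at (snd c p)) w))) (at (snd c p))"
    using has_derivative_compose[OF smooth_map_has_derivative[OF f s c d],
        of "snd e \<circ> g \<circ> of_coords d"
          "frechet_derivative (snd e \<circ> g \<circ> of_coords d) (at (snd d (f p)))"]
      smooth_map_has_derivative[OF g s d e] cp by simp
  then have "((snd e \<circ> (\<lambda>p. g (f p)) \<circ> of_coords c) has_derivative
    (\<lambda>w. frechet_derivative (snd e \<circ> g \<circ> of_coords d) (at (snd d (f p)))
      (frechet_derivative (snd d \<circ> f \<circ> of_coords c) (at (snd c p)) w))) (at (snd c p))"
  proof (rule has_derivative_transform_within_open[OF _ O])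
    fix z assume "z \<in> ?O"
    then obtain q where "q \<in> fst c" "f q \<in> fst d" "z = snd c q" by auto
    then show "(snd e \<circ> g \<circ> of_coords d) ((snd d \<circ> f \<circ> of_coords c) z) =
        (snd e \<circ> (\<lambda>p. g (f p)) \<circ> of_coords c) z"
      using of_coords_snd[OF A, of c q] of_coords_snd[OF D, of d "f q"] c d
      by (simp add: charts_at_iff)
  qed
  from frechet_derivative_at[OF this] show ?thesis by metis
qed

text \<open>A transition map is the coordinate form of the identity; in this shape the change of
  chart rules become the chain rule with the identity on one side.\<close>

lemma transition_altdef: "transition c d = snd d \<circ> (\<lambda>p. p) \<circ> of_coords c"
  by (simp add: transition_def fun_eq_iff)

lemma frechet_derivative_transition_left:
  assumes "smooth_atlas s A" "smooth_map s A D f" "1 \<le> s"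
    "c \<in> charts_at A p" "c' \<in> charts_at A p" "d \<in> charts_at D (f p)"
  shows "frechet_derivative (snd d \<circ> f \<circ> of_coords c) (at (snd c p)) w =
    frechet_derivative (snd d \<circ> f \<circ> of_coords c') (at (snd c' p))
      (frechet_derivative (transition c c') (at (snd c p)) w)"
  unfolding transition_altdef
  using frechet_derivative_smooth_comp[OF assms(1) assms(1) smooth_map_ident[OF assms(1)] assms(2-6)]
  by simp

lemma frechet_derivative_transition_right:
  assumes "smooth_atlas s A" "smooth_atlas s D" "smooth_map s A D f" "1 \<le> s"
    "c \<in> charts_at A p" "d \<in> charts_at D (f p)" "d' \<in> charts_at D (f p)"
  shows "frechet_derivative (snd d' \<circ> f \<circ> of_coords c) (at (snd c p)) w =
    frechet_derivative (transition d d') (at (snd d (f p)))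
      (frechet_derivative (snd d \<circ> f \<circ> of_coords c) (at (snd c p)) w)"
  unfolding transition_altdef
  using frechet_derivative_smooth_comp[OF assms(1-3) smooth_map_ident[OF assms(2)] assms(4-7)]
  by simp

lemma frechet_derivative_transition_self:
  assumes "smooth_atlas s A" "c \<in> charts_at A p"
  shows "frechet_derivative (transition c c) (at (snd c p)) w = w"
proof -
  have "(transition c c has_derivative (\<lambda>w. w)) (at (snd c p))"
  proof (rule has_derivative_transform_within_open[OF has_derivative_ident])
    show "open (snd c ` fst c)" "snd c p \<in> snd c ` fst c"
      using assms by (auto simp: charts_at_iff open_chart_image)
  qed (simp add: transition_def snd_of_coords)
  then show ?thesis using frechet_derivative_at by metis
qed

lemma linear_frechet_transition:
  assumes "smooth_atlas s A" "1 \<le> s" "c \<in> charts_at A p" "d \<in> charts_at A p"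
  shows "linear (frechet_derivative (transition c d) (at (snd c p)))"
  using smooth_map_has_derivative[OF smooth_map_ident[OF assms(1)] assms(2-4)] has_derivative_linear
  unfolding transition_altdef by blast

section \<open>Tangent vectors through their coordinates in one chart\<close>

lemma tangent_space_iff:
  "u \<in> tangent_space A p \<longleftrightarrow> fst u = p \<and> p \<in> points A \<and>
    (\<forall>c\<in>charts_at A p. \<forall>d\<in>charts_at A p.
      snd u d = frechet_derivative (transition c d) (at (snd c p)) (snd u c)) \<and>
    (\<forall>c. c \<notin> charts_at A p \<longrightarrow> snd u c = 0)"
proof (cases u)
  case (Pair q v)
  show ?thesis unfolding tangent_space_def Pair fst_conv snd_conv by blast
qed

lemma tangent_spaceD:
  assumes "u \<in> tangent_space A p"
  shows "fst u = p" "p \<in> points A"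
    "c \<in> charts_at A p \<Longrightarrow> d \<in> charts_at A p \<Longrightarrow>
      frechet_derivative (transition c d) (at (snd c p)) (snd u c) = snd u d"
    "c \<notin> charts_at A p \<Longrightarrow> snd u c = 0"
  using assms[unfolded tangent_space_iff] by metis+

lemma tangent_iff: "u \<in> tangent A \<longleftrightarrow> u \<in> tangent_space A (fst u)"
  unfolding tangent_def UN_iff by (metis tangent_spaceD(1) tangent_spaceD(2))

text \<open>The differentials of transition maps compose, so compatibility with one reference chart
  implies compatibility between any two charts.\<close>

lemma tangent_spaceI:
  assumes A: "smooth_atlas s A" "1 \<le> s" and p: "c \<in> charts_at A p" "fst u = p"
    and trans: "\<And>d. d \<in> charts_at A p \<Longrightarrow>
      snd u d = frechet_derivative (transition c d) (at (snd c p)) w"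
    and zero: "\<And>d. d \<notin> charts_at A p \<Longrightarrow> snd u d = 0"
  shows "u \<in> tangent_space A p"
proof -
  have "snd u e = frechet_derivative (transition d e) (at (snd d p)) (snd u d)"
    if "d \<in> charts_at A p" "e \<in> charts_at A p" for d e
    using frechet_derivative_transition_left[OF A(1) smooth_map_ident[OF A(1)] A(2) p(1) that]
      trans that by (simp add: transition_altdef)
  moreover have "p \<in> points A"
    unfolding points_iff using p(1) by (rule exI)
  ultimately show ?thesis
    using p(2) zero unfolding tangent_space_iff by blast
qed

lemma tvec_of_in:
  "smooth_atlas s A \<Longrightarrow> 1 \<le> s \<Longrightarrow> c \<in> charts_at A p \<Longrightarrow> tvec_of A c p w \<in> tangent_space A p"
  by (rule tangent_spaceI) (auto simp: tvec_of_def)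

lemma fst_tvec_of [simp]: "fst (tvec_of A c p w) = p"
  by (simp add: tvec_of_def)

lemma snd_tvec_of:
  "smooth_atlas s A \<Longrightarrow> c \<in> charts_at A p \<Longrightarrow> snd (tvec_of A c p w) c = w"
  by (simp add: tvec_of_def frechet_derivative_transition_self)

lemma tvec_of_snd:
  assumes "u \<in> tangent_space A p" "c \<in> charts_at A p"
  shows "tvec_of A c p (snd u c) = u"
proof (rule prod_eqI)
  show "snd (tvec_of A c p (snd u c)) = snd u"
    using tangent_spaceD(3)[OF assms] tangent_spaceD(4)[OF assms(1)] by (auto simp: tvec_of_def fun_eq_iff)
qed (use tangent_spaceD[OF assms(1)] in simp)

lemma tangent_space_eqI:
  "u \<in> tangent_space A p \<Longrightarrow> v \<in> tangent_space A p \<Longrightarrow> c \<in> charts_at A p \<Longrightarrow> snd u c = snd v c \<Longrightarrow> u = v"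
  by (metis tvec_of_snd)

lemma tzero_in:
  assumes "smooth_atlas s A" "1 \<le> s" "p \<in> points A"
  shows "tzero p \<in> tangent_space A p"
proof -
  obtain c where c: "c \<in> charts_at A p" using assms(3) by (auto simp: points_iff)
  show ?thesis
    by (rule tangent_spaceI[OF assms(1,2) c, where w=0])
       (use linear_0[OF linear_frechet_transition[OF assms(1,2) c]] in \<open>auto simp: tzero_def\<close>)
qed

lemma tadd_in:
  assumes "smooth_atlas s A" "1 \<le> s" "u \<in> tangent_space A p" "v \<in> tangent_space A p"
  shows "tadd u v \<in> tangent_space A p"
proof -
  note u = tangent_spaceD[OF assms(3)] and v = tangent_spaceD[OF assms(4)]
  obtain c where c: "c \<in> charts_at A p" using u by (auto simp: points_iff)
  show ?thesis
    by (rule tangent_spaceI[OF assms(1,2) c, where w="snd u c + snd v c"])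
       (use linear_add[OF linear_frechet_transition[OF assms(1,2) c]] u v c in \<open>auto simp: tadd_def\<close>)
qed

lemma tscale_in:
  assumes "smooth_atlas s A" "1 \<le> s" "u \<in> tangent_space A p"
  shows "tscale t u \<in> tangent_space A p"
proof -
  note u = tangent_spaceD[OF assms(3)]
  obtain c where c: "c \<in> charts_at A p" using u by (auto simp: points_iff)
  show ?thesis
    by (rule tangent_spaceI[OF assms(1,2) c, where w="t *\<^sub>R snd u c"])
       (use linear_scale[OF linear_frechet_transition[OF assms(1,2) c]] u c in \<open>auto simp: tscale_def\<close>)
qed

text \<open>Removes the arbitrary chart chosen in the definition of \<open>tmap\<close>: the
  coordinate change of the vector cancels that of the map.\<close>

lemma tmap_eq:
  assumes A: "smooth_atlas s A" and f: "smooth_map s A D f" "1 \<le> s"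
    and c: "c \<in> charts_at A p" and u: "u \<in> tangent_space A p"
  shows "tmap A D f u = (f p, \<lambda>d. if d \<in> charts_at D (f p)
    then frechet_derivative (snd d \<circ> f \<circ> of_coords c) (at (snd c p)) (snd u c) else 0)"
proof -
  define c' where "c' = (SOME c. c \<in> charts_at A p)"
  have c': "c' \<in> charts_at A p" unfolding c'_def using c by (rule someI)
  have "frechet_derivative (snd d \<circ> f \<circ> of_coords c') (at (snd c' p)) (snd u c') =
      frechet_derivative (snd d \<circ> f \<circ> of_coords c) (at (snd c p)) (snd u c)"
    if "d \<in> charts_at D (f p)" for d
    using frechet_derivative_transition_left[OF A f c c' that] tangent_spaceD(3)[OF u c c'] by simp
  then show ?thesis
    using u tangent_spaceD(1)[OF u] by (auto simp: tmap_def tangent_iff Let_def c'_def fun_eq_iff)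
qed

lemma snd_tmap:
  assumes "smooth_atlas s A" "smooth_map s A D f" "1 \<le> s"
    "c \<in> charts_at A p" "u \<in> tangent_space A p" "d \<in> charts_at D (f p)"
  shows "snd (tmap A D f u) d = frechet_derivative (snd d \<circ> f \<circ> of_coords c) (at (snd c p)) (snd u c)"
  using tmap_eq[OF assms(1-5)] assms(6) by simp

lemma tmap_in:
  assumes A: "smooth_atlas s A" and D: "smooth_atlas s D" and f: "smooth_map s A D f" and s: "1 \<le> s"
    and u: "u \<in> tangent_space A p"
  shows "tmap A D f u \<in> tangent_space D (f p)"
proof -
  obtain c where c: "c \<in> charts_at A p" using tangent_spaceD(2)[OF u] by (auto simp: points_iff)
  obtain d where d: "d \<in> charts_at D (f p)"
    using smooth_map_points[OF f tangent_spaceD(2)[OF u]] by (auto simp: points_iff)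
  show ?thesis
    by (rule tangent_spaceI[OF D s d])
       (use tmap_eq[OF A f s c u] frechet_derivative_transition_right[OF A D f s c d] in auto)
qed

lemma tmap_comp:
  assumes A: "smooth_atlas s A" and D: "smooth_atlas s D" and f: "smooth_map s A D f"
    and g: "smooth_map s D E g" and gf: "smooth_map s A E (\<lambda>p. g (f p))" and s: "1 \<le> s"
    and u: "u \<in> tangent_space A p"
  shows "tmap A E (\<lambda>p. g (f p)) u = tmap D E g (tmap A D f u)"
proof -
  obtain c where c: "c \<in> charts_at A p" using tangent_spaceD(2)[OF u] by (auto simp: points_iff)
  obtain d where d: "d \<in> charts_at D (f p)"
    using smooth_map_points[OF f tangent_spaceD(2)[OF u]] by (auto simp: points_iff)
  show ?thesis
    using frechet_derivative_smooth_comp[OF A D f g s c d]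
    by (simp add: tmap_eq[OF A gf s c u] tmap_eq[OF D g s d tmap_in[OF A D f s u]]
        snd_tmap[OF A f s c u d] fun_eq_iff)
qed

text \<open>Shadows and base maps are extensional, whereas compositions are built from unrestricted
  functions; this rule and its analogue for \<open>tmap\<close> pass between the two.\<close>

lemma smooth_map_cong:
  assumes A: "smooth_atlas s A" and f: "smooth_map s A D f" and eq: "\<And>p. p \<in> points A \<Longrightarrow> f p = g p"
  shows "smooth_map s A D g"
proof -
  have "fst c \<inter> f -` S = fst c \<inter> g -` S" if "c \<in> A" for c and S
    using eq pointsI[OF that] by auto
  moreover have "Cr_on s (snd d \<circ> g \<circ> of_coords c) (snd c ` (fst c \<inter> f -` fst d))"
    if cd: "c \<in> A" "d \<in> D" for c d
  proof (rule Cr_on_cong)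
    show "open (snd c ` (fst c \<inter> f -` fst d))"
      "Cr_on s (snd d \<circ> f \<circ> of_coords c) (snd c ` (fst c \<inter> f -` fst d))"
      using f cd by (auto simp: smooth_map_def)
    show "(snd d \<circ> f \<circ> of_coords c) z = (snd d \<circ> g \<circ> of_coords c) z"
      if "z \<in> snd c ` (fst c \<inter> f -` fst d)" for z
    proof -
      have "of_coords c z \<in> points A" using that of_coords_in[of z c] pointsI[OF cd(1)] by blast
      then show ?thesis using eq by simp
    qed
  qed
  moreover have "g \<in> points A \<rightarrow> points D" using smooth_map_points[OF f] eq by (metis Pi_I)
  ultimately show ?thesis using f by (simp add: smooth_map_def)
qed

lemma tmap_cong:
  assumes A: "smooth_atlas s A" and f: "smooth_map s A D f" and s: "1 \<le> s"
    and eq: "\<And>p. p \<in> points A \<Longrightarrow> f p = g p"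
  shows "tmap A D f = tmap A D g"
proof (rule ext)
  fix u
  show "tmap A D f u = tmap A D g u"
  proof (cases "u \<in> tangent A")
    case True
    then have u: "u \<in> tangent_space A (fst u)" by (simp add: tangent_iff)
    obtain c where c: "c \<in> charts_at A (fst u)" using tangent_spaceD(2)[OF u] by (auto simp: points_iff)
    note g = smooth_map_cong[OF A f eq]
    have fg: "f (fst u) = g (fst u)" using eq tangent_spaceD(2)[OF u] by simp
    have "frechet_derivative (snd d \<circ> f \<circ> of_coords c) (at (snd c (fst u))) =
        frechet_derivative (snd d \<circ> g \<circ> of_coords c) (at (snd c (fst u)))"
      if "d \<in> charts_at D (f (fst u))" for d
    proof (rule frechet_derivative_transform_within_open)
      show "(snd d \<circ> f \<circ> of_coords c) differentiable at (snd c (fst u))"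
        using smooth_map_has_derivative[OF f s c that] by (auto simp: differentiable_def)
      show "open (snd c ` fst c)" "snd c (fst u) \<in> snd c ` fst c"
        using c A by (auto simp: charts_at_iff open_chart_image)
      show "(snd d \<circ> f \<circ> of_coords c) z = (snd d \<circ> g \<circ> of_coords c) z" if "z \<in> snd c ` fst c" for z
        using eq[OF pointsI[OF _ of_coords_in[OF that]]] c by (simp add: charts_at_iff)
    qed
    then show ?thesis
      using fg by (auto simp: tmap_eq[OF A f s c u] tmap_eq[OF A g s c u] fun_eq_iff)
  next
    case False
    then show ?thesis by (simp add: tmap_def)
  qed
qed

lemma fst_tmap: "u \<in> tangent A \<Longrightarrow> fst (tmap A D f u) = f (fst u)"
  by (simp add: tmap_def Let_def)

lemma tlinear_on_tmap:
  assumes A: "smooth_atlas s A" and f: "smooth_map s A D f" and s: "1 \<le> s"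
  shows "tlinear_on (tangent_space A p) (tmap A D f)"
proof (cases "p \<in> points A")
  case True
  then obtain c where c: "c \<in> charts_at A p" by (auto simp: points_iff)
  have lin: "linear (frechet_derivative (snd d \<circ> f \<circ> of_coords c) (at (snd c p)))"
    if "d \<in> charts_at D (f p)" for d
    using smooth_map_has_derivative[OF f s c that] has_derivative_linear by blast
  show ?thesis
    unfolding tlinear_on_def
  proof (intro conjI ballI allI)
    fix u w assume u: "u \<in> tangent_space A p" and w: "w \<in> tangent_space A p"
    show "tmap A D f (tadd u w) = tadd (tmap A D f u) (tmap A D f w)"
      using lin by (auto simp: tmap_eq[OF A f s c] u w tadd_in[OF A s u w] fun_eq_iff linear_add)
         (auto simp: tadd_def linear_add)
  next
    fix t u assume u: "u \<in> tangent_space A p"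
    show "tmap A D f (tscale t u) = tscale t (tmap A D f u)"
      using lin by (auto simp: tmap_eq[OF A f s c] u tscale_in[OF A s u] fun_eq_iff linear_scale)
         (auto simp: tscale_def linear_scale)
  qed
next
  case False
  then have "tangent_space A p = {}" by (auto simp: tangent_space_def)
  then show ?thesis by (simp add: tlinear_on_def)
qed

section \<open>Topology of a manifold\<close>

lemma openin_man_topology:
  "c \<in> A \<Longrightarrow> open S \<Longrightarrow> openin (man_topology A) (fst c \<inter> snd c -` S)"
  unfolding man_topology_def by (rule topology_generated_by_Basis) blast

lemma topspace_man_topology: "topspace (man_topology A) = points A"
proof (intro equalityI subsetI)
  fix p assume "p \<in> points A"
  then obtain c where "c \<in> A" "p \<in> fst c" by (auto simp: points_def)
  then show "p \<in> topspace (man_topology A)"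
    using openin_subset[OF openin_man_topology[OF _ open_UNIV]] by fastforce
qed (auto simp: man_topology_def points_def)

text \<open>The points with value \<open>v0\<close> and the points with some other value are both
  open, because values persist locally, and disjoint, because values are unique. The statement uses
  a relation since the value at a point is known only through existence and uniqueness.\<close>

lemma connected_space_locally_constant_relation:
  assumes X: "connected_space X" and ne: "topspace X \<noteq> {}"
    and ex: "\<And>p. p \<in> topspace X \<Longrightarrow> \<exists>v. G p v"
    and uniq: "\<And>p v v'. p \<in> topspace X \<Longrightarrow> G p v \<Longrightarrow> G p v' \<Longrightarrow> v = v'"
    and loc: "\<And>p v. p \<in> topspace X \<Longrightarrow> G p v \<Longrightarrow> \<exists>N. openin X N \<and> p \<in> N \<and> (\<forall>q\<in>N. G q v)"
  shows "\<exists>v. \<forall>p\<in>topspace X. G p v"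
proof -
  obtain p0 v0 where p0: "p0 \<in> topspace X" "G p0 v0" using ne ex by blast
  define U where "U = {p \<in> topspace X. G p v0}"
  define V where "V = {p \<in> topspace X. \<exists>v. v \<noteq> v0 \<and> G p v}"
  have "openin X U"
  proof (subst openin_subopen, intro ballI)
    fix p assume "p \<in> U"
    then obtain N where "openin X N" "p \<in> N" "\<forall>q\<in>N. G q v0" using loc[of p v0] by (auto simp: U_def)
    then show "\<exists>T. openin X T \<and> p \<in> T \<and> T \<subseteq> U"
      using openin_subset[of X N] by (auto simp: U_def intro!: exI[of _ N])
  qed
  moreover have "openin X V"
  proof (subst openin_subopen, intro ballI)
    fix p assume "p \<in> V"
    then obtain v where v: "p \<in> topspace X" "G p v" "v \<noteq> v0" by (auto simp: V_def)
    then obtain N where "openin X N" "p \<in> N" "\<forall>q\<in>N. G q v" using loc[of p v] by auto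
    then show "\<exists>T. openin X T \<and> p \<in> T \<and> T \<subseteq> V"
      using openin_subset[of X N] v(3) by (auto simp: V_def intro!: exI[of _ N])
  qed
  moreover have "topspace X \<subseteq> U \<union> V" "U \<inter> V = {}"
    using ex uniq by (fastforce simp: U_def V_def)+
  moreover have "U \<noteq> {}" using p0 by (auto simp: U_def)
  ultimately have "V = {}" using X by (auto simp: connected_space_def)
  then show ?thesis using \<open>topspace X \<subseteq> U \<union> V\<close> by (auto simp: U_def)
qed

section \<open>The tangent atlas\<close>

lemma tangent_atlas_points: "points (tangent_atlas A) = tangent A"
proof -
  have "u \<in> points (tangent_atlas A)" if "u \<in> tangent A" for u
  proof -
    have "fst u \<in> points A" using that tangent_spaceD(2)[of u A "fst u"] by (simp add: tangent_iff)
    then show ?thesis using that by (auto simp: points_def tangent_atlas_def)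
  qed
  then show ?thesis by (auto simp: points_def tangent_atlas_def)
qed

abbreviation tchart :: "('p, 'e::euclidean_space) atlas \<Rightarrow> ('p, 'e) chart \<Rightarrow> (('p, 'e) tvec, 'e \<times> 'e) chart" where
  "tchart A c \<equiv> ({u \<in> tangent A. fst u \<in> fst c}, \<lambda>u. (snd c (fst u), snd u c))"

lemma tangent_atlas_eq: "tangent_atlas A = tchart A ` A"
  by (simp add: tangent_atlas_def)

lemma tchart_image:
  fixes A :: "('a, 'b::euclidean_space) atlas"
  assumes "smooth_atlas s A" "1 \<le> s" "c \<in> A"
  shows "snd (tchart A c) ` fst (tchart A c) = (snd c ` fst c) \<times> UNIV"
proof (intro equalityI subsetI)
  fix x :: "'b \<times> 'b"
  assume "x \<in> (snd c ` fst c) \<times> UNIV"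
  then obtain p w where x: "x = (snd c p, w)" "p \<in> fst c" by auto
  then have c: "c \<in> charts_at A p" using assms by (simp add: charts_at_iff)
  have "tvec_of A c p w \<in> tangent A" using tvec_of_in[OF assms(1,2) c] by (simp add: tangent_iff)
  then show "x \<in> snd (tchart A c) ` fst (tchart A c)"
    using x snd_tvec_of[OF assms(1) c, of w] by (auto intro!: image_eqI[where x="tvec_of A c p w"])
qed auto

lemma tchart_inj: "smooth_atlas s A \<Longrightarrow> c \<in> A \<Longrightarrow> inj_on (snd (tchart A c)) (fst (tchart A c))"
proof (rule inj_onI)
  fix u v assume A: "smooth_atlas s A" "c \<in> A" and u: "u \<in> fst (tchart A c)" and v: "v \<in> fst (tchart A c)"
    and eq: "snd (tchart A c) u = snd (tchart A c) v"
  have "fst u = fst v"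
    using of_coords_snd[OF A] u v eq by (metis (no_types, lifting) fst_conv mem_Collect_eq snd_conv)
  then show "u = v"
    using u v eq A by (intro tangent_space_eqI[of u A "fst u" v c]) (auto simp: tangent_iff charts_at_iff)
qed

lemma of_coords_tchart:
  assumes "smooth_atlas s A" "1 \<le> s" "c \<in> A" "z \<in> snd c ` fst c"
  shows "of_coords (tchart A c) (z, w) = tvec_of A c (of_coords c z) w"
proof -
  have c: "c \<in> charts_at A (of_coords c z)" using of_coords_in[OF assms(4)] assms(3) by (simp add: charts_at_iff)
  have "tvec_of A c (of_coords c z) w \<in> fst (tchart A c)"
    using tvec_of_in[OF assms(1,2) c] c by (auto simp: tangent_iff charts_at_iff)
  moreover have "snd (tchart A c) (tvec_of A c (of_coords c z) w) = (z, w)"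
    using snd_tvec_of[OF assms(1) c] snd_of_coords[OF assms(4)] by simp
  ultimately show ?thesis
    using inv_into_f_f[OF tchart_inj[OF assms(1,3)], of "tvec_of A c (of_coords c z) w"]
    unfolding of_coords_def[of "tchart A c"] by argo
qed

section \<open>The ambient space and the generalised Galilean group\<close>

lemma of_coords_std [simp]: "of_coords std = id"
  by (simp add: of_coords_def fun_eq_iff)

lemma points_std [simp]: "points {std} = UNIV"
  by (simp add: points_def)

lemma charts_at_std [simp]: "charts_at {std} p = {std}"
  by (auto simp: charts_at_def)

lemma smooth_atlas_std: "smooth_atlas s {std :: ('a::euclidean_space, 'a) chart}"
  using Cr_on_ident[OF open_UNIV, of s, where 'a='a] unfolding id_def[symmetric]
  by (simp add: smooth_atlas_def transition_def)

text \<open>With a single global chart a tangent vector is just a base point and a coordinate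
  vector. All computations in the ambient bundle are done in this normal form.\<close>

abbreviation evec :: "'a::euclidean_space \<Rightarrow> 'a \<Rightarrow> ('a, 'a) tvec" where
  "evec a w \<equiv> tvec_of {std} std a w"

lemma snd_evec [simp]: "snd (evec a w) std = w"
  by (rule snd_tvec_of[OF smooth_atlas_std]) simp

lemma evec_in [simp]: "evec a w \<in> tangent_space {std} a"
  by (rule tvec_of_in[OF smooth_atlas_std[of 1]]) simp_all

lemma evec_in_tangent [simp]: "evec a w \<in> tangent {std}"
  by (simp add: tangent_iff)

lemma evec_snd: "u \<in> tangent_space {std} a \<Longrightarrow> evec a (snd u std) = u"
  by (rule tvec_of_snd) auto

lemma evec_snd_tangent: "u \<in> tangent {std} \<Longrightarrow> evec (fst u) (snd u std) = u"
  by (simp add: tangent_iff evec_snd)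

lemma tangent_std_cases:
  assumes "u \<in> tangent {std}"
  obtains a w where "u = evec a w"
  using evec_snd_tangent[OF assms] by metis

lemma evec_eq_iff [simp]: "evec a w = evec a' w' \<longleftrightarrow> a = a' \<and> w = w'"
  by (metis fst_tvec_of snd_evec)

lemma tvec_std_eqI:
  "u \<in> tangent_space {std} a \<Longrightarrow> v \<in> tangent_space {std} a \<Longrightarrow> snd u std = snd v std \<Longrightarrow> u = v"
  by (metis evec_snd)

lemma smooth_map_std:
  "smooth_map s A {std} f \<longleftrightarrow>
    (\<forall>c\<in>A. open (snd c ` fst c) \<and> Cr_on s (f \<circ> of_coords c) (snd c ` fst c))"
  by (simp add: smooth_map_def)

lemma smooth_map_std_std: "smooth_map s {std} {std} f \<longleftrightarrow> Cr_on s f UNIV"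
  by (simp add: smooth_map_std)

lemma tmap_std:
  assumes "smooth_atlas s A" "smooth_map s A {std} f" "1 \<le> s" "c \<in> charts_at A p"
    "u \<in> tangent_space A p"
  shows "tmap A {std} f u =
    evec (f p) (frechet_derivative (f \<circ> of_coords c) (at (snd c p)) (snd u c))"
proof (rule tvec_std_eqI)
  show "tmap A {std} f u \<in> tangent_space {std} (f p)"
    by (rule tmap_in[OF assms(1) smooth_atlas_std assms(2,3,5)])
  show "snd (tmap A {std} f u) std =
      snd (evec (f p) (frechet_derivative (f \<circ> of_coords c) (at (snd c p)) (snd u c))) std"
    using snd_tmap[OF assms, of std] by simp
qed simp

lemma tmap_std_std:
  assumes "Cr_on s f UNIV" "1 \<le> s"
  shows "tmap {std} {std} f (evec a w) = evec (f a) (frechet_derivative f (at a) w)"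
  using tmap_std[OF smooth_atlas_std, of s f std a "evec a w"] assms
  by (simp add: smooth_map_std_std)

section \<open>Galilean maps of the ambient bundle and their tangent maps\<close>

definition gal_map :: "(R3 \<Rightarrow> R3) \<Rightarrow> R3 \<Rightarrow> R3 \<Rightarrow> R3 \<times> R3 \<Rightarrow> R3 \<times> R3" where
  "gal_map R t s a = (R (fst a) + t, R (snd a) + s)"

definition gal_lin :: "(R3 \<Rightarrow> R3) \<Rightarrow> R3 \<times> R3 \<Rightarrow> R3 \<times> R3" where
  "gal_lin R w = (R (fst w), R (snd w))"

abbreviation Tgal :: "(R3 \<Rightarrow> R3) \<Rightarrow> R3 \<Rightarrow> R3 \<Rightarrow> TE \<Rightarrow> TE" where
  "Tgal R t s \<equiv> tmap {std} {std} (gal_map R t s)"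

lemma linear_gal_lin: "linear R \<Longrightarrow> linear (gal_lin R)"
  by (auto simp: gal_lin_def linear_iff scaleR_prod_def)

lemma gal_map_affine: "gal_map R t s = (\<lambda>a. gal_lin R a + (t, s))"
  by (simp add: fun_eq_iff gal_map_def gal_lin_def)

lemma gal_map_has_derivative:
  "linear R \<Longrightarrow> (gal_map R t s has_derivative gal_lin R) (at a)"
  unfolding gal_map_affine
  by (auto intro!: derivative_eq_intros bounded_linear_imp_has_derivative
      simp: linear_conv_bounded_linear[symmetric] linear_gal_lin)

lemma Cr_on_affine: "open S \<Longrightarrow> linear (h :: 'a::euclidean_space \<Rightarrow> _) \<Longrightarrow> Cr_on s (\<lambda>a. h a + t) S"
  by (intro Cr_on_add Cr_on_linear Cr_on_const) (auto simp: linear_conv_bounded_linear)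

lemma Cr_on_gal_map: "linear R \<Longrightarrow> Cr_on s (gal_map R t b) UNIV"
  unfolding gal_map_affine by (rule Cr_on_affine) (auto simp: linear_gal_lin)

lemma smooth_gal_map: "linear R \<Longrightarrow> smooth_map r {std} {std} (gal_map R t s)"
  by (simp add: smooth_map_std_std Cr_on_gal_map)

lemma Tgal_evec: "linear R \<Longrightarrow> Tgal R t s (evec a w) = evec (gal_map R t s a) (gal_lin R w)"
  using tmap_std_std[OF Cr_on_gal_map[of R 1 t s]] frechet_derivative_at[OF gal_map_has_derivative[of R t s a]]
  by simp

lemma orth_linear: "orthogonal_transformation R \<Longrightarrow> linear R"
  by (rule orthogonal_transformation_linear)

lemma Tgal_comp:
  assumes "linear R" "linear R'"
  shows "compose (tangent {std}) (Tgal R t s) (Tgal R' t' s') = Tgal (R \<circ> R') (R t' + t) (R s' + s)"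
proof (rule ext)
  fix U :: TE
  show "compose (tangent {std}) (Tgal R t s) (Tgal R' t' s') U = Tgal (R \<circ> R') (R t' + t) (R s' + s) U"
  proof (cases "U \<in> tangent {std}")
    case True
    then obtain a w where U: "U = evec a w" by (rule tangent_std_cases)
    show ?thesis
      using assms by (simp add: U compose_def Tgal_evec linear_compose linear_add[OF assms(1)]
          gal_map_def gal_lin_def)
  qed (simp add: compose_def tmap_def)
qed

lemma Tgal_id: "Tgal id 0 0 = (\<lambda>U\<in>tangent {std}. U)"
proof (rule ext)
  fix U :: TE
  show "Tgal id 0 0 U = (\<lambda>U\<in>tangent {std}. U) U"
  proof (cases "U \<in> tangent {std}")
    case True
    then obtain a w where U: "U = evec a w" by (rule tangent_std_cases)
    show ?thesis by (simp add: U Tgal_evec linear_id gal_map_def gal_lin_def)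
  qed (simp add: tmap_def)
qed

lemma Tgal_closed: "linear R \<Longrightarrow> U \<in> tangent {std} \<Longrightarrow> Tgal R t s U \<in> tangent {std}"
  by (metis Tgal_evec evec_in_tangent tangent_std_cases)

lemma tot_Eamb [simp]: "tot Eamb = {std}" and bas_Eamb [simp]: "bas Eamb = {std}"
  and prj_Eamb [simp]: "prj Eamb = fst"
  by (simp_all add: Eamb_def EE_def)

lemma iota_evec: "iota (evec a w) = evec (fst a) (fst w + snd w)"
  by (simp add: iota_def EE_def)

lemma gal_map_in_Aff:
  assumes R: "linear R"
  shows "gal_map R t s \<in> Aff r Eamb Eamb"
proof -
  have "smooth_map r {std} {std} (\<lambda>x. R x + t)"
    unfolding smooth_map_std_std using R by (simp add: Cr_on_affine)
  moreover have "affine_fun (\<lambda>y. snd (gal_map R t s (fst p, y)))" for p :: "R3 \<times> R3"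
    using R by (simp add: affine_fun_def gal_map_def linear_0)
  ultimately show ?thesis
    using smooth_gal_map[OF R]
    by (auto simp: Aff_def fibre_pt_def gal_map_def[of R t s "_"] intro!: exI[of _ "\<lambda>x. R x + t"])
qed

lemma tmap_gal_base:
  assumes "linear R"
  shows "tmap {std} {std} (\<lambda>x. R x + t) (evec x v) = evec (R x + t) (R (v::R3))"
proof -
  have "((\<lambda>x. R x + t) has_derivative R) (at x)"
    using assms by (auto intro!: derivative_eq_intros bounded_linear_imp_has_derivative
        simp: linear_conv_bounded_linear)
  from frechet_derivative_at[OF this] show ?thesis
    using tmap_std_std[OF Cr_on_affine[OF open_UNIV assms], of 1 t x v] by simp
qed

text \<open>Compatibility with \<open>iota\<close> has two halves. The base points give
  \<open>fst (a p) = R (fst p) + t\<close>; the vectors say that the two components of the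
  derivative of \<open>a\<close> add up to \<open>R (fst w + snd w)\<close>. The first half fixes
  one summand as \<open>R (fst w)\<close>, so the other is \<open>R (snd w)\<close>. Hence
  \<open>snd (a p) - R (snd p)\<close> has zero derivative everywhere and is the constant
  \<open>s\<close>.\<close>

lemma gen_Gal_eq: "gen_Gal r = {Tgal R t s | R t s. orthogonal_transformation R}"
proof (intro equalityI subsetI)
  fix G assume "G \<in> {Tgal R t s | R t s. orthogonal_transformation R}"
  then obtain R t s where G: "G = Tgal R t s" and R: "orthogonal_transformation R" by blast
  note lin = orth_linear[OF R]
  have "tmap EE EE (\<lambda>x. R x + t) \<in> TGal" using R by (auto simp: TGal_def Gal_def)
  moreover have "iota (Tgal R t s U) = tmap EE EE (\<lambda>x. R x + t) (iota U)" if "U \<in> tangent {std}" for U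
  proof -
    obtain a w where U: "U = evec a w" using \<open>U \<in> tangent {std}\<close> by (rule tangent_std_cases)
    show ?thesis
      by (simp add: U Tgal_evec[OF lin] iota_evec EE_def tmap_gal_base[OF lin])
        (simp add: gal_map_def gal_lin_def linear_add[OF lin])
  qed
  ultimately show "G \<in> gen_Gal r"
    using gal_map_in_Aff[OF lin, of t s "r + 1"] unfolding gen_Gal_def G tot_Eamb by blast
next
  fix G assume "G \<in> gen_Gal r"
  then obtain a h where G: "G = tmap {std} {std} a" and a: "a \<in> Aff (r + 1) Eamb Eamb"
    and h: "h \<in> TGal" and eq: "\<And>U. U \<in> tangent {std} \<Longrightarrow> iota (tmap {std} {std} a U) = h (iota U)"
    by (auto simp: gen_Gal_def)
  obtain R t where hR: "h = tmap {std} {std} (\<lambda>x. R x + t)" and R: "orthogonal_transformation R"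
    using h by (auto simp: TGal_def Gal_def EE_def)
  note lin = orth_linear[OF R]
  have r: "1 \<le> r + 1" by simp
  have a_smooth: "Cr_on (r + 1) a UNIV" using a by (simp add: Aff_def smooth_map_std_std)
  have a_der: "(a has_derivative frechet_derivative a (at p)) (at p)" for p
    using Cr_on_differentiable[OF a_smooth r] frechet_derivative_works by blast
  have "fst (a p) = R (fst p) + t \<and>
      fst (frechet_derivative a (at p) w) + snd (frechet_derivative a (at p) w) = R (fst w + snd w)" for p w
    using eq[of "evec p w"]
    by (simp add: tmap_std_std[OF a_smooth r] iota_evec hR tmap_gal_base[OF lin])
  then have fst_a: "fst (a p) = R (fst p) + t"
    and sum: "fst (frechet_derivative a (at p) w) + snd (frechet_derivative a (at p) w) = R (fst w + snd w)"
    for p w by auto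
  have "((\<lambda>p. fst (a p)) has_derivative (\<lambda>w. R (fst w))) (at p)" for p
    unfolding fst_a using lin
    by (auto intro!: derivative_eq_intros bounded_linear.has_derivative[of R]
        simp: linear_conv_bounded_linear)
  then have "fst (frechet_derivative a (at p) w) = R (fst w)" for p w
    using has_derivative_unique[OF has_derivative_fst[OF a_der]] by metis
  then have snd_der: "snd (frechet_derivative a (at p) w) = R (snd w)" for p w
    using sum[of p w] by (simp add: linear_add[OF lin])
  have "((\<lambda>p. snd (a p) - R (snd p)) has_derivative (\<lambda>w. snd (frechet_derivative a (at p) w) - R (snd w))) (at p)" for p
    using lin
    by (intro has_derivative_diff has_derivative_snd[OF a_der]
        bounded_linear.has_derivative[OF _ has_derivative_snd[OF has_derivative_ident]])
      (simp add: linear_conv_bounded_linear)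
  then have "\<exists>s. \<forall>p\<in>UNIV. snd (a p) - R (snd p) = s"
    by (intro has_derivative_zero_constant) (auto simp: snd_der)
  then obtain s where "\<And>p. snd (a p) = R (snd p) + s" by (metis UNIV_I diff_add_cancel add.commute)
  then have "a = gal_map R t s" using fst_a by (auto simp: fun_eq_iff gal_map_def prod_eq_iff)
  then show "G \<in> {Tgal R t s | R t s. orthogonal_transformation R}" using G R by blast
qed

lemma gen_Gal_I: "orthogonal_transformation R \<Longrightarrow> Tgal R t s \<in> gen_Gal r"
  unfolding gen_Gal_eq by blast

lemma gen_Gal_E:
  assumes "g \<in> gen_Gal r"
  obtains R t s where "g = Tgal R t s" "orthogonal_transformation R"
  using assms unfolding gen_Gal_eq by blast

lemma gen_Gal_left_inverse:
  assumes "g \<in> gen_Gal r"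
  shows "\<exists>g'\<in>gen_Gal r. compose (tangent {std}) g' g = (\<lambda>U\<in>tangent {std}. U)"
proof -
  obtain R t s where g: "g = Tgal R t s" and R: "orthogonal_transformation R"
    using assms by (rule gen_Gal_E)
  have "bij R" using R by (rule orthogonal_transformation_bij)
  define R' where "R' = inv_into UNIV R"
  have R': "orthogonal_transformation R'" unfolding R'_def using R by (rule orthogonal_transformation_inv)
  have "R' \<circ> R = id" unfolding R'_def using \<open>bij R\<close> by (simp add: bij_is_inj)
  \<comment> \<open>The inverse of \<open>x \<mapsto> R x + t\<close> is
    \<open>x \<mapsto> R' x - R' t\<close>, and likewise on the second factor.\<close>
  then have "compose (tangent {std}) (Tgal R' (- R' t) (- R' s)) g = (\<lambda>U\<in>tangent {std}. U)"
    unfolding g by (subst Tgal_comp) (simp_all add: orth_linear R R' Tgal_id)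
  then show ?thesis using gen_Gal_I[OF R'] by blast
qed

lemma group_gen_Gal: "group (gen_Gal_group r)"
proof (rule groupI)
  show "\<one>\<^bsub>gen_Gal_group r\<^esub> \<in> carrier (gen_Gal_group r)"
    using gen_Gal_I[OF orthogonal_transformation_id[folded id_def], of 0 0 r]
    by (simp add: gen_Gal_group_def Tgal_id)
next
  fix x y assume "x \<in> carrier (gen_Gal_group r)" "y \<in> carrier (gen_Gal_group r)"
  then obtain R t s R' t' s' where x: "x = Tgal R t s" "orthogonal_transformation R"
    and y: "y = Tgal R' t' s'" "orthogonal_transformation R'"
    by (auto simp: gen_Gal_group_def elim!: gen_Gal_E)
  show "x \<otimes>\<^bsub>gen_Gal_group r\<^esub> y \<in> carrier (gen_Gal_group r)"
    using gen_Gal_I[OF orthogonal_transformation_compose[OF x(2) y(2)]]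
    by (simp add: gen_Gal_group_def x y Tgal_comp orth_linear)
next
  fix x y z assume "x \<in> carrier (gen_Gal_group r)" "y \<in> carrier (gen_Gal_group r)"
    and "z \<in> carrier (gen_Gal_group r)"
  then obtain R t s where "z = Tgal R t s" "orthogonal_transformation R"
    by (auto simp: gen_Gal_group_def elim!: gen_Gal_E)
  then have "z \<in> tangent {std} \<rightarrow> tangent {std}"
    using Tgal_closed orth_linear by blast
  then show "x \<otimes>\<^bsub>gen_Gal_group r\<^esub> y \<otimes>\<^bsub>gen_Gal_group r\<^esub> z =
      x \<otimes>\<^bsub>gen_Gal_group r\<^esub> (y \<otimes>\<^bsub>gen_Gal_group r\<^esub> z)"
    by (simp add: gen_Gal_group_def compose_assoc)
next
  fix x assume "x \<in> carrier (gen_Gal_group r)"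
  then obtain R t s where x: "x = Tgal R t s" "orthogonal_transformation R"
    by (auto simp: gen_Gal_group_def elim!: gen_Gal_E)
  show "\<one>\<^bsub>gen_Gal_group r\<^esub> \<otimes>\<^bsub>gen_Gal_group r\<^esub> x = x"
    by (simp add: gen_Gal_group_def x Tgal_id[symmetric] Tgal_comp orth_linear linear_id)
  show "\<exists>y\<in>carrier (gen_Gal_group r). y \<otimes>\<^bsub>gen_Gal_group r\<^esub> x = \<one>\<^bsub>gen_Gal_group r\<^esub>"
    using gen_Gal_left_inverse[of x r] \<open>x \<in> carrier (gen_Gal_group r)\<close>
    by (simp add: gen_Gal_group_def)
qed

section \<open>Affine bundles in trivialising coordinates\<close>

text \<open>Affinity as two identities between values, a form that can be differentiated with
  respect to a parameter.\<close>

lemma affine_funI: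
  assumes "\<And>y y'. f (y + y') = f y + f y' - f 0" "\<And>t y. f (t *\<^sub>R y) = f 0 + t *\<^sub>R (f y - f 0)"
  shows "affine_fun f"
  unfolding affine_fun_def by (rule linearI) (simp_all add: assms algebra_simps)

lemma affine_funD:
  assumes "affine_fun f"
  shows "f (y + y') = f y + f y' - f 0" "f (t *\<^sub>R y) = f 0 + t *\<^sub>R (f y - f 0)"
  using linear_add[OF assms[unfolded affine_fun_def], of y y']
    linear_scale[OF assms[unfolded affine_fun_def], of t y]
  by (simp_all add: algebra_simps)

lemma affine_fun_linear_comp:
  assumes "affine_fun f" "linear h"
  shows "affine_fun (\<lambda>y. h (f y))"
  by (rule affine_funI)
    (simp_all add: affine_funD[OF assms(1)] linear_add[OF assms(2)] linear_diff[OF assms(2)]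
      linear_scale[OF assms(2)])

lemma affine_fun_plus_const:
  "affine_fun f \<Longrightarrow> affine_fun (\<lambda>y. f y + a)"
  by (rule affine_funI) (simp_all add: affine_funD algebra_simps)

lemma affine_fun_const: "affine_fun (\<lambda>y. a)"
  by (rule affine_funI) simp_all

lemma affine_fun_Pair:
  "affine_fun f \<Longrightarrow> affine_fun g \<Longrightarrow> affine_fun (\<lambda>y. (f y, g y))"
  by (rule affine_funI)
    (simp_all add: prod_eq_iff affine_funD(1)[of f] affine_funD(1)[of g]
      affine_funD(2)[of f] affine_funD(2)[of g])

lemma Cr_on_comp_fst:
  fixes f :: "'a::euclidean_space \<Rightarrow> 'c::real_normed_vector"
  assumes "open S" "Cr_on r f S"
  shows "Cr_on r (\<lambda>x. f (fst x)) (S \<times> (UNIV :: 'b::euclidean_space set))"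
  by (rule Cr_on_compose[of _ S])
    (auto intro!: Cr_on_fst Cr_on_ident open_Times assms)

locale smooth_affine_bundle =
  fixes r :: enat and B :: "('p, 'f::euclidean_space, 'q, 'b::euclidean_space) affbundle"
  assumes r: "1 \<le> r" and affine_bundle: "affine_bundle (r + 1) B"
begin

lemma r1: "1 \<le> r + 1" and r_le: "r \<le> r + 1"
  by simp_all

lemma atlas_tot: "smooth_atlas (r + 1) (tot B)" and atlas_bas: "smooth_atlas (r + 1) (bas B)"
  and prj_smooth: "smooth_map (r + 1) (tot B) (bas B) (prj B)"
  and prj_points: "prj B ` points (tot B) = points (bas B)"
  and connected_tot: "connected_space (man_topology (tot B))"
  using affine_bundle by (simp_all add: affine_bundle_def manifold_def)

lemma trivialises_ex:
  assumes "c \<in> tot B"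
  obtains b where "trivialises B c b"
  using affine_bundle assms unfolding affine_bundle_def by blast

lemma trivialisesD:
  assumes "trivialises B c b"
  shows "c \<in> tot B" "b \<in> bas B" "snd c ` fst c = (snd b ` fst b) \<times> UNIV"
    "p \<in> fst c \<Longrightarrow> b \<in> charts_at (bas B) (prj B p)"
    "p \<in> fst c \<Longrightarrow> fst (snd c p) = snd b (prj B p)"
  using assms unfolding trivialises_def charts_at_iff by blast+

lemma trivial_ex_at:
  assumes "p \<in> points (tot B)"
  obtains c b where "trivialises B c b" "p \<in> fst c" "c \<in> charts_at (tot B) p"
    "b \<in> charts_at (bas B) (prj B p)"
proof -
  obtain c where c: "c \<in> charts_at (tot B) p" using assms unfolding points_iff by blast
  then have c': "c \<in> tot B" "p \<in> fst c" by (simp_all add: charts_at_iff)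
  obtain b where b: "trivialises B c b" using trivialises_ex[OF c'(1)] .
  show ?thesis using that[OF b c'(2) c trivialisesD(4)[OF b c'(2)]] .
qed

lemma chart_vertical_line:
  assumes "c \<in> tot B" "(x, y) \<in> snd c ` fst c"
  shows "(x, y') \<in> snd c ` fst c"
  using assms trivialisesD(3) by (metis SigmaD1 SigmaI UNIV_I trivialises_ex)

lemma fibre_pt:
  assumes "c \<in> tot B" "p \<in> fst c"
  shows "fibre_pt c p y \<in> fst c" "snd c (fibre_pt c p y) = (fst (snd c p), y)"
    "prj B (fibre_pt c p y) = prj B p"
proof -
  obtain b where b: "trivialises B c b" using assms trivialises_ex by blast
  have "(fst (snd c p), snd (snd c p)) \<in> snd c ` fst c" using assms by simp
  then have z: "(fst (snd c p), y) \<in> snd c ` fst c" using chart_vertical_line[OF assms(1)] by blast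
  show 1: "fibre_pt c p y \<in> fst c" "snd c (fibre_pt c p y) = (fst (snd c p), y)"
    using of_coords_in[OF z] snd_of_coords[OF z] by (simp_all add: fibre_pt_def)
  have "snd b (prj B (fibre_pt c p y)) = snd b (prj B p)"
    using trivialisesD(5)[OF b 1(1)] trivialisesD(5)[OF b assms(2)] 1(2) by simp
  then show "prj B (fibre_pt c p y) = prj B p"
    using trivialisesD(4)[OF b 1(1)] trivialisesD(4)[OF b assms(2)] of_coords_snd[OF atlas_bas]
    by (metis charts_at_iff)
qed

lemma tprj_in: "u \<in> tangent_space (tot B) p \<Longrightarrow> tprj B u \<in> tangent_space (bas B) (prj B p)"
  unfolding tprj_def by (rule tmap_in[OF atlas_tot atlas_bas prj_smooth r1])

lemma snd_tprj:
  assumes b: "trivialises B c b" and p: "p \<in> fst c" and u: "u \<in> tangent_space (tot B) p"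
  shows "snd (tprj B u) b = fst (snd u c)"
proof -
  note c = trivialisesD(1)[OF b]
  have "((snd b \<circ> prj B \<circ> of_coords c) has_derivative fst) (at (snd c p))"
  proof (rule has_derivative_transform_within_open)
    show "(fst has_derivative fst) (at (snd c p))"
      by (rule bounded_linear_imp_has_derivative[OF bounded_linear_fst])
    show "open (snd c ` fst c)" "snd c p \<in> snd c ` fst c"
      using open_chart_image[OF atlas_tot c] p by auto
    show "fst z = (snd b \<circ> prj B \<circ> of_coords c) z" if "z \<in> snd c ` fst c" for z
      using trivialisesD(5)[OF b of_coords_in[OF that]] snd_of_coords[OF that] by simp
  qed
  then have "frechet_derivative (snd b \<circ> prj B \<circ> of_coords c) (at (snd c p)) = fst"
    by (metis frechet_derivative_at)
  then show ?thesis
    using snd_tmap[OF atlas_tot prj_smooth r1 _ u trivialisesD(4)[OF b p], of c] c p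
    by (simp add: tprj_def charts_at_iff)
qed

lemma tprj_tvec_of:
  assumes b: "trivialises B c b" and p: "p \<in> fst c"
  shows "tprj B (tvec_of (tot B) c p w) = tvec_of (bas B) b (prj B p) (fst w)"
proof -
  have c: "c \<in> charts_at (tot B) p" using trivialisesD(1)[OF b] p by (simp add: charts_at_iff)
  note b' = trivialisesD(4)[OF b p]
  have t: "tvec_of (tot B) c p w \<in> tangent_space (tot B) p" by (rule tvec_of_in[OF atlas_tot r1 c])
  show ?thesis
    by (rule tangent_space_eqI[OF tprj_in[OF t] tvec_of_in[OF atlas_bas r1 b'] b'])
      (simp add: snd_tprj[OF b p t] snd_tvec_of[OF atlas_bas b'] snd_tvec_of[OF atlas_tot c])
qed

lemma vertical_iff:
  assumes b: "trivialises B c b" and p: "p \<in> fst c"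
  shows "u \<in> vertical B p \<longleftrightarrow> u \<in> tangent_space (tot B) p \<and> fst (snd u c) = 0"
proof -
  note b' = trivialisesD(4)[OF b p]
  have "prj B p \<in> points (bas B)" using b' unfolding points_iff by blast
  then have z: "tzero (prj B p) \<in> tangent_space (bas B) (prj B p)"
    by (rule tzero_in[OF atlas_bas r1])
  have "tprj B u = tzero (prj B p) \<longleftrightarrow> fst (snd u c) = 0" if u: "u \<in> tangent_space (tot B) p"
    using tangent_space_eqI[OF tprj_in[OF u] z b'] snd_tprj[OF b p u] by (auto simp: tzero_def)
  then show ?thesis by (auto simp: vertical_def)
qed

lemma vertical_subset: "u \<in> vertical B p \<Longrightarrow> u \<in> tangent_space (tot B) p"
  by (simp add: vertical_def)

section \<open>The fibre product and forms given by coordinate expressions\<close>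

lemma fibprod_points:
  "points (fibprod_atlas B) = {(a, u). a \<in> points (tot B) \<and> u \<in> tangent_space (bas B) (prj B a)}"
proof (intro equalityI subsetI)
  fix x assume "x \<in> points (fibprod_atlas B)"
  then show "x \<in> {(a, u). a \<in> points (tot B) \<and> u \<in> tangent_space (bas B) (prj B a)}"
    using trivialisesD(1) pointsI by (fastforce simp: points_def fibprod_atlas_def)
next
  fix x assume "x \<in> {(a, u). a \<in> points (tot B) \<and> u \<in> tangent_space (bas B) (prj B a)}"
  then obtain a u where x: "x = (a, u)" "a \<in> points (tot B)" "u \<in> tangent_space (bas B) (prj B a)"
    by blast
  obtain c b where "trivialises B c b" "a \<in> fst c" using trivial_ex_at[OF x(2)] by metis
  then show "x \<in> points (fibprod_atlas B)"
    using x unfolding fibprod_atlas_def by (intro pointsI) auto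
qed

abbreviation fchart ::
  "('p, 'b \<times> 'f) chart \<Rightarrow> ('q, 'b) chart \<Rightarrow> ('p \<times> ('q, 'b) tvec, ('b \<times> 'f) \<times> 'b) chart" where
  "fchart c b \<equiv> ({(a, u). a \<in> fst c \<and> u \<in> tangent_space (bas B) (prj B a)},
    \<lambda>(a, u). (snd c a, snd u b))"

lemma of_coords_fchart:
  assumes b: "trivialises B c b" and z: "z \<in> snd c ` fst c"
  shows "of_coords (fchart c b) (z, w) =
    (of_coords c z, tvec_of (bas B) b (prj B (of_coords c z)) w)"
proof -
  note c = trivialisesD(1)[OF b]
  note p = of_coords_in[OF z]
  have inj: "inj_on (snd (fchart c b)) (fst (fchart c b))"
  proof (rule inj_onI)
    fix x x' assume x: "x \<in> fst (fchart c b)" "x' \<in> fst (fchart c b)"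
      and eq: "snd (fchart c b) x = snd (fchart c b) x'"
    obtain a u where xa: "x = (a, u)" by (cases x)
    obtain a' u' where xa': "x' = (a', u')" by (cases x')
    note xx = xa xa'
    have aa': "a \<in> fst c" "a' \<in> fst c" "snd c a = snd c a'" using x eq by (simp_all add: xx)
    have "a = a'"
      using of_coords_snd[OF atlas_tot c aa'(1)] of_coords_snd[OF atlas_tot c aa'(2)] aa'(3) by argo
    moreover have "u = u'"
      by (rule tangent_space_eqI[of u "bas B" "prj B a" u' b])
        (use x eq \<open>a = a'\<close> trivialisesD(4)[OF b, of a] in \<open>auto simp: xx\<close>)
    ultimately show "x = x'" by (simp add: xx)
  qed
  note b' = trivialisesD(4)[OF b p]
  have "(of_coords c z, tvec_of (bas B) b (prj B (of_coords c z)) w) \<in> fst (fchart c b)"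
    using p tvec_of_in[OF atlas_bas r1 b'] by simp
  from inv_into_f_f[OF inj this] show ?thesis
    using snd_of_coords[OF z] snd_tvec_of[OF atlas_bas b'] unfolding of_coords_def[of "fchart c b"]
    by simp
qed

text \<open>Reduces the properties shared by connections and solder forms to a coordinate expression
  \<open>V\<close> in the trivialising charts. Only smoothness takes work, because the target may be
  read in another chart \<open>d\<close>: there the vector is the differential of the transition
  applied to \<open>V\<close>, and that differential has regularity \<open>r\<close> since the atlas
  has regularity \<open>r + 1\<close>.\<close>

lemma fibre_affine_formI:
  fixes V :: "('p, 'b \<times> 'f) chart \<Rightarrow> 'b \<times> 'f \<Rightarrow> 'b \<Rightarrow> 'b \<times> 'f"
  assumes ext: "\<theta> \<in> extensional (points (fibprod_atlas B))"
    and V: "\<And>c b p u. trivialises B c b \<Longrightarrow> p \<in> fst c \<Longrightarrow> u \<in> tangent_space (bas B) (prj B p) \<Longrightarrow>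
      \<theta> (p, u) = tvec_of (tot B) c p (V c (snd c p) (snd u b))"
    and lin: "\<And>c z. c \<in> tot B \<Longrightarrow> z \<in> snd c ` fst c \<Longrightarrow> linear (V c z)"
    and cr: "\<And>c w. c \<in> tot B \<Longrightarrow> Cr_on r (\<lambda>z. V c z w) (snd c ` fst c)"
    and aff: "\<And>c x y w. c \<in> tot B \<Longrightarrow> (x, y) \<in> snd c ` fst c \<Longrightarrow> affine_fun (\<lambda>y. V c (x, y) w)"
  shows "fibre_affine_form r B \<theta>"
proof -
  have in_ts: "\<theta> (a, u) \<in> tangent_space (tot B) a"
    if a: "a \<in> points (tot B)" and u: "u \<in> tangent_space (bas B) (prj B a)" for a u
  proof -
    obtain c b where cb: "trivialises B c b" "a \<in> fst c" "c \<in> charts_at (tot B) a"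
      using trivial_ex_at[OF a] by metis
    show ?thesis unfolding V[OF cb(1,2) u] by (rule tvec_of_in[OF atlas_tot r1 cb(3)])
  qed
  have snd_\<theta>: "snd (\<theta> (p, u)) c = V c (snd c p) (snd u b)"
    if "trivialises B c b" "p \<in> fst c" "u \<in> tangent_space (bas B) (prj B p)" for c b p u
    unfolding V[OF that] using that trivialisesD(1)[OF that(1)]
    by (intro snd_tvec_of[OF atlas_tot]) (simp add: charts_at_iff)
  have "tlinear_on (tangent_space (bas B) (prj B a)) (\<lambda>u. \<theta> (a, u))" if a: "a \<in> points (tot B)" for a
  proof -
    obtain c b where cb: "trivialises B c b" "a \<in> fst c" "c \<in> charts_at (tot B) a"
      using trivial_ex_at[OF a] by metis
    have l: "linear (V c (snd c a))" using lin[OF trivialisesD(1)[OF cb(1)]] cb(2) by blast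
    show ?thesis
      unfolding tlinear_on_def
    proof (intro conjI ballI allI)
      fix u w assume u: "u \<in> tangent_space (bas B) (prj B a)" and w: "w \<in> tangent_space (bas B) (prj B a)"
      note uw = tadd_in[OF atlas_bas r1 u w]
      show "\<theta> (a, tadd u w) = tadd (\<theta> (a, u)) (\<theta> (a, w))"
        by (rule tangent_space_eqI[OF in_ts[OF a uw] tadd_in[OF atlas_tot r1 in_ts[OF a u] in_ts[OF a w]] cb(3)])
          (simp add: snd_\<theta>[OF cb(1,2) uw], simp add: tadd_def snd_\<theta>[OF cb(1,2)] u w linear_add[OF l])
    next
      fix t u assume u: "u \<in> tangent_space (bas B) (prj B a)"
      note tu = tscale_in[OF atlas_bas r1 u, of t]
      show "\<theta> (a, tscale t u) = tscale t (\<theta> (a, u))"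
        by (rule tangent_space_eqI[OF in_ts[OF a tu] tscale_in[OF atlas_tot r1 in_ts[OF a u]] cb(3)])
          (simp add: snd_\<theta>[OF cb(1,2) tu], simp add: tscale_def snd_\<theta>[OF cb(1,2)] u linear_scale[OF l])
    qed
  qed
  moreover have "affine_fun (\<lambda>y. snd (\<theta> (fibre_pt c a y, u)) c)"
    if c: "c \<in> tot B" and a: "a \<in> fst c" and u: "u \<in> tangent_space (bas B) (prj B a)" for c a u
  proof -
    obtain b where b: "trivialises B c b" using trivialises_ex[OF c] by blast
    have "(fst (snd c a), snd (snd c a)) \<in> snd c ` fst c" using a by simp
    from aff[OF c this, of "snd u b"] show ?thesis
      using snd_\<theta>[OF b fibre_pt(1)[OF c a]] fibre_pt(2,3)[OF c a] u by simp
  qed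
  moreover have "smooth_map r (fibprod_atlas B) (tangent_atlas (tot B)) \<theta>"
    unfolding smooth_map_def
  proof (intro conjI ballI)
    show "\<theta> \<in> points (fibprod_atlas B) \<rightarrow> points (tangent_atlas (tot B))"
    proof
      fix x assume "x \<in> points (fibprod_atlas B)"
      then obtain a u where x: "x = (a, u)" "a \<in> points (tot B)" "u \<in> tangent_space (bas B) (prj B a)"
        unfolding fibprod_points by blast
      show "\<theta> x \<in> points (tangent_atlas (tot B))"
        using in_ts[OF x(2,3)] tangent_spaceD(1)[OF in_ts[OF x(2,3)]]
        by (simp add: x(1) tangent_atlas_points tangent_iff)
    qed
  next
    fix C D assume "C \<in> fibprod_atlas B" "D \<in> tangent_atlas (tot B)"
    then obtain c b d where C: "C = fchart c b" "trivialises B c b" and D: "D = tchart (tot B) d" "d \<in> tot B"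
      by (auto simp: fibprod_atlas_def tangent_atlas_eq)
    note c = trivialisesD(1)[OF C(2)]
    let ?O = "snd c ` (fst c \<inter> fst d)"
    have O: "open ?O" using atlas_tot c D(2) by (simp add: smooth_atlas_def)
    have O_sub: "?O \<subseteq> snd c ` fst c" by auto
    have tr: "Cr_on (r + 1) (transition c d) ?O"
      using atlas_tot c D(2) by (simp add: smooth_atlas_def)
    have dom: "fst C \<inter> \<theta> -` fst D = {(a, u). a \<in> fst c \<inter> fst d \<and> u \<in> tangent_space (bas B) (prj B a)}"
    proof -
      have "\<theta> (a, u) \<in> tangent (tot B) \<and> fst (\<theta> (a, u)) = a"
        if "a \<in> fst c" "u \<in> tangent_space (bas B) (prj B a)" for a u
        using in_ts[OF pointsI[OF c that(1)] that(2)] tangent_spaceD(1) tangent_iff by metis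
      then show ?thesis by (auto simp: C(1) D(1))
    qed
    have img: "snd C ` (fst C \<inter> \<theta> -` fst D) = ?O \<times> UNIV"
    proof (intro equalityI subsetI)
      fix x assume "x \<in> snd C ` (fst C \<inter> \<theta> -` fst D)"
      then show "x \<in> ?O \<times> UNIV" unfolding dom by (auto simp: C(1))
    next
      fix x assume "x \<in> ?O \<times> (UNIV :: 'b set)"
      then obtain a w where x: "x = (snd c a, w)" "a \<in> fst c" "a \<in> fst d" by auto
      note b' = trivialisesD(4)[OF C(2) x(2)]
      have "(a, tvec_of (bas B) b (prj B a) w) \<in> fst C \<inter> \<theta> -` fst D"
        unfolding dom using x tvec_of_in[OF atlas_bas r1 b'] by simp
      moreover have "snd C (a, tvec_of (bas B) b (prj B a) w) = x"
        by (simp add: C(1) x snd_tvec_of[OF atlas_bas b'])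
      ultimately show "x \<in> snd C ` (fst C \<inter> \<theta> -` fst D)" by (metis image_eqI)
    qed
    show "open (snd C ` (fst C \<inter> \<theta> -` fst D))"
      unfolding img by (intro open_Times O open_UNIV)
    have OU: "open (?O \<times> (UNIV :: 'b set))" by (intro open_Times O open_UNIV)
    have Vcr: "Cr_on r (\<lambda>x. V c (fst x) (snd x)) (?O \<times> UNIV)"
    proof (rule Cr_on_linear_apply[OF OU, where H="\<lambda>x. V c (fst x)" and h=snd])
      show "linear (V c (fst x))" if "x \<in> ?O \<times> (UNIV :: 'b set)" for x
        using that O_sub by (intro lin[OF c]) auto
      show "Cr_on r (\<lambda>x. V c (fst x) v) (?O \<times> UNIV)" for v
        by (rule Cr_on_comp_fst[OF O Cr_on_subset[OF cr[OF c] O_sub]])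
    qed (intro Cr_on_snd Cr_on_ident OU)
    \<comment> \<open>This is \<theta> read from the chart of \<open>c\<close> and \<open>b\<close>
      on the fibre product to the tangent chart of \<open>d\<close>.\<close>
    have "Cr_on r (\<lambda>x. (transition c d (fst x),
        frechet_derivative (transition c d) (at (fst x)) (V c (fst x) (snd x)))) (?O \<times> UNIV)"
    proof (rule Cr_on_Pair[OF OU])
      show "Cr_on r (\<lambda>x. transition c d (fst x)) (?O \<times> (UNIV :: 'b set))"
        by (rule Cr_on_comp_fst[OF O Cr_on_mono[OF tr r_le]])
      show "Cr_on r (\<lambda>x. frechet_derivative (transition c d) (at (fst x)) (V c (fst x) (snd x)))
          (?O \<times> UNIV)"
      proof (rule Cr_on_linear_apply[OF OU, where H="\<lambda>x. frechet_derivative (transition c d) (at (fst x))"])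
        show "linear (frechet_derivative (transition c d) (at (fst x)))" if "x \<in> ?O \<times> (UNIV :: 'b set)" for x
          using that by (intro linear_frechet_derivative Cr_on_differentiable[OF tr r1]) auto
        show "Cr_on r (\<lambda>x. frechet_derivative (transition c d) (at (fst x)) v) (?O \<times> (UNIV :: 'b set))" for v
          by (rule Cr_on_comp_fst[OF O Cr_on_deriv[OF tr]])
      qed (rule Vcr)
    qed
    then show "Cr_on r (snd D \<circ> \<theta> \<circ> of_coords C) (snd C ` (fst C \<inter> \<theta> -` fst D))"
      unfolding img
    proof (rule Cr_on_cong[OF OU])
      fix x assume "x \<in> ?O \<times> (UNIV :: 'b set)"
      then obtain a w where x: "x = (snd c a, w)" "a \<in> fst c" "a \<in> fst d" by auto
      have ca: "c \<in> charts_at (tot B) a" "d \<in> charts_at (tot B) a"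
        using x c D(2) by (simp_all add: charts_at_iff)
      note b' = trivialisesD(4)[OF C(2) x(2)]
      have "of_coords C x = (a, tvec_of (bas B) b (prj B a) w)"
        unfolding C(1) x(1) using of_coords_fchart[OF C(2)] x(2) of_coords_snd[OF atlas_tot c x(2)] by simp
      moreover have "\<theta> (a, tvec_of (bas B) b (prj B a) w) = tvec_of (tot B) c a (V c (snd c a) w)"
        using V[OF C(2) x(2) tvec_of_in[OF atlas_bas r1 b']] by (simp add: snd_tvec_of[OF atlas_bas b'])
      ultimately show "(transition c d (fst x),
          frechet_derivative (transition c d) (at (fst x)) (V c (fst x) (snd x))) =
          (snd D \<circ> \<theta> \<circ> of_coords C) x"
        using ca of_coords_snd[OF atlas_tot c x(2)]
        by (simp add: D(1) x(1) tvec_of_def transition_def)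
    qed
  qed
  ultimately show ?thesis
    using ext in_ts unfolding fibre_affine_form_def by blast
qed

end

section \<open>Placements in trivialising coordinates\<close>

text \<open>On a vertical line through \<open>(x, y)\<close> the function is affine in the
  parameter, so its derivative is the slope, the same at every height. This is why the linear part
  of a shadow can be indexed by \<open>x\<close> alone.\<close>

lemma has_derivative_affine_along:
  fixes f :: "'a::euclidean_space \<times> 'f::euclidean_space \<Rightarrow> 'v::real_normed_vector"
  assumes f: "f differentiable at (x, y)" and aff: "affine_fun (\<lambda>y. f (x, y))"
  shows "frechet_derivative f (at (x, y)) (0, w) = f (x, w) - f (x, 0)"
proof -
  let ?D = "frechet_derivative f (at (x, y))"
  have D: "(f has_derivative ?D) (at (x, y))" using f frechet_derivative_works by blast
  have "((\<lambda>t::real. (x, y + t *\<^sub>R w)) has_derivative (\<lambda>t. (0, t *\<^sub>R w))) (at 0)"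
    by (auto intro!: derivative_eq_intros)
  then have "((\<lambda>t::real. f (x, y + t *\<^sub>R w)) has_derivative (\<lambda>t. ?D (0, t *\<^sub>R w))) (at 0)"
    by (rule has_derivative_compose) (use D in simp)
  moreover have "f (x, y + t *\<^sub>R w) = f (x, y) + t *\<^sub>R (f (x, w) - f (x, 0))" for t
    using affine_funD(1)[OF aff, of y "t *\<^sub>R w"] affine_funD(2)[OF aff, of t w] by simp
  then have "((\<lambda>t::real. f (x, y + t *\<^sub>R w)) has_derivative (\<lambda>t. t *\<^sub>R (f (x, w) - f (x, 0)))) (at 0)"
    by (simp, auto intro!: derivative_eq_intros)
  ultimately have "(\<lambda>t. ?D (0, t *\<^sub>R w)) = (\<lambda>t. t *\<^sub>R (f (x, w) - f (x, 0)))"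
    by (rule has_derivative_unique)
  from fun_cong[OF this, of 1] show ?thesis by simp
qed

text \<open>The affinity identities hold at every nearby \<open>x\<close>, so they may be
  differentiated in \<open>x\<close> as well. Translating vertically by \<open>y\<close> moves all
  the derivatives involved to the common point \<open>(x, 0)\<close>, where uniqueness of the
  derivative turns the identities for \<open>f\<close> into those for its differential.\<close>

lemma affine_fun_frechet_derivative:
  fixes f :: "'a::euclidean_space \<times> 'f::euclidean_space \<Rightarrow> 'v::real_normed_vector"
  assumes S: "open S" "\<And>x y y'. (x, y) \<in> S \<Longrightarrow> (x, y') \<in> S"
    and f: "\<And>z. z \<in> S \<Longrightarrow> f differentiable at z"
    and aff: "\<And>x y. (x, y) \<in> S \<Longrightarrow> affine_fun (\<lambda>y. f (x, y))"
    and x: "(x, y0) \<in> S"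
  shows "affine_fun (\<lambda>y. frechet_derivative f (at (x, y)) w)"
proof -
  have x0: "(x, 0) \<in> S" using S(2)[OF x] .
  have shift: "((\<lambda>z. f (z + (0, y))) has_derivative frechet_derivative f (at (x, y))) (at (x, 0))" for y
  proof -
    have "((\<lambda>z. z + (0, y)) has_derivative (\<lambda>w. w)) (at (x, 0))"
      by (auto intro!: derivative_eq_intros)
    moreover have "(f has_derivative frechet_derivative f (at (x, y))) (at ((x, 0) + (0, y)))"
      using iffD1[OF frechet_derivative_works f[OF S(2)[OF x]]] by simp
    ultimately show ?thesis by (rule has_derivative_compose)
  qed
  have aff': "affine_fun (\<lambda>y. f (fst z, y))" if "z \<in> S" for z
    using aff[of "fst z" "snd z"] that by simp
  show ?thesis
  proof (rule affine_funI)
    fix y y'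
    let ?g = "\<lambda>z. f (z + (0, y)) + f (z + (0, y')) - f (z + (0, 0))"
    have 1: "(?g has_derivative (\<lambda>w. frechet_derivative f (at (x, y)) w +
        frechet_derivative f (at (x, y')) w - frechet_derivative f (at (x, 0)) w)) (at (x, 0))"
      by (intro has_derivative_diff has_derivative_add shift)
    have 2: "(?g has_derivative frechet_derivative f (at (x, y + y'))) (at (x, 0))"
    proof (rule has_derivative_transform_within_open[OF shift S(1) x0])
      fix z assume "z \<in> S"
      note a = affine_funD(1)[OF aff'[OF this]]
      show "f (z + (0, y + y')) = ?g z"
        using a[of "snd z + y" y'] a[of "snd z" y'] by (cases z) (simp add: add.assoc)
    qed
    show "frechet_derivative f (at (x, y + y')) w = frechet_derivative f (at (x, y)) w +
        frechet_derivative f (at (x, y')) w - frechet_derivative f (at (x, 0)) w"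
      by (rule fun_cong[OF has_derivative_unique[OF 2 1]])
  next
    fix t :: real and y
    let ?g = "\<lambda>z. f (z + (0, 0)) + t *\<^sub>R (f (z + (0, y)) - f (z + (0, 0)))"
    have 1: "(?g has_derivative (\<lambda>w. frechet_derivative f (at (x, 0)) w +
        t *\<^sub>R (frechet_derivative f (at (x, y)) w - frechet_derivative f (at (x, 0)) w))) (at (x, 0))"
      by (intro has_derivative_diff has_derivative_add has_derivative_scaleR_right shift)
    have 2: "(?g has_derivative frechet_derivative f (at (x, t *\<^sub>R y))) (at (x, 0))"
    proof (rule has_derivative_transform_within_open[OF shift S(1) x0])
      fix z assume "z \<in> S"
      note a = affine_funD[OF aff'[OF this]]
      show "f (z + (0, t *\<^sub>R y)) = ?g z"
        using a(1)[of "snd z" "t *\<^sub>R y"] a(1)[of "snd z" y] a(2)[of t y] by (cases z) simp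
    qed
    show "frechet_derivative f (at (x, t *\<^sub>R y)) w = frechet_derivative f (at (x, 0)) w +
        t *\<^sub>R (frechet_derivative f (at (x, y)) w - frechet_derivative f (at (x, 0)) w)"
      by (rule fun_cong[OF has_derivative_unique[OF 2 1]])
  qed
qed

lemma tprj_Eamb: "tprj Eamb (evec a w) = evec (fst a) (fst w)"
proof -
  have "frechet_derivative fst (at a) = fst"
    using frechet_derivative_at[OF bounded_linear_imp_has_derivative[OF bounded_linear_fst]] by metis
  then show ?thesis
    using tmap_std_std[OF Cr_on_linear[OF open_UNIV bounded_linear_fst], of 1 a w]
    by (simp add: tprj_def)
qed

lemma fibprod_points_Eamb:
  "(a, u) \<in> points (fibprod_atlas Eamb) \<longleftrightarrow> u \<in> tangent_space {std} (fst a)"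
proof -
  have "trivialises Eamb c b \<longleftrightarrow> c = std \<and> b = std" for c b
    by (auto simp: trivialises_def)
  then show ?thesis by (auto simp: points_def fibprod_atlas_def)
qed

lemma theta_E_evec: "theta_E (a, evec (fst a) k) = evec a (0, k)"
  by (simp add: theta_E_def fibprod_points_Eamb)

lemma gamma_E_evec: "gamma_E (a, evec (fst a) k) = evec a (k, 0)"
  by (simp add: gamma_E_def fibprod_points_Eamb)

locale affine_placement = smooth_affine_bundle r B
  for r :: enat and B :: "('p, real^3, 'q, 'b::euclidean_space) affbundle" +
  fixes \<phi> :: "'p \<Rightarrow> R3 \<times> R3"
  assumes phi_Aff: "\<phi> \<in> Aff (r + 1) B Eamb"
begin

lemma phi_smooth: "smooth_map (r + 1) (tot B) {std} \<phi>"
  using phi_Aff by (simp add: Aff_def)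

lemma phi_chart_Cr: "c \<in> tot B \<Longrightarrow> Cr_on (r + 1) (\<phi> \<circ> of_coords c) (snd c ` fst c)"
  using phi_smooth by (simp add: smooth_map_std)

text \<open>The point of the fibre chosen inside \<open>base_map\<close> does not matter, because
  the first component of \<phi> factors through the projection.\<close>

lemma base_map_prj:
  assumes "p \<in> points (tot B)"
  shows "base_map B Eamb \<phi> (prj B p) = fst (\<phi> p)"
proof -
  obtain lb where lb: "\<And>p. p \<in> points (tot B) \<Longrightarrow> fst (\<phi> p) = lb (prj B p)"
    using phi_Aff by (auto simp: Aff_def)
  define p' where "p' = (SOME p'. p' \<in> points (tot B) \<and> prj B p' = prj B p)"
  have "p' \<in> points (tot B) \<and> prj B p' = prj B p"
    unfolding p'_def by (rule someI[of _ p]) (use assms in simp)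
  then have "fst (\<phi> p') = fst (\<phi> p)" using lb assms by metis
  moreover have "prj B p \<in> points (bas B)" using assms prj_points by blast
  ultimately show ?thesis by (simp add: base_map_def p'_def)
qed

lemma base_map_smooth: "smooth_map (r + 1) (bas B) {std} (base_map B Eamb \<phi>)"
proof -
  obtain lb where lb: "\<And>p. p \<in> points (tot B) \<Longrightarrow> fst (\<phi> p) = lb (prj B p)"
    and s: "smooth_map (r + 1) (bas B) {std} lb"
    using phi_Aff by (auto simp: Aff_def)
  show ?thesis
  proof (rule smooth_map_cong[OF atlas_bas s])
    fix x assume "x \<in> points (bas B)"
    then obtain p where "p \<in> points (tot B)" "x = prj B p" using prj_points by blast
    then show "lb x = base_map B Eamb \<phi> x" using lb base_map_prj by metis
  qed
qed

lemma fst_phi_fibre_pt: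
  assumes c: "c \<in> tot B" and p: "p \<in> fst c"
  shows "fst (\<phi> (fibre_pt c p y)) = fst (\<phi> p)"
  using base_map_prj[OF pointsI[OF c p]] base_map_prj[OF pointsI[OF c fibre_pt(1)[OF c p, of y]]]
    fibre_pt(3)[OF c p, of y] by metis

text \<open>Membership in \<open>Aff\<close> provides affinity of the fibre component; the base
  component is constant along the fibre.\<close>

lemma phi_chart_affine:
  assumes c: "c \<in> tot B" and z: "(x, y) \<in> snd c ` fst c"
  shows "affine_fun (\<lambda>y. (\<phi> \<circ> of_coords c) (x, y))"
proof -
  let ?p = "of_coords c (x, y)"
  note p = of_coords_in[OF z]
  have pt: "fibre_pt c ?p y' = of_coords c (x, y')" for y'
    using snd_of_coords[OF z] by (simp add: fibre_pt_def)
  have "fst (\<phi> (of_coords c (x, y'))) = fst (\<phi> ?p)" for y'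
    using fst_phi_fibre_pt[OF c p, of y'] by (simp add: pt)
  moreover have "affine_fun (\<lambda>y'. snd (\<phi> (fibre_pt c ?p y')))"
    using phi_Aff c p by (simp add: Aff_def)
  ultimately have "affine_fun (\<lambda>y'. (fst (\<phi> ?p), snd (\<phi> (of_coords c (x, y')))))"
    by (intro affine_fun_Pair affine_fun_const) (simp add: pt)
  moreover have "(fst (\<phi> ?p), snd (\<phi> (of_coords c (x, y')))) = (\<phi> \<circ> of_coords c) (x, y')" for y'
    using \<open>fst (\<phi> (of_coords c (x, y'))) = fst (\<phi> ?p)\<close> by (simp add: prod_eq_iff)
  ultimately show ?thesis by simp
qed

lemma phi_chart_differentiable:
  "c \<in> tot B \<Longrightarrow> z \<in> snd c ` fst c \<Longrightarrow> (\<phi> \<circ> of_coords c) differentiable at z"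
  using Cr_on_differentiable[OF phi_chart_Cr r1] by blast

text \<open>The linear part of \<open>\<phi>\<close> on the fibre over the point with coordinates \<open>x\<close>.\<close>

definition microA :: "('p, 'b \<times> R3) chart \<Rightarrow> 'b \<Rightarrow> real^3 \<Rightarrow> real^3" where
  "microA c x w = snd (\<phi> (of_coords c (x, w))) - snd (\<phi> (of_coords c (x, 0)))"

lemma deriv_phi_vertical:
  assumes c: "c \<in> tot B" and z: "z \<in> snd c ` fst c"
  shows "frechet_derivative (\<phi> \<circ> of_coords c) (at z) (0, w) = (0, microA c (fst z) w)"
proof -
  obtain x y where xy: "z = (x, y)" by (cases z)
  have z': "(x, y) \<in> snd c ` fst c" using z xy by simp
  have "fst (\<phi> (of_coords c (x, w))) = fst (\<phi> (of_coords c (x, 0)))"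
  proof -
    let ?p = "of_coords c (x, y)"
    note p = of_coords_in[OF z']
    show ?thesis
      using fst_phi_fibre_pt[OF c p, of w] fst_phi_fibre_pt[OF c p, of 0] snd_of_coords[OF z']
      by (simp add: fibre_pt_def)
  qed
  then show ?thesis
    using has_derivative_affine_along[of "\<phi> \<circ> of_coords c" x y w,
        OF phi_chart_differentiable[OF c z'] phi_chart_affine[OF c z']]
    by (simp add: xy microA_def prod_eq_iff)
qed

lemma tmap_phi:
  "c \<in> charts_at (tot B) p \<Longrightarrow> u \<in> tangent_space (tot B) p \<Longrightarrow>
    tmap (tot B) {std} \<phi> u =
      evec (\<phi> p) (frechet_derivative (\<phi> \<circ> of_coords c) (at (snd c p)) (snd u c))"
  by (rule tmap_std[OF atlas_tot phi_smooth r1])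

text \<open>The two sides are the chain rule for the two factorisations of one map: \<phi> followed
  by \<open>fst\<close>, and the projection followed by the base map.\<close>

lemma tprj_tmap_phi:
  assumes "u \<in> tangent (tot B)"
  shows "tprj Eamb (tmap (tot B) {std} \<phi> u) = tmap (bas B) {std} (base_map B Eamb \<phi>) (tprj B u)"
proof -
  have u: "u \<in> tangent_space (tot B) (fst u)" using assms by (simp add: tangent_iff)
  have fst_smooth: "smooth_map (r + 1) {std} {std} (fst :: R3 \<times> R3 \<Rightarrow> R3)"
    by (simp add: smooth_map_std_std Cr_on_linear bounded_linear_fst)
  have f: "smooth_map (r + 1) (tot B) {std} (\<lambda>p. fst (\<phi> p))"
    unfolding smooth_map_std
  proof (intro ballI conjI)
    fix c assume c: "c \<in> tot B"
    show O: "open (snd c ` fst c)" by (rule open_chart_image[OF atlas_tot c])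
    show "Cr_on (r + 1) ((\<lambda>p. fst (\<phi> p)) \<circ> of_coords c) (snd c ` fst c)"
      using Cr_on_fst[OF O phi_chart_Cr[OF c]] by (simp add: comp_def)
  qed
  have eq: "fst (\<phi> p) = base_map B Eamb \<phi> (prj B p)" if "p \<in> points (tot B)" for p
    using base_map_prj[OF that] by simp
  have g: "smooth_map (r + 1) (tot B) {std} (\<lambda>p. base_map B Eamb \<phi> (prj B p))"
    by (rule smooth_map_cong[OF atlas_tot f eq])
  have "tprj Eamb (tmap (tot B) {std} \<phi> u) = tmap (tot B) {std} (\<lambda>p. fst (\<phi> p)) u"
    using tmap_comp[OF atlas_tot smooth_atlas_std phi_smooth fst_smooth f r1 u] by (simp add: tprj_def)
  also have "\<dots> = tmap (tot B) {std} (\<lambda>p. base_map B Eamb \<phi> (prj B p)) u"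
    using tmap_cong[OF atlas_tot f r1 eq] by simp
  also have "\<dots> = tmap (bas B) {std} (base_map B Eamb \<phi>) (tprj B u)"
    unfolding tprj_def by (rule tmap_comp[OF atlas_tot atlas_bas prj_smooth base_map_smooth g r1 u])
  finally show ?thesis .
qed

lemma shadow_tmap_phi: "shadow B (tmap (tot B) {std} \<phi>) = \<phi>"
proof (rule extensionalityI[of _ "points (tot B)"])
  show "\<phi> \<in> extensional (points (tot B))" using phi_Aff by (simp add: Aff_def)
  show "shadow B (tmap (tot B) {std} \<phi>) p = \<phi> p" if "p \<in> points (tot B)" for p
    using that fst_tmap[of "tzero p" "tot B"] tzero_in[OF atlas_tot r1 that]
    by (simp add: shadow_def tangent_iff tzero_def)
qed (simp add: shadow_def)

end

text \<open>
  Satisfied both by a conformation \<open>F\<close> and by the tangent map of its shadow, so that the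
  pull-backs by \<open>F\<close> and by \<open>T\<phi>\<close> are treated at once.
\<close>

locale placement = smooth_affine_bundle r B
  for r :: enat and B :: "('p, real^3, 'q, 'b::euclidean_space) affbundle" +
  fixes L :: "('p, 'b \<times> R3) tvec \<Rightarrow> TE"
  assumes shadow_Aff: "shadow B L \<in> Aff (r + 1) B Eamb"
    and L_in: "\<And>p u. u \<in> tangent_space (tot B) p \<Longrightarrow> L u \<in> tangent_space {std} (shadow B L p)"
    and L_lin: "\<And>p. p \<in> points (tot B) \<Longrightarrow> tlinear_on (tangent_space (tot B) p) L"
    and L_inj: "\<And>p. p \<in> points (tot B) \<Longrightarrow> inj_on L (tangent_space (tot B) p)"
    and L_smooth: "\<And>c w. c \<in> tot B \<Longrightarrow>
      Cr_on r (\<lambda>z. snd (L (tvec_of (tot B) c (of_coords c z) w)) std) (snd c ` fst c)"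
    and L_prj: "\<And>u. u \<in> tangent (tot B) \<Longrightarrow> tprj Eamb (L u) = bar B Eamb L (tprj B u)"
    and L_vert: "\<And>p u. p \<in> points (tot B) \<Longrightarrow> u \<in> vertical B p \<Longrightarrow>
      L u = tmap (tot B) {std} (shadow B L) u"
    and L_affine: "\<And>c p w. c \<in> tot B \<Longrightarrow> p \<in> fst c \<Longrightarrow>
      affine_fun (\<lambda>y. snd (L (tvec_of (tot B) c (fibre_pt c p y) w)) std)"
begin

sublocale affine_placement r B "shadow B L"
  by unfold_locales (rule shadow_Aff)

text \<open>For a conformation this is the block form of the overview:
  \<open>Lc c z (dx, dy)\<close> stands for \<open>(dp dx, G dx + A dy)\<close>.\<close>

definition Lc :: "('p, 'b \<times> R3) chart \<Rightarrow> 'b \<times> R3 \<Rightarrow> 'b \<times> R3 \<Rightarrow> R3 \<times> R3" where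
  "Lc c z w = snd (L (tvec_of (tot B) c (of_coords c z) w)) std"

lemma L_eq:
  assumes "c \<in> charts_at (tot B) p" "u \<in> tangent_space (tot B) p"
  shows "L u = evec (shadow B L p) (Lc c (snd c p) (snd u c))"
proof -
  have "of_coords c (snd c p) = p" using assms of_coords_snd[OF atlas_tot] by (simp add: charts_at_iff)
  then show ?thesis using evec_snd[OF L_in[OF assms(2)]] tvec_of_snd[OF assms(2,1)] by (simp add: Lc_def)
qed

lemma L_tvec_of:
  assumes "c \<in> charts_at (tot B) p"
  shows "L (tvec_of (tot B) c p w) = evec (shadow B L p) (Lc c (snd c p) w)"
  using L_eq[OF assms tvec_of_in[OF atlas_tot r1 assms]] by (simp add: snd_tvec_of[OF atlas_tot assms])

lemma
  assumes c: "c \<in> tot B" and z: "z \<in> snd c ` fst c"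
  shows Lc_linear: "linear (Lc c z)" and Lc_inj: "inj (Lc c z)"
proof -
  let ?p = "of_coords c z"
  have cp: "c \<in> charts_at (tot B) ?p" using c of_coords_in[OF z] by (simp add: charts_at_iff)
  then have p: "?p \<in> points (tot B)" unfolding points_iff by blast
  have t: "tvec_of (tot B) c ?p w \<in> tangent_space (tot B) ?p" for w by (rule tvec_of_in[OF atlas_tot r1 cp])
  note s = snd_tvec_of[OF atlas_tot cp]
  have add: "tvec_of (tot B) c ?p (w + w') = tadd (tvec_of (tot B) c ?p w) (tvec_of (tot B) c ?p w')" for w w'
    by (rule tangent_space_eqI[OF t tadd_in[OF atlas_tot r1 t t] cp]) (simp add: s, simp add: tadd_def s)
  have scale: "tvec_of (tot B) c ?p (k *\<^sub>R w) = tscale k (tvec_of (tot B) c ?p w)" for w k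
    by (rule tangent_space_eqI[OF t tscale_in[OF atlas_tot r1 t] cp]) (simp add: s, simp add: tscale_def s)
  show "linear (Lc c z)"
    using L_lin[OF p] t unfolding tlinear_on_def Lc_def
    by (intro linearI) (simp_all add: add scale, simp_all add: tadd_def tscale_def)
  show "inj (Lc c z)"
  proof (rule injI)
    fix w w' assume "Lc c z w = Lc c z w'"
    then have "L (tvec_of (tot B) c ?p w) = L (tvec_of (tot B) c ?p w')"
      using L_tvec_of[OF cp] snd_of_coords[OF z] by simp
    then have "tvec_of (tot B) c ?p w = tvec_of (tot B) c ?p w'"
      by (rule inj_onD[OF L_inj[OF p] _ t t])
    then show "w = w'" using s by metis
  qed
qed

lemma Lc_Cr: "c \<in> tot B \<Longrightarrow> Cr_on r (\<lambda>z. Lc c z w) (snd c ` fst c)"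
  unfolding Lc_def by (rule L_smooth)

lemma Lc_affine:
  assumes c: "c \<in> tot B" and z: "(x, y) \<in> snd c ` fst c"
  shows "affine_fun (\<lambda>y. Lc c (x, y) w)"
  using L_affine[OF c of_coords_in[OF z], of w] snd_of_coords[OF z]
  by (simp add: Lc_def fibre_pt_def)

text \<open>The base map is read off from any lift of \<open>u\<close>. The vertical part
  \<open>dy\<close> of the lift is free because \<open>L\<close> respects the projections.\<close>

lemma bar_evec:
  assumes b: "trivialises B c b" and p: "p \<in> fst c" and u: "u \<in> tangent_space (bas B) (prj B p)"
  shows "bar B Eamb L u = evec (fst (shadow B L p)) (fst (Lc c (snd c p) (snd u b, dy)))"
proof -
  have cp: "c \<in> charts_at (tot B) p" using trivialisesD(1)[OF b] p by (simp add: charts_at_iff)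
  let ?v = "tvec_of (tot B) c p (snd u b, dy)"
  have v: "?v \<in> tangent_space (tot B) p" by (rule tvec_of_in[OF atlas_tot r1 cp])
  have "tprj B ?v = u"
    using tprj_tvec_of[OF b p] tvec_of_snd[OF u trivialisesD(4)[OF b p]] by simp
  moreover have "?v \<in> tangent (tot B)" using v by (simp add: tangent_iff)
  ultimately show ?thesis using L_prj[of ?v] L_tvec_of[OF cp] tprj_Eamb by simp
qed

text \<open>On vertical vectors \<open>L\<close> is the tangent map of its shadow, so this block is
  determined by the shadow alone.\<close>

lemma Lc_vertical:
  assumes c: "c \<in> tot B" and z: "z \<in> snd c ` fst c"
  shows "Lc c z (0, w) = (0, microA c (fst z) w)"
proof -
  let ?p = "of_coords c z" and ?v = "tvec_of (tot B) c (of_coords c z) (0, w)"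
  note p = of_coords_in[OF z]
  have cp: "c \<in> charts_at (tot B) ?p" using c p by (simp add: charts_at_iff)
  obtain b where b: "trivialises B c b" using trivialises_ex[OF c] .
  have t: "?v \<in> tangent_space (tot B) ?p" by (rule tvec_of_in[OF atlas_tot r1 cp])
  then have "?v \<in> vertical B ?p"
    using vertical_iff[OF b p] by (simp add: snd_tvec_of[OF atlas_tot cp])
  from L_vert[OF pointsI[OF c p] this] show ?thesis
    using tmap_phi[OF cp t] deriv_phi_vertical[OF c z, of w] snd_of_coords[OF z]
    by (simp add: Lc_def snd_tvec_of[OF atlas_tot cp])
qed

lemma Lc_split:
  assumes c: "c \<in> tot B" and z: "z \<in> snd c ` fst c"
  shows "Lc c z (dx, dy) = Lc c z (dx, 0) + (0, microA c (fst z) dy)"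
  using linear_add[OF Lc_linear[OF c z], of "(dx, 0)" "(0, dy)"] Lc_vertical[OF c z] by simp

text \<open>Injectivity of \<open>L\<close> on a tangent space restricts to vertical vectors.
  Material and ambient fibres both have dimension 3, so injective already means bijective.\<close>

lemma
  assumes c: "c \<in> tot B" and z: "z \<in> snd c ` fst c"
  shows microA_linear: "linear (microA c (fst z))" and microA_inj: "inj (microA c (fst z))"
    and microA_surj: "surj (microA c (fst z))"
proof -
  have eq: "microA c (fst z) w = snd (Lc c z (0, w))" for w using Lc_vertical[OF c z] by simp
  note lin = Lc_linear[OF c z]
  show l: "linear (microA c (fst z))"
  proof (rule linearI)
    show "microA c (fst z) (w + w') = microA c (fst z) w + microA c (fst z) w'" for w w'
      using linear_add[OF lin, of "(0, w)" "(0, w')"] by (simp add: eq)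
    show "microA c (fst z) (k *\<^sub>R w) = k *\<^sub>R microA c (fst z) w" for w k
      using linear_scale[OF lin, of k "(0, w)"] by (simp add: eq)
  qed
  show i: "inj (microA c (fst z))"
  proof (rule injI)
    fix w w' assume "microA c (fst z) w = microA c (fst z) w'"
    then have "Lc c z (0, w) = Lc c z (0, w')" using Lc_vertical[OF c z] by simp
    then show "w = w'" using injD[OF Lc_inj[OF c z]] by blast
  qed
  show "surj (microA c (fst z))" using linear_injective_imp_surjective[OF l i] by blast
qed

abbreviation invA :: "('p, 'b \<times> R3) chart \<Rightarrow> 'b \<Rightarrow> real^3 \<Rightarrow> real^3" where
  "invA c x \<equiv> inv_into UNIV (microA c x)"

lemma microA_invA:
  "c \<in> tot B \<Longrightarrow> z \<in> snd c ` fst c \<Longrightarrow> microA c (fst z) (invA c (fst z) w) = w"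
  using microA_surj by (simp add: surj_f_inv_f)

lemma invA_linear: "c \<in> tot B \<Longrightarrow> z \<in> snd c ` fst c \<Longrightarrow> linear (invA c (fst z))"
  using microA_linear microA_inj microA_surj by (simp add: bij_betw_def inj_linear_imp_inv_linear)

lemma microA_Cr:
  assumes c: "c \<in> tot B"
  shows "Cr_on r (\<lambda>z. microA c (fst z) w) (snd c ` fst c)"
proof (rule Cr_on_cong)
  show O: "open (snd c ` fst c)" by (rule open_chart_image[OF atlas_tot c])
  show "Cr_on r (\<lambda>z. snd (Lc c z (0, w))) (snd c ` fst c)" by (rule Cr_on_snd[OF O Lc_Cr[OF c]])
qed (use Lc_vertical[OF c] in simp)

lemma invA_Cr:
  assumes c: "c \<in> tot B" and h: "Cr_on r h (snd c ` fst c)"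
  shows "Cr_on r (\<lambda>z. invA c (fst z) (h z)) (snd c ` fst c)"
  by (rule Cr_on_linear_inverse[OF open_chart_image[OF atlas_tot c], where H="\<lambda>z. microA c (fst z)"])
    (use microA_linear[OF c] microA_inj[OF c] microA_Cr[OF c] h in auto)

text \<open>\<open>L\<close> need not be onto, so a preimage exists only when the base component of
  \<open>k\<close> is attained, here by \<open>dx\<close>. The block triangular form then leaves an
  equation in the fibre, which \<open>invA\<close> solves.\<close>

lemma inv_L:
  assumes b: "trivialises B c b" and p: "p \<in> fst c" and k: "fst k = fst (Lc c (snd c p) (dx, 0))"
  shows "inv_into (tangent_space (tot B) p) L (evec (shadow B L p) k) =
    tvec_of (tot B) c p (dx, invA c (fst (snd c p)) (snd k - snd (Lc c (snd c p) (dx, 0))))"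
proof -
  note c = trivialisesD(1)[OF b]
  have z: "snd c p \<in> snd c ` fst c" using p by simp
  have cp: "c \<in> charts_at (tot B) p" using c p by (simp add: charts_at_iff)
  let ?v = "tvec_of (tot B) c p (dx, invA c (fst (snd c p)) (snd k - snd (Lc c (snd c p) (dx, 0))))"
  have "Lc c (snd c p) (dx, invA c (fst (snd c p)) (snd k - snd (Lc c (snd c p) (dx, 0)))) = k"
    using k by (subst Lc_split[OF c z]) (simp add: microA_invA[OF c z] prod_eq_iff)
  then have "L ?v = evec (shadow B L p) k" by (simp add: L_tvec_of[OF cp])
  then show ?thesis
    using inv_into_f_f[OF L_inj[OF pointsI[OF c p]] tvec_of_in[OF atlas_tot r1 cp]] by metis
qed

text \<open>In the notation of the overview these are \<open>A\<^sup>-\<^sup>1 dp\<close> and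
  \<open>- A\<^sup>-\<^sup>1 G\<close>. The ambient vectors to invert are \<open>(0, dp u)\<close>
  and \<open>(dp u, 0)\<close>, hence the horizontal parts 0 and \<open>snd u b\<close>.\<close>

lemma
  assumes b: "trivialises B c b" and p: "p \<in> fst c" and u: "u \<in> tangent_space (bas B) (prj B p)"
  shows pull_theta: "pull_form B Eamb L theta_E (p, u) =
      tvec_of (tot B) c p (0, invA c (fst (snd c p)) (fst (Lc c (snd c p) (snd u b, 0))))" (is ?th)
    and pull_gamma: "pull_form B Eamb L gamma_E (p, u) =
      tvec_of (tot B) c p (snd u b, - invA c (fst (snd c p)) (snd (Lc c (snd c p) (snd u b, 0))))" (is ?ga)
proof -
  note c = trivialisesD(1)[OF b]
  have z: "snd c p \<in> snd c ` fst c" using p by simp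
  have pu: "(p, u) \<in> points (fibprod_atlas B)" using pointsI[OF c p] u by (simp add: fibprod_points)
  have L0: "Lc c (snd c p) (0, 0) = 0"
    using linear_0[OF Lc_linear[OF c z]] by (simp add: zero_prod_def)
  show ?th
    using pu inv_L[OF b p, of "(0, fst (Lc c (snd c p) (snd u b, 0)))" 0]
    by (simp add: pull_form_def bar_evec[OF b p u, of 0] theta_E_evec L0)
  show ?ga
    using pu inv_L[OF b p, of "(fst (Lc c (snd c p) (snd u b, 0)), 0)" "snd u b"]
      linear_neg[OF invA_linear[OF c z]]
    by (simp add: pull_form_def bar_evec[OF b p u, of 0] gamma_E_evec)
qed

end

section \<open>The pulled-back structures\<close>

lemma evec_zero: "evec a 0 = tzero a"
  by (rule tvec_std_eqI[of _ a]) (simp_all add: tzero_in[OF smooth_atlas_std[of 1]], simp add: tzero_def)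

lemma vertical_Eamb: "evec a (0, k) \<in> vertical Eamb a"
  by (simp add: vertical_def tprj_Eamb evec_zero)

lemma g_vv_evec: "g_vv (evec a (0, k), evec a (0, k')) = k \<bullet> k'"
proof -
  have "(evec a (0, k), evec a (0, k')) \<in> vertical_pairs Eamb"
    unfolding vertical_pairs_def tot_Eamb points_std using vertical_Eamb by blast
  then show ?thesis by (simp add: g_vv_def pseudo_metric_def g_eucl_def iota_evec)
qed

context placement
begin

lemma pull_theta_Sold: "pull_form B Eamb L theta_E \<in> Sold r B"
proof -
  let ?V = "\<lambda>c z w. (0 :: 'b, invA c (fst z) (fst (Lc c z (w, 0))))"
  let ?\<theta> = "pull_form B Eamb L theta_E"
  have "fibre_affine_form r B ?\<theta>"
  proof (rule fibre_affine_formI[where V="?V"])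
    show "?\<theta> \<in> extensional (points (fibprod_atlas B))" by (simp add: pull_form_def)
    show "?\<theta> (p, u) = tvec_of (tot B) c p (?V c (snd c p) (snd u b))"
      if "trivialises B c b" "p \<in> fst c" "u \<in> tangent_space (bas B) (prj B p)" for c b p u
      by (rule pull_theta[OF that])
    show "linear (?V c z)" if "c \<in> tot B" "z \<in> snd c ` fst c" for c z
    proof -
      note l = Lc_linear[OF that] and i = invA_linear[OF that]
      have "Lc c z (w + w', 0) = Lc c z (w, 0) + Lc c z (w', 0)" for w w'
        using linear_add[OF l, of "(w, 0)" "(w', 0)"] by simp
      moreover have "Lc c z (k *\<^sub>R w, 0) = k *\<^sub>R Lc c z (w, 0)" for k w
        using linear_scale[OF l, of k "(w, 0)"] by simp
      ultimately show ?thesis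
        by (intro linearI) (simp_all add: linear_add[OF i] linear_scale[OF i])
    qed
    show "Cr_on r (\<lambda>z. ?V c z w) (snd c ` fst c)" if c: "c \<in> tot B" for c w
      using open_chart_image[OF atlas_tot c] invA_Cr[OF c] Lc_Cr[OF c]
      by (intro Cr_on_Pair Cr_on_const invA_Cr[OF c] Cr_on_fst)
    show "affine_fun (\<lambda>y. ?V c (x, y) w)" if c: "c \<in> tot B" and z: "(x, y) \<in> snd c ` fst c" for c x y w
    proof -
      have i: "linear (invA c x)" using invA_linear[OF c z] by simp
      have "linear (\<lambda>k :: R3 \<times> R3. (0 :: 'b, invA c x (fst k)))"
        by (intro linearI) (simp_all add: linear_add[OF i] linear_scale[OF i])
      from affine_fun_linear_comp[OF Lc_affine[OF c z, of "(w, 0)"] this] show ?thesis by simp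
    qed
  qed
  moreover have "inj_on ?\<theta> (points (fibprod_atlas B))"
  proof (rule inj_onI)
    fix x x' assume x: "x \<in> points (fibprod_atlas B)" and x': "x' \<in> points (fibprod_atlas B)"
      and eq: "?\<theta> x = ?\<theta> x'"
    obtain p u where pu: "x = (p, u)" "p \<in> points (tot B)" "u \<in> tangent_space (bas B) (prj B p)"
      using x unfolding fibprod_points by blast
    obtain p' u' where pu': "x' = (p', u')" "p' \<in> points (tot B)" "u' \<in> tangent_space (bas B) (prj B p')"
      using x' unfolding fibprod_points by blast
    obtain c b where b: "trivialises B c b" "p \<in> fst c" and cp: "c \<in> charts_at (tot B) p"
      and b': "b \<in> charts_at (bas B) (prj B p)"
      using trivial_ex_at[OF pu(2)] .
    obtain c' b' where b2: "trivialises B c' b'" "p' \<in> fst c'"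
      using trivial_ex_at[OF pu'(2)] .
    have "fst (?\<theta> (p, u)) = fst (?\<theta> (p', u'))" using eq pu(1) pu'(1) by simp
    then have pp': "p' = p" by (simp add: pull_theta[OF b pu(3)] pull_theta[OF b2 pu'(3)])
    note c = trivialisesD(1)[OF b(1)]
    have z: "snd c p \<in> snd c ` fst c" using b(2) by simp
    note u' = pu'(3)[unfolded pp']
    let ?z = "snd c p"
    have "snd (?\<theta> (p, u)) c = snd (?\<theta> (p, u')) c" using eq pu(1) pu'(1) pp' by simp
    then have "invA c (fst ?z) (fst (Lc c ?z (snd u b, 0))) = invA c (fst ?z) (fst (Lc c ?z (snd u' b, 0)))"
      by (simp add: pull_theta[OF b pu(3)] pull_theta[OF b u'] snd_tvec_of[OF atlas_tot cp])
    then have "fst (Lc c ?z (snd u b, 0)) = fst (Lc c ?z (snd u' b, 0))"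
      using microA_invA[OF c z] by metis
    then have 0: "fst (Lc c ?z (snd u b - snd u' b, 0)) = 0"
      using linear_diff[OF Lc_linear[OF c z], of "(snd u b, 0)" "(snd u' b, 0)"] by simp
    \<comment> \<open>The base component of the image of \<open>snd u b - snd u' b\<close> is zero;
      this vertical correction cancels the fibre component too. Injectivity of \<open>L\<close> then
      kills the whole vector, in particular the difference. Injectivity of the solder form thus
      comes from all of \<open>L\<close>, not from \<open>A\<close> alone.\<close>
    let ?dy = "invA c (fst ?z) (- snd (Lc c ?z (snd u b - snd u' b, 0)))"
    have "Lc c ?z (snd u b - snd u' b, ?dy) = 0"
      using 0 by (subst Lc_split[OF c z]) (simp add: microA_invA[OF c z] prod_eq_iff)
    then have "(snd u b - snd u' b, ?dy) = 0"
      using linear_injective_0[OF Lc_linear[OF c z]] Lc_inj[OF c z] by blast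
    then have "snd u b = snd u' b" by (simp add: prod_eq_iff)
    then have "u = u'" by (rule tangent_space_eqI[OF pu(3) u' b'])
    then show "x = x'" using pu(1) pu'(1) pp' by simp
  qed
  moreover have "?\<theta> (p, u) \<in> vertical B p"
    if p: "p \<in> points (tot B)" and u: "u \<in> tangent_space (bas B) (prj B p)" for p u
  proof -
    obtain c b where b: "trivialises B c b" "p \<in> fst c" and cp: "c \<in> charts_at (tot B) p"
      using trivial_ex_at[OF p] .
    show ?thesis
      unfolding pull_theta[OF b u] vertical_iff[OF b]
      using tvec_of_in[OF atlas_tot r1 cp] by (simp add: snd_tvec_of[OF atlas_tot cp])
  qed
  ultimately show ?thesis by (simp add: Sold_def)
qed

lemma pull_gamma_Con: "pull_form B Eamb L gamma_E \<in> Con r B"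
proof -
  let ?V = "\<lambda>c z w. (w, - invA c (fst z) (snd (Lc c z (w, 0))))"
  let ?\<gamma> = "pull_form B Eamb L gamma_E"
  have "fibre_affine_form r B ?\<gamma>"
  proof (rule fibre_affine_formI[where V="?V"])
    show "?\<gamma> \<in> extensional (points (fibprod_atlas B))" by (simp add: pull_form_def)
    show "?\<gamma> (p, u) = tvec_of (tot B) c p (?V c (snd c p) (snd u b))"
      if "trivialises B c b" "p \<in> fst c" "u \<in> tangent_space (bas B) (prj B p)" for c b p u
      by (rule pull_gamma[OF that])
    show "linear (?V c z)" if "c \<in> tot B" "z \<in> snd c ` fst c" for c z
    proof -
      note l = Lc_linear[OF that] and i = invA_linear[OF that]
      have "Lc c z (w + w', 0) = Lc c z (w, 0) + Lc c z (w', 0)" for w w'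
        using linear_add[OF l, of "(w, 0)" "(w', 0)"] by simp
      moreover have "Lc c z (k *\<^sub>R w, 0) = k *\<^sub>R Lc c z (w, 0)" for k w
        using linear_scale[OF l, of k "(w, 0)"] by simp
      ultimately show ?thesis
        by (intro linearI) (simp_all add: linear_add[OF i] linear_scale[OF i])
    qed
    show "Cr_on r (\<lambda>z. ?V c z w) (snd c ` fst c)" if c: "c \<in> tot B" for c w
      using open_chart_image[OF atlas_tot c] invA_Cr[OF c] Lc_Cr[OF c]
      by (intro Cr_on_Pair Cr_on_const Cr_on_minus invA_Cr[OF c] Cr_on_snd)
    show "affine_fun (\<lambda>y. ?V c (x, y) w)" if c: "c \<in> tot B" and z: "(x, y) \<in> snd c ` fst c" for c x y w
    proof -
      have i: "linear (invA c x)" using invA_linear[OF c z] by simp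
      have "linear (\<lambda>k :: R3 \<times> R3. - invA c x (snd k))"
        by (intro linearI) (simp_all add: linear_add[OF i] linear_scale[OF i])
      from affine_fun_Pair[OF affine_fun_const affine_fun_linear_comp[OF Lc_affine[OF c z, of "(w, 0)"] this]]
      show ?thesis by simp
    qed
  qed
  moreover have "tprj B (?\<gamma> (p, u)) = u"
    if p: "p \<in> points (tot B)" and u: "u \<in> tangent_space (bas B) (prj B p)" for p u
  proof -
    obtain c b where b: "trivialises B c b" "p \<in> fst c" and b': "b \<in> charts_at (bas B) (prj B p)"
      using trivial_ex_at[OF p] .
    show ?thesis
      unfolding pull_gamma[OF b u] tprj_tvec_of[OF b] using tvec_of_snd[OF u b'] by simp
  qed
  ultimately show ?thesis by (simp add: Con_def)
qed

lemma L_vertical: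
  assumes cp: "c \<in> charts_at (tot B) p" and u: "u \<in> vertical B p"
  shows "L u = evec (shadow B L p) (0, microA c (fst (snd c p)) (snd (snd u c)))"
proof -
  have c: "c \<in> tot B" "p \<in> fst c" using cp by (simp_all add: charts_at_iff)
  obtain b where b: "trivialises B c b" using trivialises_ex[OF c(1)] .
  have "snd u c = (0, snd (snd u c))" using u unfolding vertical_iff[OF b c(2)] by (simp add: prod_eq_iff)
  moreover have "snd c p \<in> snd c ` fst c" using c by simp
  ultimately show ?thesis
    using L_eq[OF cp vertical_subset[OF u]] Lc_vertical[OF c(1)] by metis
qed

text \<open>The Gram form \<open>A\<^sup>T A\<close>, independent of the height in the
  fibre.\<close>

lemma pull_metric_eq:
  assumes cp: "c \<in> charts_at (tot B) p" and u: "u \<in> vertical B p" and w: "w \<in> vertical B p"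
  shows "pull_metric B L g_vv (u, w) =
    microA c (fst (snd c p)) (snd (snd u c)) \<bullet> microA c (fst (snd c p)) (snd (snd w c))"
proof -
  have "p \<in> points (tot B)" using cp unfolding points_iff by blast
  then have "(u, w) \<in> vertical_pairs B" using u w by (auto simp: vertical_pairs_def)
  then show ?thesis
    by (simp add: pull_metric_def L_vertical[OF cp u] L_vertical[OF cp w] g_vv_evec)
qed

lemma vertical_tvec_of:
  assumes "c \<in> charts_at (tot B) p"
  shows "tvec_of (tot B) c p (0, w) \<in> vertical B p"
proof -
  have c: "c \<in> tot B" "p \<in> fst c" using assms by (simp_all add: charts_at_iff)
  obtain b where b: "trivialises B c b" using trivialises_ex[OF c(1)] .
  show ?thesis
    unfolding vertical_iff[OF b c(2)]
    using tvec_of_in[OF atlas_tot r1 assms] by (simp add: snd_tvec_of[OF atlas_tot assms])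
qed

lemma pull_metric_micro: "pull_metric B L g_vv \<in> micro_metrics r B"
proof -
  let ?g = "pull_metric B L g_vv"
  have "?g (u, w) = ?g (w, u) \<and> (\<forall>u'\<in>vertical B p. ?g (tadd u u', w) = ?g (u, w) + ?g (u', w)) \<and>
      (\<forall>t. ?g (tscale t u, w) = t * ?g (u, w)) \<and> (u \<noteq> tzero p \<longrightarrow> 0 < ?g (u, u))"
    if p: "p \<in> points (tot B)" and u: "u \<in> vertical B p" and w: "w \<in> vertical B p" for p u w
  proof -
    obtain c b where b: "trivialises B c b" "p \<in> fst c" and cp: "c \<in> charts_at (tot B) p"
      using trivial_ex_at[OF p] .
    note c = trivialisesD(1)[OF b(1)]
    have z: "snd c p \<in> snd c ` fst c" using b by simp
    note lin = microA_linear[OF c z] and eq = pull_metric_eq[OF cp]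
    have "?g (tadd u u', w) = ?g (u, w) + ?g (u', w)" if u': "u' \<in> vertical B p" for u'
    proof -
      have "tadd u u' \<in> vertical B p"
        using u u' tadd_in[OF atlas_tot r1, of u p u'] unfolding vertical_iff[OF b] by (simp add: tadd_def)
      then show ?thesis
        by (simp add: eq u u' w) (simp add: tadd_def linear_add[OF lin] inner_add_left)
    qed
    moreover have "?g (tscale t u, w) = t * ?g (u, w)" for t
    proof -
      have "tscale t u \<in> vertical B p"
        using u tscale_in[OF atlas_tot r1, of u p] unfolding vertical_iff[OF b] by (simp add: tscale_def)
      then show ?thesis by (simp add: eq u w) (simp add: tscale_def linear_scale[OF lin])
    qed
    moreover have "0 < ?g (u, u)" if "u \<noteq> tzero p"
    proof -
      have "snd u c \<noteq> 0"
        using that tangent_space_eqI[OF vertical_subset[OF u] tzero_in[OF atlas_tot r1 p] cp]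
        by (auto simp: tzero_def)
      moreover have "fst (snd u c) = 0" using u unfolding vertical_iff[OF b] by simp
      ultimately have "snd (snd u c) \<noteq> 0" by (simp add: prod_eq_iff)
      then have "microA c (fst (snd c p)) (snd (snd u c)) \<noteq> 0"
        using linear_injective_0[OF lin] microA_inj[OF c z] by blast
      then show ?thesis by (simp add: eq[OF u u])
    qed
    ultimately show ?thesis by (simp add: eq u w inner_commute)
  qed
  moreover have "Cr_on r (\<lambda>z. ?g (tvec_of (tot B) c (of_coords c z) (0, w),
      tvec_of (tot B) c (of_coords c z) (0, w'))) (snd c ` fst c)" if c: "c \<in> tot B" for c w w'
  proof (rule Cr_on_cong)
    show O: "open (snd c ` fst c)" by (rule open_chart_image[OF atlas_tot c])
    show "Cr_on r (\<lambda>z. microA c (fst z) w \<bullet> microA c (fst z) w') (snd c ` fst c)"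
      by (intro Cr_on_bilinear[OF O bounded_bilinear_inner] microA_Cr[OF c])
    fix z assume z: "z \<in> snd c ` fst c"
    have cp: "c \<in> charts_at (tot B) (of_coords c z)"
      using c of_coords_in[OF z] by (simp add: charts_at_iff)
    show "microA c (fst z) w \<bullet> microA c (fst z) w' =
        ?g (tvec_of (tot B) c (of_coords c z) (0, w), tvec_of (tot B) c (of_coords c z) (0, w'))"
      using pull_metric_eq[OF cp vertical_tvec_of[OF cp, of w] vertical_tvec_of[OF cp, of w']] snd_of_coords[OF z]
      by (simp add: snd_tvec_of[OF atlas_tot cp])
  qed
  moreover have "?g \<in> extensional (vertical_pairs B)" by (simp add: pull_metric_def)
  ultimately show ?thesis unfolding micro_metrics_def by blast
qed

end

section \<open>Conformations and the tangent maps of their shadows as placements\<close>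

lemma Conf_placement:
  fixes B :: "('p, real^3, 'q, 'b::euclidean_space) affbundle"
  assumes "smooth_affine_bundle r B" and F: "F \<in> Conf r B"
  shows "placement r B F"
proof -
  interpret smooth_affine_bundle r B by fact
  have Lpa: "F \<in> Lpa r B Eamb"
    and emb: "diff_embedding r (tangent_atlas (tot B)) (tangent_atlas {std}) F"
    using F by (simp_all add: Conf_def)
  have inj: "inj_on F (tangent (tot B))"
    using emb homeomorphic_imp_injective_map
    by (fastforce simp: diff_embedding_def embedding_map_def topspace_man_topology tangent_atlas_points)
  show ?thesis
  proof unfold_locales
    show "shadow B F \<in> Aff (r + 1) B Eamb" using Lpa by (simp add: Lpa_def)
    show F_in: "F u \<in> tangent_space {std} (shadow B F p)" if "u \<in> tangent_space (tot B) p" for p u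
      using Lpa that tangent_spaceD(2)[OF that] by (simp add: Lpa_def)
    show "tlinear_on (tangent_space (tot B) p) F" if "p \<in> points (tot B)" for p
      using Lpa that by (simp add: Lpa_def)
    show "inj_on F (tangent_space (tot B) p)" if "p \<in> points (tot B)" for p
      by (rule inj_on_subset[OF inj]) (use that in \<open>auto simp: tangent_def\<close>)
    show "tprj Eamb (F u) = bar B Eamb F (tprj B u)" if "u \<in> tangent (tot B)" for u
      using Lpa that by (simp add: Lpa_def)
    show "F u = tmap (tot B) {std} (shadow B F) u" if "p \<in> points (tot B)" "u \<in> vertical B p" for p u
      using Lpa that by (simp add: Lpa_def)
    show "affine_fun (\<lambda>y. snd (F (tvec_of (tot B) c (fibre_pt c p y) w)) std)"
      if "c \<in> tot B" "p \<in> fst c" for c p w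
      using Lpa that by (simp add: Lpa_def)
    show "Cr_on r (\<lambda>z. snd (F (tvec_of (tot B) c (of_coords c z) w)) std) (snd c ` fst c)"
      if c: "c \<in> tot B" for c w
    proof -
      let ?W = "snd c ` fst c" and ?C = "tchart (tot B) c" and ?D = "tchart {std :: (R3 \<times> R3, R3 \<times> R3) chart} std"
      have W: "open ?W" by (rule open_chart_image[OF atlas_tot c])
      have "?C \<in> tangent_atlas (tot B)" "?D \<in> tangent_atlas {std}" using c by (auto simp: tangent_atlas_eq)
      then have "Cr_on r (snd ?D \<circ> F \<circ> of_coords ?C) (snd ?C ` (fst ?C \<inter> F -` fst ?D))"
        using emb unfolding diff_embedding_def smooth_map_def by blast
      moreover have "fst ?C \<inter> F -` fst ?D = fst ?C"
        using F_in by (auto simp: tangent_iff[of _ "tot B"]) (auto simp: tangent_def)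
      ultimately have cr: "Cr_on r (snd ?D \<circ> F \<circ> of_coords ?C) (?W \<times> UNIV)"
        using tchart_image[OF atlas_tot r1 c] by simp
      \<comment> \<open>Smoothness between the tangent bundles is joint in point and vector;
        freezing the coordinate vector \<open>w\<close> leaves the regularity required of a
        placement.\<close>
      have "Cr_on r (\<lambda>z. (snd ?D \<circ> F \<circ> of_coords ?C) (z, w)) ?W"
        by (rule Cr_on_compose[OF W _ _ _ cr])
          (auto intro!: open_Times W Cr_on_Pair Cr_on_ident Cr_on_const)
      from Cr_on_snd[OF W this] show ?thesis
      proof (rule Cr_on_cong[OF W])
        fix z assume z: "z \<in> ?W"
        show "snd ((snd ?D \<circ> F \<circ> of_coords ?C) (z, w)) = snd (F (tvec_of (tot B) c (of_coords c z) w)) std"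
          using of_coords_tchart[OF atlas_tot r1 c z, of w] by simp
      qed
    qed
  qed
qed

text \<open>Here the two embedding conditions part: \<open>F\<close> owes its injectivity on tangent
  spaces to being an embedding itself, while \<open>Tshadow B F\<close> owes it to the injective
  differential of the shadow. One derivative is spent, from \<open>r + 1\<close> to
  \<open>r\<close>, and affinity in the vertical coordinate survives it by
  \<open>affine_fun_frechet_derivative\<close>.\<close>

lemma
  fixes B :: "('p, real^3, 'q, 'b::euclidean_space) affbundle"
  assumes "smooth_affine_bundle r B" and F: "F \<in> Conf r B"
  shows Tshadow_placement: "placement r B (Tshadow B F)" and shadow_Tshadow: "shadow B (Tshadow B F) = shadow B F"
proof -
  interpret placement r B F by (rule Conf_placement[OF assms])
  let ?\<phi> = "shadow B F"
  have T: "Tshadow B F = tmap (tot B) {std} ?\<phi>" by (simp add: Tshadow_def)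
  show sh: "shadow B (Tshadow B F) = ?\<phi>" unfolding T by (rule shadow_tmap_phi)
  have inj: "inj (frechet_derivative (?\<phi> \<circ> of_coords c) (at (snd c p)))" if "c \<in> charts_at (tot B) p" for c p
  proof -
    have "p \<in> points (tot B)" using that unfolding points_iff by blast
    then show ?thesis using F that by (simp add: Conf_def diff_embedding_def)
  qed
  show "placement r B (Tshadow B F)"
  proof (unfold_locales, unfold sh, unfold T)
    show "?\<phi> \<in> Aff (r + 1) B Eamb" by (rule shadow_Aff)
    show "tmap (tot B) {std} ?\<phi> u \<in> tangent_space {std} (?\<phi> p)" if "u \<in> tangent_space (tot B) p" for p u
      by (rule tmap_in[OF atlas_tot smooth_atlas_std phi_smooth r1 that])
    show "tlinear_on (tangent_space (tot B) p) (tmap (tot B) {std} ?\<phi>)" for p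
      by (rule tlinear_on_tmap[OF atlas_tot phi_smooth r1])
    show "inj_on (tmap (tot B) {std} ?\<phi>) (tangent_space (tot B) p)" if p: "p \<in> points (tot B)" for p
    proof (rule inj_onI)
      fix u v assume u: "u \<in> tangent_space (tot B) p" and v: "v \<in> tangent_space (tot B) p"
        and eq: "tmap (tot B) {std} ?\<phi> u = tmap (tot B) {std} ?\<phi> v"
      obtain c where c: "c \<in> charts_at (tot B) p" using p unfolding points_iff by blast
      have "snd u c = snd v c" using eq injD[OF inj[OF c]] by (simp add: tmap_phi[OF c] u v)
      then show "u = v" by (rule tangent_space_eqI[OF u v c])
    qed
    show "tprj Eamb (tmap (tot B) {std} ?\<phi> u) = bar B Eamb (tmap (tot B) {std} ?\<phi>) (tprj B u)"
      if "u \<in> tangent (tot B)" for u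
      using tprj_tmap_phi[OF that] by (simp add: bar_def shadow_tmap_phi)
    have coord: "snd (tmap (tot B) {std} ?\<phi> (tvec_of (tot B) c (of_coords c z) w)) std =
        frechet_derivative (?\<phi> \<circ> of_coords c) (at z) w" if c: "c \<in> tot B" and z: "z \<in> snd c ` fst c" for c z w
    proof -
      have cp: "c \<in> charts_at (tot B) (of_coords c z)" using c of_coords_in[OF z] by (simp add: charts_at_iff)
      show ?thesis
        using tmap_phi[OF cp tvec_of_in[OF atlas_tot r1 cp]] snd_of_coords[OF z]
        by (simp add: snd_tvec_of[OF atlas_tot cp])
    qed
    show "Cr_on r (\<lambda>z. snd (tmap (tot B) {std} ?\<phi> (tvec_of (tot B) c (of_coords c z) w)) std) (snd c ` fst c)"
      if c: "c \<in> tot B" for c w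
      by (rule Cr_on_cong[OF open_chart_image[OF atlas_tot c] Cr_on_deriv[OF phi_chart_Cr[OF c]]])
        (simp add: coord[OF c])
    show "affine_fun (\<lambda>y. snd (tmap (tot B) {std} ?\<phi> (tvec_of (tot B) c (fibre_pt c p y) w)) std)"
      if c: "c \<in> tot B" and p: "p \<in> fst c" for c p w
    proof -
      obtain x y where xy: "snd c p = (x, y)" by (cases "snd c p")
      then have z: "(x, y) \<in> snd c ` fst c" using p by (metis image_eqI)
      have "affine_fun (\<lambda>y. frechet_derivative (?\<phi> \<circ> of_coords c) (at (x, y)) w)"
        by (rule affine_fun_frechet_derivative[OF open_chart_image[OF atlas_tot c]
              chart_vertical_line[OF c] phi_chart_differentiable[OF c] phi_chart_affine[OF c] z])
      then show ?thesis
        using coord[OF c chart_vertical_line[OF c z]] by (simp add: fibre_pt_def xy)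
    qed
  qed simp_all
qed

text \<open>The metric sees only vertical vectors, where \<open>F\<close> and the tangent map of its
  shadow agree. The solder form is \<open>A\<^sup>-\<^sup>1 dp\<close>, and both factors come from
  the shadow. The connection involves \<open>G\<close>, which is why it may differ.\<close>

lemma II_Tshadow:
  fixes B :: "('p, real^3, 'q, 'b::euclidean_space) affbundle"
  assumes "smooth_affine_bundle r B" and F: "F \<in> Conf r B"
  shows "pull_metric B F g_vv = pull_metric B (Tshadow B F) g_vv"
    and "pull_form B Eamb F theta_E = pull_form B Eamb (Tshadow B F) theta_E"
proof -
  interpret F: placement r B F by (rule Conf_placement[OF assms])
  interpret T: placement r B "Tshadow B F" by (rule Tshadow_placement[OF assms])
  note sh = shadow_Tshadow[OF assms]
  have "F u = Tshadow B F u" if "p \<in> points (tot B)" "u \<in> vertical B p" for p u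
    using F.L_vert[OF that] by (simp add: Tshadow_def)
  then show "pull_metric B F g_vv = pull_metric B (Tshadow B F) g_vv"
    unfolding pull_metric_def by (intro restrict_ext) (auto simp: vertical_pairs_def)
  have bar: "bar B Eamb F = bar B Eamb (Tshadow B F)" by (simp add: bar_def sh)
  have "pull_form B Eamb F theta_E (p, u) = pull_form B Eamb (Tshadow B F) theta_E (p, u)"
    if pu: "(p, u) \<in> points (fibprod_atlas B)" for p u
  proof -
    have p: "p \<in> points (tot B)" and u: "u \<in> tangent_space (bas B) (prj B p)"
      using pu unfolding F.fibprod_points by auto
    obtain c b where b: "trivialises B c b" "p \<in> fst c" using F.trivial_ex_at[OF p] .
    have "fst (F.Lc c (snd c p) (snd u b, 0)) = fst (T.Lc c (snd c p) (snd u b, 0))"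
      using F.bar_evec[OF b u, of 0] T.bar_evec[OF b u, of 0] by (simp add: bar)
    then show ?thesis unfolding F.pull_theta[OF b u] T.pull_theta[OF b u] by (simp add: sh)
  qed
  then show "pull_form B Eamb F theta_E = pull_form B Eamb (Tshadow B F) theta_E"
    unfolding pull_form_def by (intro restrict_ext) (metis (no_types, lifting) restrict_apply surj_pair)
qed

lemma II_mem:
  fixes B :: "('p, real^3, 'q, 'b::euclidean_space) affbundle"
  assumes "smooth_affine_bundle r B" and F: "F \<in> Conf r B"
  shows "II B F \<in> micro_metrics r B \<times> Sold r B \<times> Con r B \<times> Con r B"
  using placement.pull_metric_micro placement.pull_theta_Sold placement.pull_gamma_Con
    Conf_placement[OF assms] Tshadow_placement[OF assms]
  by (auto simp: II_def)

section \<open>The action of the generalised Galilean group\<close>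

text \<open>Coordinate preimages of open sets generate the topology, so continuity in coordinates is
  all that has to be checked. It serves both the ambient space and its tangent bundle.\<close>

lemma continuous_map_single_chart:
  assumes f: "\<And>p. p \<in> fst c \<Longrightarrow> f p \<in> fst d" and eq: "\<And>p. p \<in> fst c \<Longrightarrow> snd d (f p) = h (snd c p)"
    and h: "continuous_on UNIV h"
  shows "continuous_map (man_topology {c}) (man_topology {d}) f"
  unfolding man_topology_def[of "{d}"]
proof (rule continuous_on_generated_topo)
  have top: "topspace (man_topology {c}) = fst c" by (simp add: topspace_man_topology points_def)
  show "openin (man_topology {c}) (f -` U \<inter> topspace (man_topology {c}))"
    if "U \<in> {fst c \<inter> snd c -` S |c S. c \<in> {d} \<and> open S}" for U
  proof -
    obtain S where S: "U = fst d \<inter> snd d -` S" "open S" using \<open>U \<in> _\<close> by auto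
    have "f -` U \<inter> topspace (man_topology {c}) = fst c \<inter> snd c -` (h -` S)"
      using f eq by (auto simp: top S(1))
    moreover have "open (h -` S)" using h S(2) by (simp add: continuous_on_open_vimage)
    ultimately show ?thesis using openin_man_topology[of c "{c}"] by simp
  qed
  have "fst d \<inter> snd d -` UNIV \<in> {fst c \<inter> snd c -` S |c S. c \<in> {d} \<and> open S}" using open_UNIV by blast
  then show "f ` topspace (man_topology {c}) \<subseteq> \<Union> {fst c \<inter> snd c -` S |c S. c \<in> {d} \<and> open S}"
    using f by (auto simp: top)
qed

lemma embedding_map_inverse:
  assumes "continuous_map X X f" "continuous_map X X g"
    "\<And>x. x \<in> topspace X \<Longrightarrow> g (f x) = x" "\<And>x. x \<in> topspace X \<Longrightarrow> f (g x) = x"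
  shows "embedding_map X X f"
proof -
  have "homeomorphic_maps X X f g" using assms by (simp add: homeomorphic_maps_def)
  then have "homeomorphic_map X X f" using homeomorphic_map_maps by blast
  then show ?thesis using surjective_embedding_map by blast
qed

lemma orthogonal_transformation_inverse:
  fixes R :: "'a::euclidean_space \<Rightarrow> 'a"
  assumes "orthogonal_transformation R"
  shows "\<exists>R'. orthogonal_transformation R' \<and> (\<forall>x. R' (R x) = x) \<and> (\<forall>x. R (R' x) = x)"
proof (intro exI conjI allI)
  have "bij R" using assms by (rule orthogonal_transformation_bij)
  then show "inv_into UNIV R (R x) = x" "R (inv_into UNIV R x) = x" for x
    by (simp_all add: bij_is_inj bij_is_surj surj_f_inv_f)
  show "orthogonal_transformation (inv_into UNIV R)" by (rule orthogonal_transformation_inv[OF assms])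
qed

lemma linear_continuous: "linear (h :: 'a::euclidean_space \<Rightarrow> 'b::real_normed_vector) \<Longrightarrow> continuous_on UNIV h"
  by (simp add: linear_continuous_on linear_conv_bounded_linear)

lemma continuous_gal_map: "linear R \<Longrightarrow> continuous_on UNIV (gal_map R t s)"
  unfolding gal_map_affine
  by (rule continuous_on_add[OF linear_continuous[OF linear_gal_lin] continuous_on_const])

lemma embedding_gal_map:
  assumes R: "orthogonal_transformation R"
  shows "embedding_map (man_topology {std}) (man_topology {std}) (gal_map R t s)"
proof -
  obtain R' :: "R3 \<Rightarrow> R3" where R': "orthogonal_transformation R'" and inv: "\<And>x. R' (R x) = x" "\<And>x. R (R' x) = x"
    using orthogonal_transformation_inverse[OF R] by blast
  have cont: "continuous_map (man_topology {std}) (man_topology {std}) (gal_map R t s)"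
    if "orthogonal_transformation R" for R t s
    by (rule continuous_map_single_chart[where h="gal_map R t s"])
      (auto intro!: continuous_gal_map orth_linear[OF that])
  show ?thesis
    by (rule embedding_map_inverse[OF cont[OF R] cont[OF R', of "- R' t" "- R' s"]])
      (simp_all add: gal_map_def inv linear_add[OF orth_linear[OF R]] linear_add[OF orth_linear[OF R']]
        linear_diff[OF orth_linear[OF R]])
qed

lemma embedding_Tgal:
  assumes R: "orthogonal_transformation R"
  shows "embedding_map (man_topology (tangent_atlas {std})) (man_topology (tangent_atlas {std})) (Tgal R t s)"
proof -
  obtain R' :: "R3 \<Rightarrow> R3" where R': "orthogonal_transformation R'" and inv: "\<And>x. R' (R x) = x" "\<And>x. R (R' x) = x"
    using orthogonal_transformation_inverse[OF R] by blast
  have cont: "continuous_map (man_topology (tangent_atlas {std})) (man_topology (tangent_atlas {std})) (Tgal R t s)"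
    if R: "orthogonal_transformation R" for R t s
  proof -
    have h: "continuous_on UNIV (\<lambda>x. (gal_map R t s (fst x), gal_lin R (snd x)))"
      by (intro continuous_on_Pair
          continuous_on_compose2[OF linear_continuous[OF linear_gal_lin[OF orth_linear[OF R]]]]
          continuous_on_compose2[OF continuous_gal_map[OF orth_linear[OF R]]]
          continuous_on_fst continuous_on_snd continuous_on_id) auto
    show ?thesis
      unfolding tangent_atlas_eq image_insert image_empty
    proof (rule continuous_map_single_chart[OF _ _ h])
      fix U :: TE assume "U \<in> fst (tchart {std} std)"
      then have "U \<in> tangent {std}" by simp
      then obtain a w where U: "U = evec a w" by (rule tangent_std_cases)
      show "Tgal R t s U \<in> fst (tchart {std} std)"
        "snd (tchart {std} std) (Tgal R t s U) =
          (gal_map R t s (fst (snd (tchart {std} std) U)), gal_lin R (snd (snd (tchart {std} std) U)))"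
        by (simp_all add: U Tgal_evec orth_linear[OF R])
    qed
  qed
  have "Tgal R' (- R' t) (- R' s) (Tgal R t s U) = U \<and> Tgal R t s (Tgal R' (- R' t) (- R' s) U) = U"
    if "U \<in> topspace (man_topology (tangent_atlas {std}))" for U
  proof -
    have "U \<in> tangent {std}" using that by (simp add: topspace_man_topology tangent_atlas_points)
    then obtain a w where U: "U = evec a w" by (rule tangent_std_cases)
    show ?thesis
      by (simp add: U Tgal_evec orth_linear[OF R] orth_linear[OF R'] gal_map_def gal_lin_def inv
          linear_add[OF orth_linear[OF R]] linear_add[OF orth_linear[OF R']] linear_diff[OF orth_linear[OF R]])
  qed
  then show ?thesis
    by (intro embedding_map_inverse[OF cont[OF R] cont[OF R', of "- R' t" "- R' s"]]) blast+
qed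

lemma gal_lin_inj: "orthogonal_transformation R \<Longrightarrow> inj (gal_lin R)"
  using orthogonal_transformation_inj[of R] by (auto simp: inj_def gal_lin_def prod_eq_iff)

lemma smooth_map_affine_comp:
  fixes h :: "'v::euclidean_space \<Rightarrow> 'w::euclidean_space"
  assumes A: "smooth_atlas s A" and f: "smooth_map s A {std} f" and h: "linear h"
  shows "smooth_map s A {std} (\<lambda>p. h (f p) + a)"
  unfolding smooth_map_std
proof (intro ballI conjI)
  fix c assume c: "c \<in> A"
  show O: "open (snd c ` fst c)" by (rule open_chart_image[OF A c])
  have cr: "Cr_on s (f \<circ> of_coords c) (snd c ` fst c)" using f c by (simp add: smooth_map_std)
  have "Cr_on s (\<lambda>z. h ((f \<circ> of_coords c) z) + a) (snd c ` fst c)"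
    by (rule Cr_on_add[OF O Cr_on_linear_comp[OF O _ cr] Cr_on_const[OF O]])
      (use h in \<open>simp add: linear_conv_bounded_linear\<close>)
  then show "Cr_on s ((\<lambda>p. h (f p) + a) \<circ> of_coords c) (snd c ` fst c)" by (simp add: comp_def)
qed

section \<open>Moving a placement by a Galilean map\<close>

context placement
begin

abbreviation galL :: "(R3 \<Rightarrow> R3) \<Rightarrow> R3 \<Rightarrow> R3 \<Rightarrow> ('p, 'b \<times> R3) tvec \<Rightarrow> TE" where
  "galL R t s \<equiv> compose (tangent (tot B)) (Tgal R t s) L"

abbreviation gal_shadow :: "(R3 \<Rightarrow> R3) \<Rightarrow> R3 \<Rightarrow> R3 \<Rightarrow> 'p \<Rightarrow> R3 \<times> R3" where
  "gal_shadow R t s \<equiv> (\<lambda>p\<in>points (tot B). gal_map R t s (shadow B L p))"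

lemma L_evec:
  assumes "u \<in> tangent_space (tot B) p"
  obtains k where "L u = evec (shadow B L p) k"
  using evec_snd[OF L_in[OF assms]] by metis

lemma L_tangent: "u \<in> tangent (tot B) \<Longrightarrow> L u \<in> tangent {std}"
  by (metis L_evec evec_in_tangent tangent_iff)

lemma galL_evec:
  assumes R: "linear R" and u: "u \<in> tangent_space (tot B) p" and k: "L u = evec (shadow B L p) k"
  shows "galL R t s u = evec (gal_map R t s (shadow B L p)) (gal_lin R k)"
proof -
  have "u \<in> tangent (tot B)" using u tangent_spaceD(1)[OF u] by (simp add: tangent_iff)
  then show ?thesis by (simp add: compose_def k Tgal_evec[OF R])
qed

lemma shadow_galL:
  assumes R: "linear R"
  shows "shadow B (galL R t s) = gal_shadow R t s"
  unfolding shadow_def[of B "galL R t s"]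
proof (rule restrict_ext)
  fix p assume p: "p \<in> points (tot B)"
  have z: "tzero p \<in> tangent_space (tot B) p" by (rule tzero_in[OF atlas_tot r1 p])
  obtain k where k: "L (tzero p) = evec (shadow B L p) k" using L_evec[OF z] .
  show "fst (galL R t s (tzero p)) = gal_map R t s (shadow B L p)"
    using galL_evec[OF R z k] by simp
qed

lemma gal_shadow_smooth:
  assumes R: "linear R"
  shows "smooth_map (r + 1) (tot B) {std} (\<lambda>p. gal_map R t s (shadow B L p))"
    and "smooth_map (r + 1) (tot B) {std} (gal_shadow R t s)"
proof -
  show 1: "smooth_map (r + 1) (tot B) {std} (\<lambda>p. gal_map R t s (shadow B L p))"
    unfolding gal_map_affine by (rule smooth_map_affine_comp[OF atlas_tot phi_smooth linear_gal_lin[OF R]])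
  show "smooth_map (r + 1) (tot B) {std} (gal_shadow R t s)"
    by (rule smooth_map_cong[OF atlas_tot 1]) simp
qed

lemma gal_shadow_Aff:
  assumes R: "linear R"
  shows "gal_shadow R t s \<in> Aff (r + 1) B Eamb"
proof -
  obtain lb where lb: "smooth_map (r + 1) (bas B) {std} lb"
    "\<And>p. p \<in> points (tot B) \<Longrightarrow> fst (shadow B L p) = lb (prj B p)"
    using shadow_Aff by (auto simp: Aff_def)
  have "smooth_map (r + 1) (bas B) {std} (\<lambda>x. R (lb x) + t)"
    by (rule smooth_map_affine_comp[OF atlas_bas lb(1) R])
  moreover have "fst (gal_shadow R t s p) = R (lb (prj B p)) + t" if "p \<in> points (tot B)" for p
    using that lb(2) by (simp add: gal_map_def)
  moreover have "affine_fun (\<lambda>y. snd (gal_shadow R t s (fibre_pt c p y)))"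
    if c: "c \<in> tot B" and p: "p \<in> fst c" for c p
  proof -
    have "affine_fun (\<lambda>y. snd (shadow B L (fibre_pt c p y)))"
      using shadow_Aff c p by (simp add: Aff_def)
    from affine_fun_plus_const[OF affine_fun_linear_comp[OF this R], of s]
    show ?thesis using pointsI[OF c fibre_pt(1)[OF c p]] by (simp add: gal_map_def)
  qed
  ultimately show ?thesis
    using gal_shadow_smooth(2)[OF R] by (auto simp: Aff_def)
qed

lemma tmap_gal_shadow:
  assumes R: "linear R" and u: "u \<in> tangent_space (tot B) p"
  shows "tmap (tot B) {std} (gal_shadow R t s) u = Tgal R t s (tmap (tot B) {std} (shadow B L) u)"
proof -
  have "tmap (tot B) {std} (gal_shadow R t s) = tmap (tot B) {std} (\<lambda>p. gal_map R t s (shadow B L p))"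
    by (rule tmap_cong[OF atlas_tot gal_shadow_smooth(2)[OF R] r1]) simp
  then show ?thesis
    using tmap_comp[OF atlas_tot smooth_atlas_std phi_smooth smooth_gal_map[OF R] gal_shadow_smooth(1)[OF R] r1 u]
    by simp
qed

lemma bar_gal:
  assumes R: "linear R" and v: "v \<in> tangent_space (bas B) x"
  shows "bar B Eamb (galL R t s) v = tmap {std} {std} (\<lambda>x. R x + t) (bar B Eamb L v)"
proof -
  have G: "affine_placement r B (gal_shadow R t s)"
    by (intro affine_placement.intro affine_placement_axioms.intro smooth_affine_bundle_axioms
        gal_shadow_Aff[OF R])
  let ?b = "base_map B Eamb (shadow B L)"
  have eq: "base_map B Eamb (gal_shadow R t s) x = R (?b x) + t" if "x \<in> points (bas B)" for x
  proof -
    have "x \<in> prj B ` points (tot B)" using that by (simp only: prj_points)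
    then obtain p where x: "x = prj B p" and p: "p \<in> points (tot B)" by (rule imageE)
    have "base_map B Eamb (gal_shadow R t s) x = fst (gal_map R t s (shadow B L p))"
      unfolding x affine_placement.base_map_prj[OF G p] using p by (simp only: restrict_apply if_True)
    then show ?thesis unfolding x base_map_prj[OF p] by (simp only: gal_map_def fst_conv)
  qed
  have sm: "smooth_map (r + 1) (bas B) {std} (\<lambda>x. R (?b x) + t)"
    by (rule smooth_map_affine_comp[OF atlas_bas base_map_smooth R])
  have sm': "smooth_map (r + 1) {std} {std} (\<lambda>x. R x + t)"
    using R by (simp add: smooth_map_std_std Cr_on_affine)
  have "tmap (bas B) {std} (base_map B Eamb (gal_shadow R t s)) = tmap (bas B) {std} (\<lambda>x. R (?b x) + t)"
    by (rule tmap_cong[OF atlas_bas affine_placement.base_map_smooth[OF G] r1 eq])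
  then show ?thesis
    using tmap_comp[OF atlas_bas smooth_atlas_std base_map_smooth sm' sm r1 v]
    by (simp add: bar_def shadow_galL[OF R])
qed

lemma galL_inj:
  assumes R: "orthogonal_transformation R" and p: "p \<in> points (tot B)"
  shows "inj_on (galL R t s) (tangent_space (tot B) p)"
proof (rule inj_onI)
  fix u v assume u: "u \<in> tangent_space (tot B) p" and v: "v \<in> tangent_space (tot B) p"
    and eq: "galL R t s u = galL R t s v"
  obtain k where k: "L u = evec (shadow B L p) k" using L_evec[OF u] .
  obtain k' where k': "L v = evec (shadow B L p) k'" using L_evec[OF v] .
  have "gal_lin R k = gal_lin R k'"
    using eq galL_evec[OF orth_linear[OF R] u k] galL_evec[OF orth_linear[OF R] v k'] by simp
  then have "L u = L v" using injD[OF gal_lin_inj[OF R]] k k' by simp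
  then show "u = v" by (rule inj_onD[OF L_inj[OF p] _ u v])
qed

text \<open>Describes the pulled-back vectors by their images under \<open>L\<close> rather than by
  coordinates, so that invariance can be shown without charts.\<close>

lemma pull_forms_cases:
  assumes "(p, u) \<in> points (fibprod_atlas B)"
  obtains k where "bar B Eamb L u = evec (fst (shadow B L p)) k"
    "pull_form B Eamb L theta_E (p, u) \<in> tangent_space (tot B) p"
    "L (pull_form B Eamb L theta_E (p, u)) = evec (shadow B L p) (0, k)"
    "pull_form B Eamb L gamma_E (p, u) \<in> tangent_space (tot B) p"
    "L (pull_form B Eamb L gamma_E (p, u)) = evec (shadow B L p) (k, 0)"
proof -
  have p: "p \<in> points (tot B)" and u: "u \<in> tangent_space (bas B) (prj B p)"
    using assms unfolding fibprod_points by auto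
  obtain c b where b: "trivialises B c b" "p \<in> fst c" and cp: "c \<in> charts_at (tot B) p"
    using trivial_ex_at[OF p] .
  note c = trivialisesD(1)[OF b(1)]
  have z: "snd c p \<in> snd c ` fst c" using b by simp
  have L0: "Lc c (snd c p) (0, 0) = 0"
    using linear_0[OF Lc_linear[OF c z]] by (simp add: zero_prod_def)
  have neg: "microA c (fst (snd c p)) (- w) = - microA c (fst (snd c p)) w" for w
    by (rule linear_neg[OF microA_linear[OF c z]])
  show ?thesis
  proof
    show "bar B Eamb L u = evec (fst (shadow B L p)) (fst (Lc c (snd c p) (snd u b, 0)))"
      by (rule bar_evec[OF b u])
    show "pull_form B Eamb L theta_E (p, u) \<in> tangent_space (tot B) p"
      "pull_form B Eamb L gamma_E (p, u) \<in> tangent_space (tot B) p"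
      unfolding pull_theta[OF b u] pull_gamma[OF b u] by (rule tvec_of_in[OF atlas_tot r1 cp])+
    show "L (pull_form B Eamb L theta_E (p, u)) =
        evec (shadow B L p) (0, fst (Lc c (snd c p) (snd u b, 0)))"
      unfolding pull_theta[OF b u] L_tvec_of[OF cp]
      by (subst Lc_split[OF c z]) (simp add: L0 microA_invA[OF c z])
    show "L (pull_form B Eamb L gamma_E (p, u)) =
        evec (shadow B L p) (fst (Lc c (snd c p) (snd u b, 0)), 0)"
      unfolding pull_gamma[OF b u] L_tvec_of[OF cp]
      by (subst Lc_split[OF c z], simp only: evec_eq_iff) (simp add: neg microA_invA[OF c z] prod_eq_iff)
  qed
qed

end

lemma fst_gal_map [simp]: "fst (gal_map R t s a) = R (fst a) + t"
  by (simp add: gal_map_def)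

lemma gal_lin_Pair_zero: "linear R \<Longrightarrow> gal_lin R (0, k) = (0, R k)" "linear R \<Longrightarrow> gal_lin R (k, 0) = (R k, 0)"
  by (simp_all add: gal_lin_def linear_0)

context placement
begin

text \<open>The action commutes with both ambient structures: \<open>(0, k)\<close> and
  \<open>(k, 0)\<close> go to \<open>(0, R k)\<close> and \<open>(R k, 0)\<close>, while the base
  map turns \<open>k\<close> into \<open>R k\<close>. So the vector pulled back by \<open>L\<close>
  is also the one pulled back by \<open>galL R t s\<close>. For the solder form it matters that base
  and fibre directions carry the same \<open>R\<close>.\<close>

lemma pull_form_galL:
  assumes R: "orthogonal_transformation R"
  shows "pull_form B Eamb (galL R t s) theta_E = pull_form B Eamb L theta_E"
    and "pull_form B Eamb (galL R t s) gamma_E = pull_form B Eamb L gamma_E"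
proof -
  note lin = orth_linear[OF R]
  have *: "pull_form B Eamb (galL R t s) theta_E (p, u) = pull_form B Eamb L theta_E (p, u) \<and>
      pull_form B Eamb (galL R t s) gamma_E (p, u) = pull_form B Eamb L gamma_E (p, u)"
    if pu: "(p, u) \<in> points (fibprod_atlas B)" for p u
  proof (rule pull_forms_cases[OF pu])
    fix k
    assume k: "bar B Eamb L u = evec (fst (shadow B L p)) k"
      and th: "pull_form B Eamb L theta_E (p, u) \<in> tangent_space (tot B) p"
        "L (pull_form B Eamb L theta_E (p, u)) = evec (shadow B L p) (0, k)"
      and ga: "pull_form B Eamb L gamma_E (p, u) \<in> tangent_space (tot B) p"
        "L (pull_form B Eamb L gamma_E (p, u)) = evec (shadow B L p) (k, 0)"
    have p: "p \<in> points (tot B)" and u: "u \<in> tangent_space (bas B) (prj B p)"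
      using pu unfolding fibprod_points by auto
    let ?a = "gal_map R t s (shadow B L p)"
    have sh: "shadow B (galL R t s) p = ?a" using p by (simp add: shadow_galL[OF lin])
    have bar: "bar B Eamb (galL R t s) u = evec (fst ?a) (R k)"
      by (simp add: bar_gal[OF lin u] k tmap_gal_base[OF lin])
    have val: "inv_into (tangent_space (tot B) p) (galL R t s) (galL R t s v) = v"
      if "v \<in> tangent_space (tot B) p" for v
      by (rule inv_into_f_f[OF galL_inj[OF R p] that])
    have "galL R t s (pull_form B Eamb L theta_E (p, u)) = theta_E (?a, evec (fst ?a) (R k))"
      unfolding theta_E_evec using galL_evec[OF lin th, of t s] by (simp add: gal_lin_Pair_zero[OF lin])
    moreover have "galL R t s (pull_form B Eamb L gamma_E (p, u)) = gamma_E (?a, evec (fst ?a) (R k))"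
      unfolding gamma_E_evec using galL_evec[OF lin ga, of t s] by (simp add: gal_lin_Pair_zero[OF lin])
    ultimately show ?thesis
      using val[OF th(1)] val[OF ga(1)] pu unfolding pull_form_def[of B Eamb "galL R t s"]
      by (simp add: sh bar)
  qed
  show "pull_form B Eamb (galL R t s) theta_E = pull_form B Eamb L theta_E"
    by (rule extensionalityI[of _ "points (fibprod_atlas B)"])
      (use * in \<open>auto simp: pull_form_def[abs_def] simp del: restrict_apply\<close>)
  show "pull_form B Eamb (galL R t s) gamma_E = pull_form B Eamb L gamma_E"
    by (rule extensionalityI[of _ "points (fibprod_atlas B)"])
      (use * in \<open>auto simp: pull_form_def[abs_def] simp del: restrict_apply\<close>)
qed

lemma pull_metric_galL:
  assumes R: "orthogonal_transformation R"
  shows "pull_metric B (galL R t s) g_vv = pull_metric B L g_vv"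
  unfolding pull_metric_def
proof (rule restrict_ext)
  note lin = orth_linear[OF R]
  fix x assume "x \<in> vertical_pairs B"
  then obtain p u w where x: "x = (u, w)" and p: "p \<in> points (tot B)"
    and u: "u \<in> vertical B p" and w: "w \<in> vertical B p"
    by (auto simp: vertical_pairs_def)
  obtain c where cp: "c \<in> charts_at (tot B) p" using p unfolding points_iff by blast
  note Lu = L_vertical[OF cp u] and Lw = L_vertical[OF cp w]
  show "(case x of (u, w) \<Rightarrow> g_vv (galL R t s u, galL R t s w)) = (case x of (u, w) \<Rightarrow> g_vv (L u, L w))"
    using R unfolding orthogonal_transformation_def
    by (simp add: x galL_evec[OF lin vertical_subset[OF u] Lu] galL_evec[OF lin vertical_subset[OF w] Lw]
        Lu Lw gal_lin_Pair_zero[OF lin] g_vv_evec)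
qed

text \<open>The tangent map of the shadow is moved by the same group element, so invariance of the
  fourth structure is \<open>pull_form_galL\<close> applied to the placement
  \<open>Tshadow B L\<close>.\<close>

lemma Tshadow_galL:
  assumes R: "linear R"
  shows "Tshadow B (galL R t s) = compose (tangent (tot B)) (Tgal R t s) (Tshadow B L)"
proof (rule extensionalityI[of _ "tangent (tot B)"])
  show "Tshadow B (galL R t s) u = compose (tangent (tot B)) (Tgal R t s) (Tshadow B L) u"
    if "u \<in> tangent (tot B)" for u
    using that tmap_gal_shadow[OF R, of u "fst u" t s]
    by (simp add: Tshadow_def shadow_galL[OF R] compose_eq tangent_iff)
qed (auto simp: Tshadow_def tmap_def)

end

lemma galL_Conf:
  fixes B :: "('p, real^3, 'q, 'b::euclidean_space) affbundle"
  assumes B: "smooth_affine_bundle r B" and F: "F \<in> Conf r B" and R: "orthogonal_transformation R"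
  shows "compose (tangent (tot B)) (Tgal R t s) F \<in> Conf r B"
proof -
  interpret placement r B F by (rule Conf_placement[OF B F])
  note lin = orth_linear[OF R]
  let ?G = "galL R t s" and ?\<phi> = "shadow B F"
  let ?h = "\<lambda>x. (gal_lin R (fst x), gal_lin R (snd x))"
  have h: "linear ?h"
    by (intro linearI) (simp_all add: linear_add[OF linear_gal_lin[OF lin]] linear_scale[OF linear_gal_lin[OF lin]])
  have h_inj: "inj ?h"
  proof (rule injI)
    fix x y assume "?h x = ?h y"
    then have "gal_lin R (fst x) = gal_lin R (fst y)" "gal_lin R (snd x) = gal_lin R (snd y)" by simp_all
    then have "fst x = fst y" "snd x = snd y" using injD[OF gal_lin_inj[OF R]] by blast+
    then show "x = y" by (rule prod_eqI)
  qed
  note sh = shadow_galL[OF lin, of t s]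
  have emb: "diff_embedding r (tangent_atlas (tot B)) (tangent_atlas {std}) F"
    and emb_phi: "diff_embedding (r + 1) (tot B) {std} ?\<phi>"
    using F by (simp_all add: Conf_def)
  have G_in: "?G u \<in> tangent_space {std} (gal_shadow R t s p)"
    and G_std: "snd (?G u) std = gal_lin R (snd (F u) std)"
    if u: "u \<in> tangent_space (tot B) p" for u p
  proof -
    obtain k where k: "F u = evec (?\<phi> p) k" using L_evec[OF u] .
    show "?G u \<in> tangent_space {std} (gal_shadow R t s p)" "snd (?G u) std = gal_lin R (snd (F u) std)"
      using tangent_spaceD(2)[OF u] by (simp_all add: galL_evec[OF lin u k] k)
  qed
  \<comment> \<open>In tangent charts the action is the fixed affine map \<open>?h\<close> plus
    \<open>((t, s), 0)\<close>; the offset is zero on the vector part because translations move base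
    points only. Smoothness and injectivity of the differential are then inherited from
    \<open>F\<close>.\<close>
  have rep: "open (snd C ` fst C) \<and> Cr_on r (snd D \<circ> F \<circ> of_coords C) (snd C ` fst C) \<and>
      fst C \<inter> ?G -` fst D = fst C \<and>
      (\<forall>x\<in>snd C ` fst C. (snd D \<circ> ?G \<circ> of_coords C) x = ?h ((snd D \<circ> F \<circ> of_coords C) x) + ((t, s), 0))"
    if C: "C \<in> tangent_atlas (tot B)" and D: "D \<in> tangent_atlas {std}" for C D
  proof -
    have D': "D = tchart {std} std" using D by (simp add: tangent_atlas_eq)
    obtain c where C': "C = tchart (tot B) c" "c \<in> tot B" using C by (auto simp: tangent_atlas_eq)
    have CT: "fst C \<subseteq> tangent (tot B)" using C' by auto
    have FD: "fst C \<inter> F -` fst D = fst C" using CT L_tangent by (auto simp: D')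
    moreover have "?G u \<in> tangent {std}" if "u \<in> tangent (tot B)" for u
      using L_tangent[OF that] Tgal_closed[OF lin] that by (simp add: compose_def)
    then have "fst C \<inter> ?G -` fst D = fst C" using CT by (auto simp: D')
    moreover have "open (snd C ` (fst C \<inter> F -` fst D)) \<and>
        Cr_on r (snd D \<circ> F \<circ> of_coords C) (snd C ` (fst C \<inter> F -` fst D))"
      using emb C D unfolding diff_embedding_def smooth_map_def by blast
    moreover have "(snd D \<circ> ?G \<circ> of_coords C) x = ?h ((snd D \<circ> F \<circ> of_coords C) x) + ((t, s), 0)"
      if x: "x \<in> snd C ` fst C" for x
    proof -
      have u: "of_coords C x \<in> tangent (tot B)" using of_coords_in[OF x] CT by blast
      obtain a k where k: "F (of_coords C x) = evec a k" using L_tangent[OF u] by (rule tangent_std_cases)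
      have "?G (of_coords C x) = evec (gal_map R t s a) (gal_lin R k)"
        using u by (simp add: k compose_eq Tgal_evec[OF lin])
      then show ?thesis by (simp add: D' k) (simp add: gal_map_affine)
    qed
    ultimately show ?thesis by simp
  qed
  have smooth_G: "smooth_map r (tangent_atlas (tot B)) (tangent_atlas {std}) ?G"
    unfolding smooth_map_def
  proof (intro conjI ballI)
    show "?G \<in> points (tangent_atlas (tot B)) \<rightarrow> points (tangent_atlas {std})"
      using L_tangent Tgal_closed[OF lin] by (auto simp: tangent_atlas_points compose_def)
    fix C :: "(('p, 'b \<times> R3) tvec, ('b \<times> R3) \<times> 'b \<times> R3) chart"
      and D :: "(TE, (R3 \<times> R3) \<times> R3 \<times> R3) chart"
    assume CD: "C \<in> tangent_atlas (tot B)" "D \<in> tangent_atlas {std}"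
    note rp = rep[OF CD]
    then show "open (snd C ` (fst C \<inter> ?G -` fst D))" by simp
    have O: "open (snd C ` fst C)" using rp by blast
    have cr: "Cr_on r (snd D \<circ> F \<circ> of_coords C) (snd C ` fst C)" using rp by blast
    have "bounded_linear ?h" using h by (simp add: linear_conv_bounded_linear)
    from Cr_on_add[OF O Cr_on_linear_comp[OF O this cr] Cr_on_const[OF O]]
    have "Cr_on r (\<lambda>x. ?h ((snd D \<circ> F \<circ> of_coords C) x) + ((t, s), 0)) (snd C ` fst C)" .
    then have "Cr_on r (snd D \<circ> ?G \<circ> of_coords C) (snd C ` fst C)"
      by (rule Cr_on_cong[OF O]) (use rp in metis)
    then show "Cr_on r (snd D \<circ> ?G \<circ> of_coords C) (snd C ` (fst C \<inter> ?G -` fst D))" using rp by simp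
  qed
  have "?G \<in> Lpa r B Eamb"
    unfolding Lpa_def tot_Eamb mem_Collect_eq sh
  proof (intro conjI ballI allI impI)
    show "?G \<in> extensional (tangent (tot B))" by simp
    show "smooth_map r (tangent_atlas (tot B)) (tangent_atlas {std}) ?G" by (rule smooth_G)
    show "gal_shadow R t s \<in> Aff (r + 1) B Eamb" by (rule gal_shadow_Aff[OF lin])
    show "?G u \<in> tangent_space {std} (gal_shadow R t s p)" if "u \<in> tangent_space (tot B) p" for u p
      by (rule G_in[OF that])
    show "tlinear_on (tangent_space (tot B) p) ?G" if p: "p \<in> points (tot B)" for p
    proof -
      note Tl = tlinear_on_tmap[OF smooth_atlas_std smooth_gal_map[OF lin] r1, of "?\<phi> p" t s]
      have G: "?G u = Tgal R t s (F u)" if "u \<in> tangent_space (tot B) p" for u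
        using that tangent_spaceD(1)[OF that] by (simp add: compose_def tangent_iff)
      show ?thesis
        unfolding tlinear_on_def
      proof (intro conjI ballI allI)
        fix u w assume u: "u \<in> tangent_space (tot B) p" and w: "w \<in> tangent_space (tot B) p"
        have "F (tadd u w) = tadd (F u) (F w)" using L_lin[OF p] u w by (simp add: tlinear_on_def)
        then show "?G (tadd u w) = tadd (?G u) (?G w)"
          unfolding G[OF tadd_in[OF atlas_tot r1 u w]] G[OF u] G[OF w]
          using Tl L_in[OF u] L_in[OF w] by (simp add: tlinear_on_def)
      next
        fix a u assume u: "u \<in> tangent_space (tot B) p"
        have "F (tscale a u) = tscale a (F u)" using L_lin[OF p] u by (simp add: tlinear_on_def)
        then show "?G (tscale a u) = tscale a (?G u)"
          unfolding G[OF tscale_in[OF atlas_tot r1 u]] G[OF u]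
          using Tl L_in[OF u] by (simp add: tlinear_on_def)
      qed
    qed
    show "tprj Eamb (?G u) = bar B Eamb ?G (tprj B u)" if u: "u \<in> tangent (tot B)" for u
    proof -
      have u': "u \<in> tangent_space (tot B) (fst u)" using u by (simp add: tangent_iff)
      obtain k where k: "F u = evec (?\<phi> (fst u)) k" using L_evec[OF u'] .
      show ?thesis
        using L_prj[OF u]
        by (simp add: galL_evec[OF lin u' k] k tprj_Eamb bar_gal[OF lin tprj_in[OF u']] gal_lin_def)
          (metis tmap_gal_base[OF lin])
    qed
    show "?G u = tmap (tot B) {std} (gal_shadow R t s) u" if "p \<in> points (tot B)" "u \<in> vertical B p" for p u
    proof -
      note u = vertical_subset[OF that(2)]
      have "u \<in> tangent (tot B)" using u tangent_spaceD(1)[OF u] by (simp add: tangent_iff)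
      then show ?thesis using L_vert[OF that] by (simp add: tmap_gal_shadow[OF lin u] compose_def)
    qed
    show "affine_fun (\<lambda>y. snd (?G (tvec_of (tot B) c (fibre_pt c p y) w)) d)"
      if c: "c \<in> tot B" and d: "d \<in> {std}" and p: "p \<in> fst c" for c d p w
    proof -
      have t: "tvec_of (tot B) c (fibre_pt c p y) w \<in> tangent_space (tot B) (fibre_pt c p y)" for y
        using fibre_pt(1)[OF c p] c by (intro tvec_of_in[OF atlas_tot r1]) (simp add: charts_at_iff)
      show ?thesis
        using affine_fun_linear_comp[OF L_affine[OF c p, of w] linear_gal_lin[OF lin]] d
        unfolding G_std[OF t, symmetric] by simp
    qed
  qed
  moreover have "diff_embedding r (tangent_atlas (tot B)) (tangent_atlas {std}) ?G"
    unfolding diff_embedding_def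
  proof (intro conjI ballI)
    show "smooth_map r (tangent_atlas (tot B)) (tangent_atlas {std}) ?G" by (rule smooth_G)
    show "embedding_map (man_topology (tangent_atlas (tot B))) (man_topology (tangent_atlas {std})) ?G"
    proof (rule embedding_map_eq)
      show "embedding_map (man_topology (tangent_atlas (tot B))) (man_topology (tangent_atlas {std})) (Tgal R t s \<circ> F)"
        using emb by (intro embedding_map_compose[OF _ embedding_Tgal[OF R]]) (simp add: diff_embedding_def)
    qed (simp add: topspace_man_topology tangent_atlas_points compose_def)
    fix u C D assume C: "C \<in> charts_at (tangent_atlas (tot B)) u"
      and D: "D \<in> charts_at (tangent_atlas {std}) (?G u)" and u: "u \<in> points (tangent_atlas (tot B))"
    have CD: "C \<in> tangent_atlas (tot B)" "D \<in> tangent_atlas {std}" "u \<in> fst C"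
      using C D by (simp_all add: charts_at_iff)
    have D': "D \<in> charts_at (tangent_atlas {std}) (F u)"
      using CD(2) L_tangent[OF u[unfolded tangent_atlas_points]]
      by (simp add: charts_at_iff tangent_atlas_eq)
    note rp = rep[OF CD(1,2)]
    let ?f = "snd D \<circ> F \<circ> of_coords C"
    have x: "snd C u \<in> snd C ` fst C" using CD(3) by simp
    have "?f differentiable at (snd C u)" using rp x Cr_on_differentiable[OF _ r] by blast
    then have df: "(?f has_derivative frechet_derivative ?f (at (snd C u))) (at (snd C u))"
      using frechet_derivative_works by blast
    have "((\<lambda>x. ?h (?f x) + ((t, s), 0)) has_derivative (\<lambda>w. ?h (frechet_derivative ?f (at (snd C u)) w) + 0)) (at (snd C u))"
      using h by (intro has_derivative_add has_derivative_const bounded_linear.has_derivative[OF _ df])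
        (simp add: linear_conv_bounded_linear)
    then have "((snd D \<circ> ?G \<circ> of_coords C) has_derivative (\<lambda>w. ?h (frechet_derivative ?f (at (snd C u)) w) + 0)) (at (snd C u))"
      by (rule has_derivative_transform_within_open[OF _ _ x]) (use rp in auto)
    from frechet_derivative_at[OF this]
    have eq: "frechet_derivative (snd D \<circ> ?G \<circ> of_coords C) (at (snd C u)) = ?h \<circ> frechet_derivative ?f (at (snd C u))"
      by (simp add: comp_def)
    have "inj (frechet_derivative ?f (at (snd C u)))"
      using emb u C D' unfolding diff_embedding_def by blast
    then show "inj (frechet_derivative (snd D \<circ> ?G \<circ> of_coords C) (at (snd C u)))"
      unfolding eq by (rule inj_compose[OF h_inj])
  qed
  moreover have "diff_embedding (r + 1) (tot B) {std} (gal_shadow R t s)"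
    unfolding diff_embedding_def
  proof (intro conjI ballI)
    show "smooth_map (r + 1) (tot B) {std} (gal_shadow R t s)" by (rule gal_shadow_smooth(2)[OF lin])
    show "embedding_map (man_topology (tot B)) (man_topology {std}) (gal_shadow R t s)"
    proof (rule embedding_map_eq)
      show "embedding_map (man_topology (tot B)) (man_topology {std}) (gal_map R t s \<circ> ?\<phi>)"
        using emb_phi by (intro embedding_map_compose[OF _ embedding_gal_map[OF R]]) (simp add: diff_embedding_def)
    qed (simp add: topspace_man_topology)
    fix p c d assume p: "p \<in> points (tot B)" and c: "c \<in> charts_at (tot B) p"
      and d: "d \<in> charts_at {std} (gal_shadow R t s p)"
    let ?D = "frechet_derivative (?\<phi> \<circ> of_coords c) (at (snd c p))"
    have "frechet_derivative (gal_shadow R t s \<circ> of_coords c) (at (snd c p)) w = gal_lin R (?D w)" for w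
    proof -
      note t = tvec_of_in[OF atlas_tot r1 c, of w]
      show ?thesis
        using tmap_gal_shadow[OF lin t, of t s] tmap_phi[OF c t]
          affine_placement.tmap_phi[OF affine_placement.intro[OF smooth_affine_bundle_axioms
            affine_placement_axioms.intro[OF gal_shadow_Aff[OF lin]]] c t, of t s]
        by (simp add: Tgal_evec[OF lin] snd_tvec_of[OF atlas_tot c])
    qed
    then have "frechet_derivative (snd d \<circ> gal_shadow R t s \<circ> of_coords c) (at (snd c p)) = gal_lin R \<circ> ?D"
      using d by (simp add: fun_eq_iff)
    moreover have "inj ?D"
      using emb_phi p c unfolding diff_embedding_def by fastforce
    ultimately show "inj (frechet_derivative (snd d \<circ> gal_shadow R t s \<circ> of_coords c) (at (snd c p)))"
      using inj_compose[OF gal_lin_inj[OF R]] by metis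
  qed
  ultimately show ?thesis by (simp add: Conf_def sh)
qed

lemma II_galL:
  fixes B :: "('p, real^3, 'q, 'b::euclidean_space) affbundle"
  assumes B: "smooth_affine_bundle r B" and F: "F \<in> Conf r B" and R: "orthogonal_transformation R"
  shows "II B (compose (tangent (tot B)) (Tgal R t s) F) = II B F"
proof -
  interpret F: placement r B F by (rule Conf_placement[OF B F])
  interpret T: placement r B "Tshadow B F" by (rule Tshadow_placement[OF B F])
  show ?thesis
    unfolding II_def F.Tshadow_galL[OF orth_linear[OF R]]
    by (simp only: F.pull_metric_galL[OF R] F.pull_form_galL[OF R] T.pull_form_galL[OF R])
qed

lemma Conf_funcset:
  fixes B :: "('p, real^3, 'q, 'b::euclidean_space) affbundle"
  assumes B: "smooth_affine_bundle r B" and F: "F \<in> Conf r B"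
  shows "F \<in> tangent (tot B) \<rightarrow> tangent {std}" and "F \<in> extensional (tangent (tot B))"
proof -
  interpret F: placement r B F by (rule Conf_placement[OF B F])
  show "F \<in> tangent (tot B) \<rightarrow> tangent {std}" using F.L_tangent by blast
  show "F \<in> extensional (tangent (tot B))" using F by (simp add: Conf_def Lpa_def)
qed

lemma group_action_Conf:
  fixes B :: "('p, real^3, 'q, 'b::euclidean_space) affbundle"
  assumes B: "smooth_affine_bundle r B"
  shows "group_action (gen_Gal_group r) (Conf r B) (left_action r B)"
proof -
  let ?E = "Conf r B" and ?T = "tangent (tot B)"
  have closed: "compose ?T g F \<in> ?E" if "g \<in> gen_Gal r" "F \<in> ?E" for g F
    using that(1) by (rule gen_Gal_E) (simp add: galL_Conf[OF B that(2)])
  \<comment> \<open>Multiplication in the group is composition restricted to ambient tangent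
    vectors. Nothing is lost, since conformations take their values there.\<close>
  have comp: "compose ?T g (compose ?T h F) = compose ?T (compose (tangent {std}) g h) F"
    if "F \<in> ?E" for g h F
    using compose_assoc[OF Conf_funcset(1)[OF B that]] .
  have one: "compose ?T (\<lambda>U\<in>tangent {std}. U) F = F" if "F \<in> ?E" for F
    using Id_compose[OF Conf_funcset[OF B that]] .
  have inverse: "\<exists>g'\<in>gen_Gal r. \<forall>F\<in>?E. compose ?T g' (compose ?T g F) = F \<and> compose ?T g (compose ?T g' F) = F"
    if g: "g \<in> gen_Gal r" for g
  proof -
    interpret G: group "gen_Gal_group r" by (rule group_gen_Gal)
    have gc: "g \<in> carrier (gen_Gal_group r)" using g by (simp add: gen_Gal_group_def)
    define g' where "g' = m_inv (gen_Gal_group r) g"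
    have "g' \<in> carrier (gen_Gal_group r)" unfolding g'_def using gc by simp
    moreover have "compose (tangent {std}) g' g = (\<lambda>U\<in>tangent {std}. U)"
      "compose (tangent {std}) g g' = (\<lambda>U\<in>tangent {std}. U)"
      using G.l_inv[OF gc] G.r_inv[OF gc] by (simp_all add: g'_def gen_Gal_group_def)
    ultimately show ?thesis
      by (intro bexI[of _ g']) (simp_all add: comp one gen_Gal_group_def)
  qed
  have bij: "left_action r B g \<in> Bij ?E" if g: "g \<in> gen_Gal r" for g
  proof -
    obtain g' where g': "g' \<in> gen_Gal r" and inv: "\<And>F. F \<in> ?E \<Longrightarrow> compose ?T g' (compose ?T g F) = F"
      "\<And>F. F \<in> ?E \<Longrightarrow> compose ?T g (compose ?T g' F) = F" using inverse[OF g] by blast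
    have "bij_betw (left_action r B g) ?E ?E"
      by (rule bij_betwI[where g="left_action r B g'"])
        (simp_all add: left_action_def closed g g' inv)
    then show ?thesis by (simp add: Bij_def left_action_def)
  qed
  have "left_action r B \<in> hom (gen_Gal_group r) (BijGroup ?E)"
  proof (rule homI)
    show "left_action r B g \<in> carrier (BijGroup ?E)" if "g \<in> carrier (gen_Gal_group r)" for g
      using bij that by (simp add: BijGroup_def gen_Gal_group_def)
    fix g h assume "g \<in> carrier (gen_Gal_group r)" "h \<in> carrier (gen_Gal_group r)"
    then have gh: "g \<in> gen_Gal r" "h \<in> gen_Gal r" by (simp_all add: gen_Gal_group_def)
    have "left_action r B (compose (tangent {std}) g h) = compose ?E (left_action r B g) (left_action r B h)"
      unfolding left_action_def compose_def[of ?E]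
      by (rule restrict_ext) (simp add: comp closed[OF gh(2)])
    then show "left_action r B (g \<otimes>\<^bsub>gen_Gal_group r\<^esub> h) =
        left_action r B g \<otimes>\<^bsub>BijGroup ?E\<^esub> left_action r B h"
      using bij gh by (simp add: BijGroup_def gen_Gal_group_def)
  qed
  then show ?thesis
    unfolding group_action_def group_hom_def group_hom_axioms_def
    using group_gen_Gal group_BijGroup by blast
qed

section \<open>Completeness of the invariants\<close>

text \<open>Product rule for an operator acting on a moving vector, where the operator is only known
  to be differentiable on basis vectors. Keeping the operator part as a basis sum allows it to be
  isolated later.\<close>

lemma has_derivative_linear_apply:
  fixes H :: "'a::real_normed_vector \<Rightarrow> 'c::euclidean_space \<Rightarrow> 'd::real_normed_vector"
  assumes S: "open S" "x \<in> S" and lin: "\<And>x. x \<in> S \<Longrightarrow> linear (H x)"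
    and H: "\<And>b. b \<in> Basis \<Longrightarrow> ((\<lambda>x. H x b) has_derivative H' b) (at x)"
    and h: "(h has_derivative h') (at x)"
  shows "((\<lambda>x. H x (h x)) has_derivative
    (\<lambda>k. (\<Sum>b\<in>Basis. (h x \<bullet> b) *\<^sub>R H' b k) + H x (h' k))) (at x)"
proof -
  have "((\<lambda>x. \<Sum>b\<in>Basis. (h x \<bullet> b) *\<^sub>R H x b) has_derivative
      (\<lambda>k. \<Sum>b\<in>Basis. (h x \<bullet> b) *\<^sub>R H' b k + (h' k \<bullet> b) *\<^sub>R H x b)) (at x)"
    by (intro has_derivative_sum has_derivative_scaleR has_derivative_inner_left H h)
  moreover have "(\<Sum>b\<in>Basis. (h x \<bullet> b) *\<^sub>R H' b k + (h' k \<bullet> b) *\<^sub>R H x b) =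
      (\<Sum>b\<in>Basis. (h x \<bullet> b) *\<^sub>R H' b k) + H x (h' k)" for k
    using linear_euclidean_sum[OF lin[OF S(2)], of "h' k"] by (simp add: sum.distrib)
  ultimately have "((\<lambda>x. \<Sum>b\<in>Basis. (h x \<bullet> b) *\<^sub>R H x b) has_derivative
      (\<lambda>k. (\<Sum>b\<in>Basis. (h x \<bullet> b) *\<^sub>R H' b k) + H x (h' k))) (at x)" by simp
  then show ?thesis
    by (rule has_derivative_transform_within_open[OF _ S]) (simp add: linear_euclidean_sum[OF lin, symmetric])
qed

text \<open>Vertical vectors are enough: \<open>A\<close> is onto, so they determine
  \<open>R\<close> even when \<open>L\<close> is not onto. The image of the base point then fixes
  \<open>t\<close> and \<open>s\<close>.\<close>

lemma (in placement) Tgal_unique: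
  assumes R: "linear R" and R': "linear R'" and p: "p \<in> points (tot B)"
    and eq: "\<And>u. u \<in> tangent_space (tot B) p \<Longrightarrow> Tgal R t s (L u) = Tgal R' t' s' (L u)"
  shows "R = R' \<and> t = t' \<and> s = s'"
proof -
  obtain c where cp: "c \<in> charts_at (tot B) p" using p unfolding points_iff by blast
  then have c: "c \<in> tot B" and z: "snd c p \<in> snd c ` fst c" by (simp_all add: charts_at_iff)
  have *: "gal_map R t s (shadow B L p) = gal_map R' t' s' (shadow B L p) \<and>
      R (microA c (fst (snd c p)) w) = R' (microA c (fst (snd c p)) w)" for w
    using eq[OF vertical_subset[OF vertical_tvec_of[OF cp]], of w] L_vertical[OF cp vertical_tvec_of[OF cp, of w]]
    by (simp add: snd_tvec_of[OF atlas_tot cp] Tgal_evec R R' gal_lin_Pair_zero)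
  have "R v = R' v" for v
    using * microA_invA[OF c z, of v] by metis
  then have "R = R'" by blast
  then show ?thesis using * by (simp add: gal_map_def)
qed

text \<open>Equal metrics make \<open>R = A' A\<^sup>-\<^sup>1\<close> preserve inner products.
  Equal forms say \<open>A\<^sup>-\<^sup>1 X = A'\<^sup>-\<^sup>1 X'\<close>, hence
  \<open>X' = R X\<close>, for the base block and for the block \<open>G\<close>; the vertical block
  satisfies it by the choice of \<open>R\<close>. Stated for placements, it serves for the
  conformations and for the tangent maps of their shadows.\<close>

lemma placement_compare:
  fixes B :: "('p, real^3, 'q, 'b::euclidean_space) affbundle"
  assumes P: "placement r B L" and Q: "placement r B L'"
    and met: "pull_metric B L g_vv = pull_metric B L' g_vv"
    and th: "pull_form B Eamb L theta_E = pull_form B Eamb L' theta_E"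
    and ga: "pull_form B Eamb L gamma_E = pull_form B Eamb L' gamma_E"
    and c: "c \<in> tot B" and z: "z \<in> snd c ` fst c"
  defines "R \<equiv> \<lambda>v. affine_placement.microA (shadow B L') c (fst z)
    (inv_into UNIV (affine_placement.microA (shadow B L) c (fst z)) v)"
  shows "orthogonal_transformation R \<and> (\<forall>w. placement.Lc B L' c z w = gal_lin R (placement.Lc B L c z w))"
proof -
  interpret P: placement r B L by fact
  interpret Q: placement r B L' by fact
  let ?p = "of_coords c z"
  note p = of_coords_in[OF z]
  have zp: "snd c ?p = z" by (rule snd_of_coords[OF z])
  have cp: "c \<in> charts_at (tot B) ?p" using c p by (simp add: charts_at_iff)
  obtain b where b: "trivialises B c b" using P.trivialises_ex[OF c] .
  note b' = P.trivialisesD(4)[OF b p]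
  let ?A = "P.microA c (fst z)" and ?A' = "Q.microA c (fst z)"
  have R: "R v = ?A' (P.invA c (fst z) v)" for v by (simp add: R_def)
  have RA: "R (?A w) = ?A' w" for w
    unfolding R using P.microA_inj[OF c z] by (simp add: inv_f_f)
  have lin: "linear R"
    unfolding R using linear_compose[OF P.invA_linear[OF c z] Q.microA_linear[OF c z]] by (simp add: comp_def)
  have "?A w \<bullet> ?A w' = ?A' w \<bullet> ?A' w'" for w w'
    using fun_cong[OF met, of "(tvec_of (tot B) c ?p (0, w), tvec_of (tot B) c ?p (0, w'))"]
      P.pull_metric_eq[OF cp P.vertical_tvec_of[OF cp, of w] P.vertical_tvec_of[OF cp, of w']]
      Q.pull_metric_eq[OF cp P.vertical_tvec_of[OF cp, of w] P.vertical_tvec_of[OF cp, of w']]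
    by (simp add: zp snd_tvec_of[OF P.atlas_tot cp])
  then have "R v \<bullet> R w = v \<bullet> w" for v w
    unfolding R using P.microA_invA[OF c z] by metis
  then have orth: "orthogonal_transformation R" using lin by (simp add: orthogonal_transformation_def)
  have "Q.Lc c z (dx, 0) = gal_lin R (P.Lc c z (dx, 0))" for dx
  proof -
    let ?u = "tvec_of (bas B) b (prj B ?p) dx"
    have u: "?u \<in> tangent_space (bas B) (prj B ?p)" by (rule tvec_of_in[OF P.atlas_bas P.r1 b'])
    have snd_u: "snd ?u b = dx" by (rule snd_tvec_of[OF P.atlas_bas b'])
    have "snd (pull_form B Eamb L theta_E (?p, ?u)) c = snd (pull_form B Eamb L' theta_E (?p, ?u)) c"
      "snd (pull_form B Eamb L gamma_E (?p, ?u)) c = snd (pull_form B Eamb L' gamma_E (?p, ?u)) c"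
      by (simp_all add: th ga)
    then have 1: "P.invA c (fst z) (fst (P.Lc c z (dx, 0))) = Q.invA c (fst z) (fst (Q.Lc c z (dx, 0)))"
      and 2: "P.invA c (fst z) (snd (P.Lc c z (dx, 0))) = Q.invA c (fst z) (snd (Q.Lc c z (dx, 0)))"
      unfolding P.pull_theta[OF b p u] Q.pull_theta[OF b p u] P.pull_gamma[OF b p u] Q.pull_gamma[OF b p u]
      by (simp_all add: zp snd_u snd_tvec_of[OF P.atlas_tot cp])
    show ?thesis
      unfolding gal_lin_def R 1 2 by (simp add: Q.microA_invA[OF c z])
  qed
  then have "Q.Lc c z (dx, dy) = gal_lin R (P.Lc c z (dx, dy))" for dx dy
    unfolding P.Lc_split[OF c z, of dx dy] Q.Lc_split[OF c z, of dx dy]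
    by (simp add: linear_add[OF linear_gal_lin[OF lin]] gal_lin_Pair_zero[OF lin] RA)
  then show ?thesis using orth by auto
qed

text \<open>Turns the comparison of the tangent maps into an equation between the derivatives of the
  two shadows in a chart.\<close>

lemma Lc_Tshadow:
  fixes B :: "('p, real^3, 'q, 'b::euclidean_space) affbundle"
  assumes B: "smooth_affine_bundle r B" and F: "F \<in> Conf r B" and c: "c \<in> tot B" and z: "z \<in> snd c ` fst c"
  shows "placement.Lc B (Tshadow B F) c z w = frechet_derivative (shadow B F \<circ> of_coords c) (at z) w"
proof -
  interpret placement r B F by (rule Conf_placement[OF B F])
  have cp: "c \<in> charts_at (tot B) (of_coords c z)" using c of_coords_in[OF z] by (simp add: charts_at_iff)
  show ?thesis
    unfolding placement.Lc_def[OF Tshadow_placement[OF B F]]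
    unfolding Tshadow_def
    using tmap_phi[OF cp tvec_of_in[OF atlas_tot r1 cp]] snd_of_coords[OF z]
    by (simp add: snd_tvec_of[OF atlas_tot cp])
qed

lemma II_complete:
  fixes B :: "('p, real^3, 'q, 'b::euclidean_space) affbundle"
  assumes B: "smooth_affine_bundle r B" and F1: "F1 \<in> Conf r B" and F2: "F2 \<in> Conf r B"
    and II: "II B F1 = II B F2"
  shows "\<exists>g\<in>gen_Gal r. F2 = compose (tangent (tot B)) g F1"
proof -
  interpret F1: placement r B F1 by (rule Conf_placement[OF B F1])
  interpret F2: placement r B F2 by (rule Conf_placement[OF B F2])
  let ?\<phi>1 = "shadow B F1" and ?\<phi>2 = "shadow B F2"
  note sh1 = shadow_Tshadow[OF B F1] and sh2 = shadow_Tshadow[OF B F2]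
  have met: "pull_metric B F1 g_vv = pull_metric B F2 g_vv"
    and th: "pull_form B Eamb F1 theta_E = pull_form B Eamb F2 theta_E"
    and ga: "pull_form B Eamb F1 gamma_E = pull_form B Eamb F2 gamma_E"
    and gT: "pull_form B Eamb (Tshadow B F1) gamma_E = pull_form B Eamb (Tshadow B F2) gamma_E"
    using II by (simp_all add: II_def)
  have metT: "pull_metric B (Tshadow B F1) g_vv = pull_metric B (Tshadow B F2) g_vv"
    and thT: "pull_form B Eamb (Tshadow B F1) theta_E = pull_form B Eamb (Tshadow B F2) theta_E"
    using met th II_Tshadow[OF B F1] II_Tshadow[OF B F2] by simp_all
  \<comment> \<open>Still depends on the chart and on \<open>x\<close>; both dependences have to be
    removed. It does not depend on the height in the fibre.\<close>
  define \<rho> where "\<rho> c x v = F2.microA c x (F1.invA c x v)" for c x v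
  have orth: "orthogonal_transformation (\<rho> c (fst z))"
    and Lc: "F2.Lc c z w = gal_lin (\<rho> c (fst z)) (F1.Lc c z w)"
    if "c \<in> tot B" "z \<in> snd c ` fst c" for c z w
    using placement_compare[OF F1.placement_axioms F2.placement_axioms met th ga that]
    by (simp_all add: \<rho>_def[abs_def])
  \<comment> \<open>The same \<rho> serves here as for \<open>F1\<close> and \<open>F2\<close>,
    because \<open>microA\<close> is read from the shadows and \<open>Tshadow\<close> does not
    change them.\<close>
  have D\<phi>: "frechet_derivative (?\<phi>2 \<circ> of_coords c) (at z) w =
      gal_lin (\<rho> c (fst z)) (frechet_derivative (?\<phi>1 \<circ> of_coords c) (at z) w)"
    if "c \<in> tot B" "z \<in> snd c ` fst c" for c z w
    using placement_compare[OF Tshadow_placement[OF B F1] Tshadow_placement[OF B F2] metT thT gT that]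
      Lc_Tshadow[OF B F1 that] Lc_Tshadow[OF B F2 that]
    by (simp add: \<rho>_def[abs_def] sh1 sh2)
  have der_\<phi>1: "((?\<phi>1 \<circ> of_coords c) has_derivative frechet_derivative (?\<phi>1 \<circ> of_coords c) (at z)) (at z)"
    and der_\<phi>2: "((?\<phi>2 \<circ> of_coords c) has_derivative frechet_derivative (?\<phi>2 \<circ> of_coords c) (at z)) (at z)"
    if "c \<in> tot B" "z \<in> snd c ` fst c" for c z
    using F1.phi_chart_differentiable[OF that] F2.phi_chart_differentiable[OF that]
    by (simp_all only: frechet_derivative_works[symmetric])
  \<comment> \<open>Since \<open>A\<^sub>1(x) w\<close> is the difference of the shadow at heights
    \<open>w\<close> and 0, its derivative is a difference of two horizontal derivatives. Everything
    is viewed as a function on the total chart, so the fibre part of \<open>h\<close> is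
    dropped.\<close>
  define dA1 where "dA1 c x w h = snd (frechet_derivative (?\<phi>1 \<circ> of_coords c) (at (x, w)) (fst h, 0)) -
      snd (frechet_derivative (?\<phi>1 \<circ> of_coords c) (at (x, 0)) (fst h, 0))"
    for c and x :: 'b and w :: R3 and h :: "'b \<times> R3"
  have vert: "((\<lambda>z. snd ((\<phi> \<circ> of_coords c) (fst z, w))) has_derivative
      (\<lambda>h. snd (frechet_derivative (\<phi> \<circ> of_coords c) (at (fst z, w)) (fst h, 0)))) (at z)"
    if "((\<phi> \<circ> of_coords c) has_derivative frechet_derivative (\<phi> \<circ> of_coords c) (at (fst z, w))) (at (fst z, w))"
    for c w and z :: "'b \<times> R3" and \<phi> :: "'p \<Rightarrow> R3 \<times> R3"
  proof -
    have "((\<lambda>z :: 'b \<times> R3. (fst z, w)) has_derivative (\<lambda>h. (fst h, 0))) (at z)"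
      by (intro has_derivative_Pair has_derivative_fst has_derivative_ident has_derivative_const)
    from has_derivative_snd[OF has_derivative_compose[OF this that]] show ?thesis .
  qed
  have line: "(fst z, w) \<in> snd c ` fst c" if "c \<in> tot B" "z \<in> snd c ` fst c" for c z w
    using F1.chart_vertical_line[OF that(1), of "fst z" "snd z" w] that(2) by simp
  have dA1: "((\<lambda>z. F1.microA c (fst z) w) has_derivative dA1 c (fst z) w) (at z)"
    and dA2: "((\<lambda>z. F2.microA c (fst z) w) has_derivative (\<lambda>h. \<rho> c (fst z) (dA1 c (fst z) w h))) (at z)"
    if cz: "c \<in> tot B" "z \<in> snd c ` fst c" for c z w
  proof -
    show "((\<lambda>z. F1.microA c (fst z) w) has_derivative dA1 c (fst z) w) (at z)"
      using has_derivative_diff[OF vert[OF der_\<phi>1[OF cz(1) line[OF cz, of w]]] vert[OF der_\<phi>1[OF cz(1) line[OF cz, of 0]]]]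
      by (simp add: F1.microA_def dA1_def[abs_def])
    have "((\<lambda>z. F2.microA c (fst z) w) has_derivative
        (\<lambda>h. snd (frechet_derivative (?\<phi>2 \<circ> of_coords c) (at (fst z, w)) (fst h, 0)) -
          snd (frechet_derivative (?\<phi>2 \<circ> of_coords c) (at (fst z, 0)) (fst h, 0)))) (at z)"
      using has_derivative_diff[OF vert[OF der_\<phi>2[OF cz(1) line[OF cz, of w]]] vert[OF der_\<phi>2[OF cz(1) line[OF cz, of 0]]]]
      by (simp add: F2.microA_def)
    \<comment> \<open>Both heights carry the same \<open>\<rho> c (fst z)\<close>, which therefore
      factors out of the difference.\<close>
    then show "((\<lambda>z. F2.microA c (fst z) w) has_derivative (\<lambda>h. \<rho> c (fst z) (dA1 c (fst z) w h))) (at z)"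
      unfolding D\<phi>[OF cz(1) line[OF cz, of w]] D\<phi>[OF cz(1) line[OF cz, of 0]]
      using linear_diff[OF orth_linear[OF orth[OF cz]]] by (simp add: gal_lin_def dA1_def)
  qed
  \<comment> \<open>Differentiating \<open>A\<^sub>2 = \<rho> A\<^sub>1\<close> and comparing with \<open>dA\<^sub>2 = \<rho> dA\<^sub>1\<close>, the product rule leaves
      \<open>d\<rho> A\<^sub>1 = 0\<close>.\<close>
  have d\<rho>: "((\<lambda>z. \<rho> c (fst z) b) has_derivative (\<lambda>h. 0)) (at z)"
    if c: "c \<in> tot B" and z: "z \<in> snd c ` fst c" and b: "b \<in> Basis" for c z b
  proof -
    let ?W = "snd c ` fst c"
    have W: "open ?W" by (rule open_chart_image[OF F1.atlas_tot c])
    \<comment> \<open>Differentiability of \<rho> has to be known before the product rule is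
      applied; it comes from regularity of \<open>A\<^sub>2\<close> and of the inverse of
      \<open>A\<^sub>1\<close>.\<close>
    have "Cr_on r (\<lambda>z. F2.microA c (fst z) (F1.invA c (fst z) v)) ?W" for v
      by (rule Cr_on_linear_apply[OF W, where H="\<lambda>z. F2.microA c (fst z)"])
        (use F2.microA_linear[OF c] F2.microA_Cr[OF c] F1.invA_Cr[OF c Cr_on_const[OF W]] in auto)
    then have "(\<lambda>z. \<rho> c (fst z) v) differentiable (at z)" for v
      unfolding \<rho>_def using Cr_on_differentiable[OF _ F1.r z] by blast
    then have D: "((\<lambda>z. \<rho> c (fst z) v) has_derivative frechet_derivative (\<lambda>z. \<rho> c (fst z) v) (at z)) (at z)" for v
      by (simp only: frechet_derivative_works[symmetric])
    let ?D = "\<lambda>v. frechet_derivative (\<lambda>z. \<rho> c (fst z) v) (at z)"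
    have lin: "linear (\<rho> c (fst z))" if "z \<in> ?W" for z by (rule orth_linear[OF orth[OF c that]])
    \<comment> \<open>This vector is frozen at \<open>z\<close>. Nearby, \<rho> applied to
      \<open>A\<^sub>1 ?w\<close> is \<open>A\<^sub>2 ?w\<close>, and at \<open>z\<close> itself
      \<open>A\<^sub>1 ?w\<close> is the basis vector \<open>b\<close>, so the surviving term is the
      derivative of \<rho> on \<open>b\<close>.\<close>
    let ?w = "F1.invA c (fst z) b"
    have Aw: "F1.microA c (fst z) ?w = b" by (rule F1.microA_invA[OF c z])
    have 1: "((\<lambda>z. \<rho> c (fst z) (F1.microA c (fst z) ?w)) has_derivative
        (\<lambda>h. (\<Sum>b'\<in>Basis. (F1.microA c (fst z) ?w \<bullet> b') *\<^sub>R ?D b' h) + \<rho> c (fst z) (dA1 c (fst z) ?w h))) (at z)"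
      by (rule has_derivative_linear_apply[OF W z lin D dA1[OF c z]])
    have 2: "((\<lambda>z. \<rho> c (fst z) (F1.microA c (fst z) ?w)) has_derivative
        (\<lambda>h. \<rho> c (fst z) (dA1 c (fst z) ?w h))) (at z)"
    proof (rule has_derivative_transform_within_open[OF dA2[OF c z] W z])
      show "F2.microA c (fst z') ?w = \<rho> c (fst z') (F1.microA c (fst z') ?w)" if "z' \<in> ?W" for z'
        unfolding \<rho>_def using F1.microA_inj[OF c that] by (simp add: inv_f_f)
    qed
    have "(\<Sum>b'\<in>Basis. (b \<bullet> b') *\<^sub>R ?D b' h) = 0" for h
      using fun_cong[OF has_derivative_unique[OF 1 2], of h] by (simp add: Aw)
    moreover have "(\<Sum>b'\<in>Basis. (b \<bullet> b') *\<^sub>R ?D b' h) = ?D b h" for h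
    proof -
      have "(\<Sum>b'\<in>Basis. (b \<bullet> b') *\<^sub>R ?D b' h) = (\<Sum>b'\<in>Basis. if b' = b then ?D b h else 0)"
        using b by (intro sum.cong) (auto simp: inner_Basis)
      then show ?thesis using b by simp
    qed
    ultimately have "?D b = (\<lambda>h. 0)" by (auto simp: fun_eq_iff)
    then show ?thesis using D[of b] by simp
  qed
  \<comment> \<open>Unlike \<rho>, this relation mentions no chart, so values found in different
    charts can be compared.\<close>
  define G where "G p v \<longleftrightarrow> (case v of (R, t, s) \<Rightarrow> orthogonal_transformation R \<and>
    (\<forall>u\<in>tangent_space (tot B) p. F2 u = Tgal R t s (F1 u)))" for p and v :: "(R3 \<Rightarrow> R3) \<times> R3 \<times> R3"
  have G_I: "G q (R, t, s)"
    if cq: "c \<in> charts_at (tot B) q" and R: "\<rho> c (fst (snd c q)) = R" and q: "?\<phi>2 q = gal_map R t s (?\<phi>1 q)" for c q R t s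
  proof -
    have c: "c \<in> tot B" and z: "snd c q \<in> snd c ` fst c" using cq by (simp_all add: charts_at_iff)
    have "F2 u = Tgal R t s (F1 u)" if u: "u \<in> tangent_space (tot B) q" for u
      unfolding F1.L_eq[OF cq u] F2.L_eq[OF cq u] Lc[OF c z] R q
      using orth_linear[OF orth[OF c z]] by (simp add: R Tgal_evec)
    then show ?thesis using orth[OF c z] by (simp add: G_def R)
  qed
  let ?X = "man_topology (tot B)"
  have top: "topspace ?X = points (tot B)" by (rule topspace_man_topology)
  have ex: "\<exists>v. G p v" if p: "p \<in> points (tot B)" for p
  proof -
    obtain c where cp: "c \<in> charts_at (tot B) p" using p unfolding points_iff by blast
    let ?R = "\<rho> c (fst (snd c p))"
    \<comment> \<open>With \<open>?R\<close> given, the translations are forced by the images of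
      \<open>p\<close> under the two shadows.\<close>
    have "G p (?R, fst (?\<phi>2 p) - ?R (fst (?\<phi>1 p)), snd (?\<phi>2 p) - ?R (snd (?\<phi>1 p)))"
      by (rule G_I[OF cp refl]) (simp add: gal_map_def)
    then show ?thesis by blast
  qed
  have uniq: "v = v'" if p: "p \<in> points (tot B)" and G: "G p v" "G p v'" for p v v'
  proof -
    obtain R t s where v: "v = (R, t, s)" by (cases v)
    obtain R' t' s' where v': "v' = (R', t', s')" by (cases v')
    have "R = R' \<and> t = t' \<and> s = s'"
      by (rule F1.Tgal_unique[OF _ _ p]) (use G v v' orth_linear in \<open>auto simp: G_def\<close>)
    then show ?thesis using v v' by simp
  qed
  have loc: "\<exists>N. openin ?X N \<and> p \<in> N \<and> (\<forall>q\<in>N. G q v)" if p: "p \<in> points (tot B)" and G: "G p v" for p v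
  proof -
    obtain c where cp: "c \<in> charts_at (tot B) p" using p unfolding points_iff by blast
    then have c: "c \<in> tot B" and pc: "p \<in> fst c" and z0: "snd c p \<in> snd c ` fst c"
      by (simp_all add: charts_at_iff)
    let ?R = "\<rho> c (fst (snd c p))"
    define t where "t = fst (?\<phi>2 p) - ?R (fst (?\<phi>1 p))"
    define s where "s = snd (?\<phi>2 p) - ?R (snd (?\<phi>1 p))"
    have p_gal: "?\<phi>2 p = gal_map ?R t s (?\<phi>1 p)" by (simp add: gal_map_def t_def s_def)
    \<comment> \<open>However \<open>v\<close> was obtained, uniqueness identifies it with the
      triple computed in the chart \<open>c\<close>.\<close>
    have v: "v = (?R, t, s)" by (rule uniq[OF p G G_I[OF cp refl p_gal]])
    \<comment> \<open>A ball, since convexity is what lets a zero derivative give a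
      constant.\<close>
    obtain e where e: "e > 0" "ball (snd c p) e \<subseteq> snd c ` fst c"
      using open_chart_image[OF F1.atlas_tot c] z0 open_contains_ball by blast
    have p_ball: "snd c p \<in> ball (snd c p) e" using e by simp
    have \<rho>_const: "\<rho> c (fst z) = ?R" if z: "z \<in> ball (snd c p) e" for z
    proof (rule linear_eq_stdbasis)
      show "linear (\<rho> c (fst z))" "linear ?R" using orth_linear[OF orth[OF c]] z e z0 by blast+
      fix b :: R3 assume b: "b \<in> Basis"
      have "\<exists>k. \<forall>z\<in>ball (snd c p) e. \<rho> c (fst z) b = k"
        by (rule has_derivative_zero_constant[OF convex_ball])
          (use d\<rho>[OF c _ b] e(2) in \<open>blast intro: has_derivative_at_withinI\<close>)
      then show "\<rho> c (fst z) b = ?R b" using z p_ball by metis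
    qed
    have lin: "linear (gal_lin ?R)" by (rule linear_gal_lin[OF orth_linear[OF orth[OF c z0]]])
    \<comment> \<open>With \<rho> constant on the ball, the derivatives of the shadows differ by a
      fixed linear map, so the shadows differ by that map and a translation.\<close>
    have "\<exists>k. \<forall>z\<in>ball (snd c p) e. (?\<phi>2 \<circ> of_coords c) z - gal_lin ?R ((?\<phi>1 \<circ> of_coords c) z) = k"
    proof (rule has_derivative_zero_constant[OF convex_ball])
      fix z assume z: "z \<in> ball (snd c p) e"
      then have zW: "z \<in> snd c ` fst c" using e by blast
      have "((\<lambda>z. (?\<phi>2 \<circ> of_coords c) z - gal_lin ?R ((?\<phi>1 \<circ> of_coords c) z)) has_derivative
          (\<lambda>h. frechet_derivative (?\<phi>2 \<circ> of_coords c) (at z) h -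
            gal_lin ?R (frechet_derivative (?\<phi>1 \<circ> of_coords c) (at z) h))) (at z)"
        using lin by (intro has_derivative_diff der_\<phi>2[OF c zW] bounded_linear.has_derivative[OF _ der_\<phi>1[OF c zW]])
          (simp add: linear_conv_bounded_linear)
      then show "((\<lambda>z. (?\<phi>2 \<circ> of_coords c) z - gal_lin ?R ((?\<phi>1 \<circ> of_coords c) z)) has_derivative (\<lambda>h. 0))
          (at z within ball (snd c p) e)"
        unfolding D\<phi>[OF c zW] \<rho>_const[OF z] by (simp add: has_derivative_at_withinI)
    qed
    then obtain k where k: "\<And>z. z \<in> ball (snd c p) e \<Longrightarrow>
        (?\<phi>2 \<circ> of_coords c) z - gal_lin ?R ((?\<phi>1 \<circ> of_coords c) z) = k" by blast
    let ?N = "fst c \<inter> snd c -` ball (snd c p) e"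
    have kq: "?\<phi>2 q - gal_lin ?R (?\<phi>1 q) = k" if q: "q \<in> ?N" for q
      using k[of "snd c q"] q of_coords_snd[OF F1.atlas_tot c, of q] by simp
    have "p \<in> ?N" using pc p_ball by simp
    have "k = (t, s)" using kq[OF \<open>p \<in> ?N\<close>] by (simp add: p_gal gal_map_affine)
    have "G q v" if q: "q \<in> ?N" for q
      unfolding v
    proof (rule G_I)
      show "c \<in> charts_at (tot B) q" using c q by (simp add: charts_at_iff)
      show "\<rho> c (fst (snd c q)) = ?R" using \<rho>_const q by simp
      show "?\<phi>2 q = gal_map ?R t s (?\<phi>1 q)"
        using kq[OF q] \<open>k = (t, s)\<close> by (simp add: gal_map_affine algebra_simps)
    qed
    then show ?thesis
      using openin_man_topology[OF c open_ball] \<open>p \<in> ?N\<close> by blast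
  qed
  have "\<exists>v. \<forall>p\<in>points (tot B). G p v"
  proof (cases "points (tot B) = {}")
    case False
    show ?thesis
      by (rule connected_space_locally_constant_relation[OF F1.connected_tot, of G, unfolded top,
            OF False ex uniq loc])
  qed simp
  then obtain v where v: "\<forall>p\<in>points (tot B). G p v" by (rule exE)
  obtain R t s where Rts: "v = (R, t, s)" by (cases v)
  show ?thesis
  \<comment> \<open>\<open>connected_space\<close> admits the empty space. There \<open>G\<close>
    yields no orthogonality, but both conformations are the function undefined everywhere and the
    identity element relates them.\<close>
  proof (cases "points (tot B) = {}")
    case True
    then have "tangent (tot B) = {}" by (simp add: tangent_def)
    then have "F2 = compose (tangent (tot B)) (Tgal id 0 0) F1"
      using Conf_funcset(2)[OF B F2] by (simp add: compose_def extensional_def fun_eq_iff)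
    then show ?thesis using gen_Gal_I[OF orthogonal_transformation_id[folded id_def]] by blast
  next
    case False
    then have R: "orthogonal_transformation R" using v by (auto simp: G_def Rts)
    have "F2 = compose (tangent (tot B)) (Tgal R t s) F1"
    proof (rule extensionalityI[OF Conf_funcset(2)[OF B F2] compose_extensional])
      fix u assume u: "u \<in> tangent (tot B)"
      then have u': "u \<in> tangent_space (tot B) (fst u)" by (simp add: tangent_iff)
      have "G (fst u) v" using v tangent_spaceD(2)[OF u'] by (rule bspec)
      then show "F2 u = compose (tangent (tot B)) (Tgal R t s) F1 u"
        using u u' by (simp add: G_def Rts compose_eq)
    qed
    then show ?thesis using gen_Gal_I[OF R] by blast
  qed
qed

theorem mainTheorem1:
  fixes r :: enat
    and B :: "('p, real^3, 'q, 'b::euclidean_space) affbundle"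
  assumes "1 \<le> r"
    and "affine_bundle (r + 1) B"
    and "DIM('b) \<in> {1, 2, 3}"
  shows
    "(\<forall>F\<in>Conf r B.
        II B F \<in> micro_metrics r B \<times> Sold r B \<times> Con r B \<times> Con r B \<and>
        II B F = (pull_metric B (Tshadow B F) g_vv, pull_form B Eamb (Tshadow B F) theta_E,
                  pull_form B Eamb F gamma_E, pull_form B Eamb (Tshadow B F) gamma_E)) \<and>
     group_action (gen_Gal_group r) (Conf r B) (left_action r B) \<and>
     (\<forall>F\<in>Conf r B. \<forall>F'\<in>orbit (gen_Gal_group r) (left_action r B) F. II B F' = II B F) \<and>
     (\<exists>\<Phi>. (\<forall>F\<in>Conf r B. \<Phi> (orbit (gen_Gal_group r) (left_action r B) F) = II B F) \<and>
          bij_betw \<Phi> (orbits (gen_Gal_group r) (Conf r B) (left_action r B)) (II B ` Conf r B)) \<and>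
     (\<forall>F1\<in>Conf r B. \<forall>F2\<in>Conf r B.
        orbit (gen_Gal_group r) (left_action r B) F1 = orbit (gen_Gal_group r) (left_action r B) F2
        \<longleftrightarrow> II B F1 = II B F2)"
proof -
  have B: "smooth_affine_bundle r B" using assms(1,2) by (rule smooth_affine_bundle.intro)
  let ?G = "gen_Gal_group r" and ?E = "Conf r B" and ?\<phi> = "left_action r B"
  interpret A: group_action ?G ?E ?\<phi> by (rule group_action_Conf[OF B])
  have inv: "II B F' = II B F" if F: "F \<in> ?E" and F': "F' \<in> orbit ?G ?\<phi> F" for F F'
  proof -
    obtain g where g: "g \<in> gen_Gal r" "F' = ?\<phi> g F" using F' by (auto simp: orbit_def gen_Gal_group_def)
    obtain R t s where R: "g = Tgal R t s" "orthogonal_transformation R" using g(1) by (rule gen_Gal_E)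
    show ?thesis using II_galL[OF B F R(2)] by (simp add: g(2) R(1) left_action_def F)
  qed
  have complete: "F2 \<in> orbit ?G ?\<phi> F1" if F: "F1 \<in> ?E" "F2 \<in> ?E" and II: "II B F1 = II B F2" for F1 F2
  proof -
    obtain g where "g \<in> gen_Gal r" "F2 = compose (tangent (tot B)) g F1"
      using II_complete[OF B F II] by blast
    then show ?thesis using F by (auto simp: orbit_def gen_Gal_group_def left_action_def)
  qed
  \<comment> \<open>One direction is invariance, as each conformation lies in its own orbit; the
    other is completeness. The induced map is well defined by the first and injective by the
    second.\<close>
  have orbit_eq: "orbit ?G ?\<phi> F1 = orbit ?G ?\<phi> F2 \<longleftrightarrow> II B F1 = II B F2"
    if F: "F1 \<in> ?E" "F2 \<in> ?E" for F1 F2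
  proof
    assume eq: "orbit ?G ?\<phi> F1 = orbit ?G ?\<phi> F2"
    have "F2 \<in> orbit ?G ?\<phi> F1" unfolding eq by (rule A.orbit_refl[OF F(2)])
    from inv[OF F(1) this] show "II B F1 = II B F2" by simp
  next
    assume II: "II B F1 = II B F2"
    have sub: "orbit ?G ?\<phi> F \<subseteq> orbit ?G ?\<phi> F'" if "F \<in> ?E" "F' \<in> ?E" "II B F = II B F'" for F F'
    proof
      fix H assume H: "H \<in> orbit ?G ?\<phi> F"
      then have "H \<in> ?E" using A.element_image[OF _ that(1)] by (auto simp: orbit_def)
      then show "H \<in> orbit ?G ?\<phi> F'" using complete[OF that(2)] inv[OF that(1) H] that(3) by simp
    qed
    show "orbit ?G ?\<phi> F1 = orbit ?G ?\<phi> F2"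
      using sub[OF F II] sub[OF F(2,1) II[symmetric]] by blast
  qed
  \<comment> \<open>The representative of the orbit is arbitrary; \<open>orbit_eq\<close> shows that
    the value does not depend on it.\<close>
  define \<Phi> where "\<Phi> = (\<lambda>Z. II B (SOME F. F \<in> ?E \<and> orbit ?G ?\<phi> F = Z))"
  have \<Phi>: "\<Phi> (orbit ?G ?\<phi> F) = II B F" if F: "F \<in> ?E" for F
  proof -
    define F' where "F' = (SOME F'. F' \<in> ?E \<and> orbit ?G ?\<phi> F' = orbit ?G ?\<phi> F)"
    have "F' \<in> ?E \<and> orbit ?G ?\<phi> F' = orbit ?G ?\<phi> F" unfolding F'_def by (rule someI[of _ F]) (simp add: F)
    then show ?thesis using orbit_eq[OF _ F, of F'] by (simp add: \<Phi>_def F'_def)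
  qed
  have orbits_eq: "orbits ?G ?E ?\<phi> = orbit ?G ?\<phi> ` ?E" by (auto simp: orbits_def)
  have "bij_betw \<Phi> (orbits ?G ?E ?\<phi>) (II B ` ?E)"
    unfolding bij_betw_def orbits_eq inj_on_def
    by (auto simp: \<Phi> orbit_eq image_image)
  moreover have "II B F = (pull_metric B (Tshadow B F) g_vv, pull_form B Eamb (Tshadow B F) theta_E,
      pull_form B Eamb F gamma_E, pull_form B Eamb (Tshadow B F) gamma_E)" if "F \<in> ?E" for F
    using II_Tshadow[OF B that] by (simp add: II_def)
  ultimately show ?thesis
    using II_mem[OF B] A.group_action_axioms inv \<Phi> orbit_eq by blast
qed

end
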